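(* Let $\mathcal{C}$ be a pointed bicomplete closed symmetric monoidal category. The cokernel functor $\mathrm{coker}\colon \mathrm{Arr}\,\mathcal{C}\to\mathrm{Arr}\,\mathcal{C}$ is a (strongly) symmetric monoidal functor from the pushout product monoidal structure on $\mathrm{Arr}\,\mathcal{C}$ to the tensor product monoidal structure on $\mathrm{Arr}\,\mathcal{C}$. Its right adjoint is the kernel functor $\ker\colon \mathrm{Arr}\,\mathcal{C}\to\mathrm{Arr}\,\mathcal{C}$.
   Context: $\mathrm{Arr}\,\mathcal{C}$ is the category whose objects are morphisms of $\mathcal{C}$ and whose morphisms are commutative squares. For $f\colon X_0\to X_1$ and $g\colon Y_0\to Y_1$: the tensor product monoidal structure has product $f\otimes g\colon X_0\otimes Y_0\to X_1\otimes Y_1$ and unit $1_S\colon S\to S$, where $S$ is the unit of $\mathcal{C}$; the pushout product monoidal structure has product $f\mathbin{\square} g\colon (X_0\otimes Y_1)\amalg_{X_0\otimes Y_0}(X_1\otimes Y_0)\to X_1\otimes Y_1$ and unit $0\to S$. Pointed means that the initial object $0$ is also terminal. The cokernel functor sends $f\colon A\to B$ to the map $B\to B/A$, where $B/A=\mathrm{coker} f$ is the pushout of $0\leftarrow A\xrightarrow{f}B$; the kernel functor sends $p\colon X\to Y$ to the map $\ker p\to X$, where $\ker p$ is the pullback of $0\to Y\xleftarrow{p}X$. *)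

theory Defs
  imports Main
begin

section \<open>Categories and functors\<close>

record ('o, 'm) cat =
  Ob :: "'o set"
  Ar :: "'m set"
  Dom :: "'m \<Rightarrow> 'o"
  Cod :: "'m \<Rightarrow> 'o"
  Idt :: "'o \<Rightarrow> 'm" ("\<one>\<index>")
  Comp :: "'m \<Rightarrow> 'm \<Rightarrow> 'm" (infixr "\<circ>\<index>" 65)

definition hom :: "('o, 'm, 'z) cat_scheme \<Rightarrow> 'o \<Rightarrow> 'o \<Rightarrow> 'm set" where
  "hom C X Y = {f \<in> Ar C. Dom C f = X \<and> Cod C f = Y}"

locale category =
  fixes C :: "('o, 'm, 'z) cat_scheme" (structure)
  assumes Dom_Ob: "f \<in> Ar C \<Longrightarrow> Dom C f \<in> Ob C"
    and Cod_Ob: "f \<in> Ar C \<Longrightarrow> Cod C f \<in> Ob C"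
    and Idt_hom: "X \<in> Ob C \<Longrightarrow> \<one> X \<in> hom C X X"
    and Comp_hom: "f \<in> hom C X Y \<Longrightarrow> g \<in> hom C Y Z \<Longrightarrow> g \<circ> f \<in> hom C X Z"
    and Comp_Idt_left: "f \<in> hom C X Y \<Longrightarrow> \<one> Y \<circ> f = f"
    and Comp_Idt_right: "f \<in> hom C X Y \<Longrightarrow> f \<circ> \<one> X = f"
    and Comp_assoc:
      "f \<in> hom C W X \<Longrightarrow> g \<in> hom C X Y \<Longrightarrow> h \<in> hom C Y Z \<Longrightarrow> (h \<circ> g) \<circ> f = h \<circ> g \<circ> f"

definition is_iso :: "('o, 'm, 'z) cat_scheme \<Rightarrow> 'm \<Rightarrow> bool" where
  "is_iso C f \<longleftrightarrow> f \<in> Ar C \<and>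
     (\<exists>g \<in> hom C (Cod C f) (Dom C f).
        g \<circ>\<^bsub>C\<^esub> f = \<one>\<^bsub>C\<^esub> (Dom C f) \<and> f \<circ>\<^bsub>C\<^esub> g = \<one>\<^bsub>C\<^esub> (Cod C f))"

record ('o, 'm, 'p, 'n) ftor =
  ObMap :: "'o \<Rightarrow> 'p"
  ArMap :: "'m \<Rightarrow> 'n"

locale cat_functor = A: category A + B: category B
  for A :: "('o, 'm, 'y) cat_scheme" and B :: "('p, 'n, 'z) cat_scheme" +
  fixes F :: "('o, 'm, 'p, 'n) ftor"
  assumes ObMap_Ob: "X \<in> Ob A \<Longrightarrow> ObMap F X \<in> Ob B"
    and ArMap_hom: "f \<in> hom A X Y \<Longrightarrow> ArMap F f \<in> hom B (ObMap F X) (ObMap F Y)"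
    and ArMap_Idt: "X \<in> Ob A \<Longrightarrow> ArMap F (\<one>\<^bsub>A\<^esub> X) = \<one>\<^bsub>B\<^esub> (ObMap F X)"
    and ArMap_Comp: "f \<in> hom A X Y \<Longrightarrow> g \<in> hom A Y Z \<Longrightarrow>
      ArMap F (g \<circ>\<^bsub>A\<^esub> f) = ArMap F g \<circ>\<^bsub>B\<^esub> ArMap F f"

definition is_right_adjoint ::
  "('o, 'm, 'y) cat_scheme \<Rightarrow> ('p, 'n, 'z) cat_scheme \<Rightarrow>
   ('o, 'm, 'p, 'n) ftor \<Rightarrow> ('p, 'n, 'o, 'm) ftor \<Rightarrow> bool" where
  "is_right_adjoint A B F G \<longleftrightarrow>
     cat_functor A B F \<and> cat_functor B A G \<and>
     (\<exists>\<phi>.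
       (\<forall>X \<in> Ob A. \<forall>Y \<in> Ob B.
          bij_betw (\<phi> X Y) (hom B (ObMap F X) Y) (hom A X (ObMap G Y))) \<and>
       (\<forall>X \<in> Ob A. \<forall>X' \<in> Ob A. \<forall>Y \<in> Ob B. \<forall>Y' \<in> Ob B.
          \<forall>a \<in> hom A X' X. \<forall>h \<in> hom B (ObMap F X) Y. \<forall>b \<in> hom B Y Y'.
            \<phi> X' Y' (b \<circ>\<^bsub>B\<^esub> h \<circ>\<^bsub>B\<^esub> ArMap F a) = ArMap G b \<circ>\<^bsub>A\<^esub> \<phi> X Y h \<circ>\<^bsub>A\<^esub> a))"


section \<open>Limits and colimits\<close>

definition is_cone ::
  "('i, 'j, 'y) cat_scheme \<Rightarrow> ('o, 'm, 'z) cat_scheme \<Rightarrow> ('i, 'j, 'o, 'm) ftor \<Rightarrow>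
   'o \<Rightarrow> ('i \<Rightarrow> 'm) \<Rightarrow> bool" where
  "is_cone J C D L p \<longleftrightarrow> L \<in> Ob C \<and>
     (\<forall>j \<in> Ob J. p j \<in> hom C L (ObMap D j)) \<and>
     (\<forall>u \<in> Ar J. ArMap D u \<circ>\<^bsub>C\<^esub> p (Dom J u) = p (Cod J u))"

definition is_limit ::
  "('i, 'j, 'y) cat_scheme \<Rightarrow> ('o, 'm, 'z) cat_scheme \<Rightarrow> ('i, 'j, 'o, 'm) ftor \<Rightarrow>
   'o \<Rightarrow> ('i \<Rightarrow> 'm) \<Rightarrow> bool" where
  "is_limit J C D L p \<longleftrightarrow> is_cone J C D L p \<and>
     (\<forall>L' q. is_cone J C D L' q \<longrightarrow>
        (\<exists>!h. h \<in> hom C L' L \<and> (\<forall>j \<in> Ob J. p j \<circ>\<^bsub>C\<^esub> h = q j)))"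

definition is_cocone ::
  "('i, 'j, 'y) cat_scheme \<Rightarrow> ('o, 'm, 'z) cat_scheme \<Rightarrow> ('i, 'j, 'o, 'm) ftor \<Rightarrow>
   'o \<Rightarrow> ('i \<Rightarrow> 'm) \<Rightarrow> bool" where
  "is_cocone J C D L p \<longleftrightarrow> L \<in> Ob C \<and>
     (\<forall>j \<in> Ob J. p j \<in> hom C (ObMap D j) L) \<and>
     (\<forall>u \<in> Ar J. p (Cod J u) \<circ>\<^bsub>C\<^esub> ArMap D u = p (Dom J u))"

definition is_colimit ::
  "('i, 'j, 'y) cat_scheme \<Rightarrow> ('o, 'm, 'z) cat_scheme \<Rightarrow> ('i, 'j, 'o, 'm) ftor \<Rightarrow>
   'o \<Rightarrow> ('i \<Rightarrow> 'm) \<Rightarrow> bool" where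
  "is_colimit J C D L p \<longleftrightarrow> is_cocone J C D L p \<and>
     (\<forall>L' q. is_cocone J C D L' q \<longrightarrow>
        (\<exists>!h. h \<in> hom C L L' \<and> (\<forall>j \<in> Ob J. h \<circ>\<^bsub>C\<^esub> p j = q j)))"

text \<open>
  The type \<open>'i\<close> bounds the size of the index categories: all limits and colimits over categories
  whose objects and arrows are elements of \<open>'i\<close>. It has to be independent of the object and arrow
  types of \<open>C\<close>: a category with products indexed by its own set of arrows is a preorder.
\<close>

definition bicomplete :: "'i itself \<Rightarrow> ('o, 'm, 'z) cat_scheme \<Rightarrow> bool" where
  "bicomplete (_ :: 'i itself) C \<longleftrightarrow>
     (\<forall>(J :: ('i, 'i) cat) D. cat_functor J C D \<longrightarrow>
        (\<exists>L p. is_limit J C D L p) \<and> (\<exists>L p. is_colimit J C D L p))"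

definition is_initial :: "('o, 'm, 'z) cat_scheme \<Rightarrow> 'o \<Rightarrow> bool" where
  "is_initial C Z \<longleftrightarrow> Z \<in> Ob C \<and> (\<forall>X \<in> Ob C. \<exists>!f. f \<in> hom C Z X)"

definition is_terminal :: "('o, 'm, 'z) cat_scheme \<Rightarrow> 'o \<Rightarrow> bool" where
  "is_terminal C Z \<longleftrightarrow> Z \<in> Ob C \<and> (\<forall>X \<in> Ob C. \<exists>!f. f \<in> hom C X Z)"

definition pointed :: "('o, 'm, 'z) cat_scheme \<Rightarrow> bool" where
  "pointed C \<longleftrightarrow> (\<exists>Z. is_initial C Z \<and> is_terminal C Z)"

definition zero_ob :: "('o, 'm, 'z) cat_scheme \<Rightarrow> 'o" where
  "zero_ob C = (SOME Z. is_initial C Z)"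

definition from_zero :: "('o, 'm, 'z) cat_scheme \<Rightarrow> 'o \<Rightarrow> 'm" where
  "from_zero C X = (THE f. f \<in> hom C (zero_ob C) X)"

definition to_zero :: "('o, 'm, 'z) cat_scheme \<Rightarrow> 'o \<Rightarrow> 'm" where
  "to_zero C X = (THE f. f \<in> hom C X (zero_ob C))"

text \<open>\<open>(i, j)\<close> is the pair of coprojections of a pushout of the span \<open>(f, g)\<close>, with \<open>i\<close> defined on
  \<open>Cod f\<close> and \<open>j\<close> on \<open>Cod g\<close>.\<close>

definition is_pushout :: "('o, 'm, 'z) cat_scheme \<Rightarrow> 'm \<Rightarrow> 'm \<Rightarrow> 'm \<Rightarrow> 'm \<Rightarrow> bool" where
  "is_pushout C f g i j \<longleftrightarrow>
     f \<in> Ar C \<and> g \<in> Ar C \<and> i \<in> Ar C \<and> j \<in> Ar C \<and>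
     Dom C f = Dom C g \<and> Dom C i = Cod C f \<and> Dom C j = Cod C g \<and> Cod C i = Cod C j \<and>
     i \<circ>\<^bsub>C\<^esub> f = j \<circ>\<^bsub>C\<^esub> g \<and>
     (\<forall>Z \<in> Ob C. \<forall>x \<in> hom C (Cod C f) Z. \<forall>y \<in> hom C (Cod C g) Z.
        x \<circ>\<^bsub>C\<^esub> f = y \<circ>\<^bsub>C\<^esub> g \<longrightarrow>
        (\<exists>!h. h \<in> hom C (Cod C i) Z \<and> h \<circ>\<^bsub>C\<^esub> i = x \<and> h \<circ>\<^bsub>C\<^esub> j = y))"

definition po_in :: "('o, 'm, 'z) cat_scheme \<Rightarrow> 'm \<Rightarrow> 'm \<Rightarrow> 'm \<times> 'm" where
  "po_in C f g = (SOME (i, j). is_pushout C f g i j)"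

definition po_inl :: "('o, 'm, 'z) cat_scheme \<Rightarrow> 'm \<Rightarrow> 'm \<Rightarrow> 'm" where
  "po_inl C f g = fst (po_in C f g)"

definition po_inr :: "('o, 'm, 'z) cat_scheme \<Rightarrow> 'm \<Rightarrow> 'm \<Rightarrow> 'm" where
  "po_inr C f g = snd (po_in C f g)"

definition po_ob :: "('o, 'm, 'z) cat_scheme \<Rightarrow> 'm \<Rightarrow> 'm \<Rightarrow> 'o" where
  "po_ob C f g = Cod C (po_inl C f g)"

definition po_desc :: "('o, 'm, 'z) cat_scheme \<Rightarrow> 'm \<Rightarrow> 'm \<Rightarrow> 'm \<Rightarrow> 'm \<Rightarrow> 'm" where
  "po_desc C f g x y =
     (THE h. h \<in> hom C (po_ob C f g) (Cod C x) \<and>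
        h \<circ>\<^bsub>C\<^esub> po_inl C f g = x \<and> h \<circ>\<^bsub>C\<^esub> po_inr C f g = y)"

definition is_pullback :: "('o, 'm, 'z) cat_scheme \<Rightarrow> 'm \<Rightarrow> 'm \<Rightarrow> 'm \<Rightarrow> 'm \<Rightarrow> bool" where
  "is_pullback C f g p q \<longleftrightarrow>
     f \<in> Ar C \<and> g \<in> Ar C \<and> p \<in> Ar C \<and> q \<in> Ar C \<and>
     Cod C f = Cod C g \<and> Cod C p = Dom C f \<and> Cod C q = Dom C g \<and> Dom C p = Dom C q \<and>
     f \<circ>\<^bsub>C\<^esub> p = g \<circ>\<^bsub>C\<^esub> q \<and>
     (\<forall>Z \<in> Ob C. \<forall>x \<in> hom C Z (Dom C f). \<forall>y \<in> hom C Z (Dom C g).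
        f \<circ>\<^bsub>C\<^esub> x = g \<circ>\<^bsub>C\<^esub> y \<longrightarrow>
        (\<exists>!h. h \<in> hom C Z (Dom C p) \<and> p \<circ>\<^bsub>C\<^esub> h = x \<and> q \<circ>\<^bsub>C\<^esub> h = y))"

definition pb_pr :: "('o, 'm, 'z) cat_scheme \<Rightarrow> 'm \<Rightarrow> 'm \<Rightarrow> 'm \<times> 'm" where
  "pb_pr C f g = (SOME (p, q). is_pullback C f g p q)"

definition pb_fst :: "('o, 'm, 'z) cat_scheme \<Rightarrow> 'm \<Rightarrow> 'm \<Rightarrow> 'm" where
  "pb_fst C f g = fst (pb_pr C f g)"

definition pb_snd :: "('o, 'm, 'z) cat_scheme \<Rightarrow> 'm \<Rightarrow> 'm \<Rightarrow> 'm" where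
  "pb_snd C f g = snd (pb_pr C f g)"

definition pb_ob :: "('o, 'm, 'z) cat_scheme \<Rightarrow> 'm \<Rightarrow> 'm \<Rightarrow> 'o" where
  "pb_ob C f g = Dom C (pb_fst C f g)"

definition pb_lift :: "('o, 'm, 'z) cat_scheme \<Rightarrow> 'm \<Rightarrow> 'm \<Rightarrow> 'm \<Rightarrow> 'm \<Rightarrow> 'm" where
  "pb_lift C f g x y =
     (THE h. h \<in> hom C (Dom C x) (pb_ob C f g) \<and>
        pb_fst C f g \<circ>\<^bsub>C\<^esub> h = x \<and> pb_snd C f g \<circ>\<^bsub>C\<^esub> h = y)"


section \<open>Symmetric monoidal categories\<close>

record ('o, 'm) smcat = "('o, 'm) cat" +
  TOb :: "'o \<Rightarrow> 'o \<Rightarrow> 'o" (infixr "\<otimes>\<^sub>o\<index>" 75)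
  TAr :: "'m \<Rightarrow> 'm \<Rightarrow> 'm" (infixr "\<otimes>\<index>" 75)
  TUnit :: 'o
  Assoc :: "'o \<Rightarrow> 'o \<Rightarrow> 'o \<Rightarrow> 'm"
  LUnit :: "'o \<Rightarrow> 'm"
  RUnit :: "'o \<Rightarrow> 'm"
  Symm :: "'o \<Rightarrow> 'o \<Rightarrow> 'm"

locale symmetric_monoidal_category = category C
  for C :: "('o, 'm, 'z) smcat_scheme" (structure) +
  assumes TUnit_Ob: "TUnit C \<in> Ob C"
    and TOb_Ob: "X \<in> Ob C \<Longrightarrow> Y \<in> Ob C \<Longrightarrow> X \<otimes>\<^sub>o Y \<in> Ob C"
    and TAr_hom: "f \<in> hom C X X' \<Longrightarrow> g \<in> hom C Y Y' \<Longrightarrow>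
      f \<otimes> g \<in> hom C (X \<otimes>\<^sub>o Y) (X' \<otimes>\<^sub>o Y')"
    and TAr_Idt: "X \<in> Ob C \<Longrightarrow> Y \<in> Ob C \<Longrightarrow> \<one> X \<otimes> \<one> Y = \<one> (X \<otimes>\<^sub>o Y)"
    and TAr_Comp: "f \<in> hom C X X' \<Longrightarrow> f' \<in> hom C X' X'' \<Longrightarrow>
      g \<in> hom C Y Y' \<Longrightarrow> g' \<in> hom C Y' Y'' \<Longrightarrow>
      (f' \<circ> f) \<otimes> (g' \<circ> g) = (f' \<otimes> g') \<circ> (f \<otimes> g)"
    and Assoc_hom: "X \<in> Ob C \<Longrightarrow> Y \<in> Ob C \<Longrightarrow> Z \<in> Ob C \<Longrightarrow>
      Assoc C X Y Z \<in> hom C ((X \<otimes>\<^sub>o Y) \<otimes>\<^sub>o Z) (X \<otimes>\<^sub>o Y \<otimes>\<^sub>o Z)"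
    and Assoc_iso: "X \<in> Ob C \<Longrightarrow> Y \<in> Ob C \<Longrightarrow> Z \<in> Ob C \<Longrightarrow> is_iso C (Assoc C X Y Z)"
    and Assoc_natural: "f \<in> hom C X X' \<Longrightarrow> g \<in> hom C Y Y' \<Longrightarrow> h \<in> hom C Z Z' \<Longrightarrow>
      Assoc C X' Y' Z' \<circ> ((f \<otimes> g) \<otimes> h) = (f \<otimes> g \<otimes> h) \<circ> Assoc C X Y Z"
    and LUnit_hom: "X \<in> Ob C \<Longrightarrow> LUnit C X \<in> hom C (TUnit C \<otimes>\<^sub>o X) X"
    and LUnit_iso: "X \<in> Ob C \<Longrightarrow> is_iso C (LUnit C X)"
    and LUnit_natural: "f \<in> hom C X X' \<Longrightarrow>
      LUnit C X' \<circ> (\<one> (TUnit C) \<otimes> f) = f \<circ> LUnit C X"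
    and RUnit_hom: "X \<in> Ob C \<Longrightarrow> RUnit C X \<in> hom C (X \<otimes>\<^sub>o TUnit C) X"
    and RUnit_iso: "X \<in> Ob C \<Longrightarrow> is_iso C (RUnit C X)"
    and RUnit_natural: "f \<in> hom C X X' \<Longrightarrow>
      RUnit C X' \<circ> (f \<otimes> \<one> (TUnit C)) = f \<circ> RUnit C X"
    and Symm_hom: "X \<in> Ob C \<Longrightarrow> Y \<in> Ob C \<Longrightarrow> Symm C X Y \<in> hom C (X \<otimes>\<^sub>o Y) (Y \<otimes>\<^sub>o X)"
    and Symm_natural: "f \<in> hom C X X' \<Longrightarrow> g \<in> hom C Y Y' \<Longrightarrow>
      Symm C X' Y' \<circ> (f \<otimes> g) = (g \<otimes> f) \<circ> Symm C X Y"
    and Symm_Symm: "X \<in> Ob C \<Longrightarrow> Y \<in> Ob C \<Longrightarrow> Symm C Y X \<circ> Symm C X Y = \<one> (X \<otimes>\<^sub>o Y)"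
    and pentagon: "W \<in> Ob C \<Longrightarrow> X \<in> Ob C \<Longrightarrow> Y \<in> Ob C \<Longrightarrow> Z \<in> Ob C \<Longrightarrow>
      (\<one> W \<otimes> Assoc C X Y Z) \<circ> Assoc C W (X \<otimes>\<^sub>o Y) Z \<circ> (Assoc C W X Y \<otimes> \<one> Z) =
      Assoc C W X (Y \<otimes>\<^sub>o Z) \<circ> Assoc C (W \<otimes>\<^sub>o X) Y Z"
    and triangle: "X \<in> Ob C \<Longrightarrow> Y \<in> Ob C \<Longrightarrow>
      (\<one> X \<otimes> LUnit C Y) \<circ> Assoc C X (TUnit C) Y = RUnit C X \<otimes> \<one> Y"
    and hexagon: "X \<in> Ob C \<Longrightarrow> Y \<in> Ob C \<Longrightarrow> Z \<in> Ob C \<Longrightarrow>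
      Assoc C Y Z X \<circ> Symm C X (Y \<otimes>\<^sub>o Z) \<circ> Assoc C X Y Z =
      (\<one> Y \<otimes> Symm C X Z) \<circ> Assoc C Y X Z \<circ> (Symm C X Y \<otimes> \<one> Z)"

definition tensor_right :: "('o, 'm, 'z) smcat_scheme \<Rightarrow> 'o \<Rightarrow> ('o, 'm, 'o, 'm) ftor" where
  "tensor_right C Y =
     \<lparr>ObMap = (\<lambda>X. X \<otimes>\<^sub>o\<^bsub>C\<^esub> Y), ArMap = (\<lambda>f. f \<otimes>\<^bsub>C\<^esub> \<one>\<^bsub>C\<^esub> Y)\<rparr>"

definition closed_monoidal :: "('o, 'm, 'z) smcat_scheme \<Rightarrow> bool" where
  "closed_monoidal C \<longleftrightarrow> (\<forall>Y \<in> Ob C. \<exists>G. is_right_adjoint C C (tensor_right C Y) G)"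

locale strong_symmetric_monoidal_structure =
  A: symmetric_monoidal_category A + B: symmetric_monoidal_category B + cat_functor A B F
  for A :: "('o, 'm, 'y) smcat_scheme" and B :: "('p, 'n, 'z) smcat_scheme"
    and F :: "('o, 'm, 'p, 'n) ftor" +
  fixes \<mu> :: "'o \<Rightarrow> 'o \<Rightarrow> 'n" and \<epsilon> :: 'n
  assumes mult_hom: "X \<in> Ob A \<Longrightarrow> Y \<in> Ob A \<Longrightarrow>
      \<mu> X Y \<in> hom B (ObMap F X \<otimes>\<^sub>o\<^bsub>B\<^esub> ObMap F Y) (ObMap F (X \<otimes>\<^sub>o\<^bsub>A\<^esub> Y))"
    and mult_iso: "X \<in> Ob A \<Longrightarrow> Y \<in> Ob A \<Longrightarrow> is_iso B (\<mu> X Y)"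
    and mult_natural: "f \<in> hom A X X' \<Longrightarrow> g \<in> hom A Y Y' \<Longrightarrow>
      \<mu> X' Y' \<circ>\<^bsub>B\<^esub> (ArMap F f \<otimes>\<^bsub>B\<^esub> ArMap F g) = ArMap F (f \<otimes>\<^bsub>A\<^esub> g) \<circ>\<^bsub>B\<^esub> \<mu> X Y"
    and unit_hom: "\<epsilon> \<in> hom B (TUnit B) (ObMap F (TUnit A))"
    and unit_iso: "is_iso B \<epsilon>"
    and associativity: "X \<in> Ob A \<Longrightarrow> Y \<in> Ob A \<Longrightarrow> Z \<in> Ob A \<Longrightarrow>
      ArMap F (Assoc A X Y Z) \<circ>\<^bsub>B\<^esub> \<mu> (X \<otimes>\<^sub>o\<^bsub>A\<^esub> Y) Z \<circ>\<^bsub>B\<^esub> (\<mu> X Y \<otimes>\<^bsub>B\<^esub> \<one>\<^bsub>B\<^esub> (ObMap F Z)) =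
      \<mu> X (Y \<otimes>\<^sub>o\<^bsub>A\<^esub> Z) \<circ>\<^bsub>B\<^esub> (\<one>\<^bsub>B\<^esub> (ObMap F X) \<otimes>\<^bsub>B\<^esub> \<mu> Y Z) \<circ>\<^bsub>B\<^esub>
        Assoc B (ObMap F X) (ObMap F Y) (ObMap F Z)"
    and left_unitality: "X \<in> Ob A \<Longrightarrow>
      ArMap F (LUnit A X) \<circ>\<^bsub>B\<^esub> \<mu> (TUnit A) X \<circ>\<^bsub>B\<^esub> (\<epsilon> \<otimes>\<^bsub>B\<^esub> \<one>\<^bsub>B\<^esub> (ObMap F X)) =
      LUnit B (ObMap F X)"
    and right_unitality: "X \<in> Ob A \<Longrightarrow>
      ArMap F (RUnit A X) \<circ>\<^bsub>B\<^esub> \<mu> X (TUnit A) \<circ>\<^bsub>B\<^esub> (\<one>\<^bsub>B\<^esub> (ObMap F X) \<otimes>\<^bsub>B\<^esub> \<epsilon>) =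
      RUnit B (ObMap F X)"
    and symmetry: "X \<in> Ob A \<Longrightarrow> Y \<in> Ob A \<Longrightarrow>
      ArMap F (Symm A X Y) \<circ>\<^bsub>B\<^esub> \<mu> X Y = \<mu> Y X \<circ>\<^bsub>B\<^esub> Symm B (ObMap F X) (ObMap F Y)"

definition strong_symmetric_monoidal_functor ::
  "('o, 'm, 'y) smcat_scheme \<Rightarrow> ('p, 'n, 'z) smcat_scheme \<Rightarrow> ('o, 'm, 'p, 'n) ftor \<Rightarrow> bool" where
  "strong_symmetric_monoidal_functor A B F \<longleftrightarrow>
     (\<exists>\<mu> \<epsilon>. strong_symmetric_monoidal_structure A B F \<mu> \<epsilon>)"


section \<open>The arrow category\<close>

text \<open>\<open>Square f g a b\<close> is the square from \<open>f\<close> to \<open>g\<close> with component \<open>a\<close> on the domains and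
  component \<open>b\<close> on the codomains.\<close>

datatype 'm square = Square (sq_src: 'm) (sq_tgt: 'm) (sq0: 'm) (sq1: 'm)

definition arrow_category :: "('o, 'm, 'z) cat_scheme \<Rightarrow> ('m, 'm square) cat" where
  "arrow_category C =
     \<lparr>Ob = Ar C,
      Ar = {Square f g a b | f g a b.
              f \<in> Ar C \<and> g \<in> Ar C \<and> a \<in> hom C (Dom C f) (Dom C g) \<and>
              b \<in> hom C (Cod C f) (Cod C g) \<and> b \<circ>\<^bsub>C\<^esub> f = g \<circ>\<^bsub>C\<^esub> a},
      Dom = sq_src,
      Cod = sq_tgt,
      Idt = (\<lambda>f. Square f f (\<one>\<^bsub>C\<^esub> (Dom C f)) (\<one>\<^bsub>C\<^esub> (Cod C f))),
      Comp = (\<lambda>t s. Square (sq_src s) (sq_tgt t) (sq0 t \<circ>\<^bsub>C\<^esub> sq0 s) (sq1 t \<circ>\<^bsub>C\<^esub> sq1 s))\<rparr>"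

definition arrow_tensor :: "('o, 'm, 'z) smcat_scheme \<Rightarrow> ('m, 'm square) smcat" where
  "arrow_tensor C =
     \<lparr>Ob = Ob (arrow_category C), Ar = Ar (arrow_category C),
      Dom = Dom (arrow_category C), Cod = Cod (arrow_category C),
      Idt = Idt (arrow_category C), Comp = Comp (arrow_category C),
      TOb = TAr C,
      TAr = (\<lambda>s t. Square (sq_src s \<otimes>\<^bsub>C\<^esub> sq_src t) (sq_tgt s \<otimes>\<^bsub>C\<^esub> sq_tgt t)
                     (sq0 s \<otimes>\<^bsub>C\<^esub> sq0 t) (sq1 s \<otimes>\<^bsub>C\<^esub> sq1 t)),
      TUnit = \<one>\<^bsub>C\<^esub> (TUnit C),
      Assoc = (\<lambda>f g h. Square ((f \<otimes>\<^bsub>C\<^esub> g) \<otimes>\<^bsub>C\<^esub> h) (f \<otimes>\<^bsub>C\<^esub> g \<otimes>\<^bsub>C\<^esub> h)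
                 (Assoc C (Dom C f) (Dom C g) (Dom C h))
                 (Assoc C (Cod C f) (Cod C g) (Cod C h))),
      LUnit = (\<lambda>f. Square (\<one>\<^bsub>C\<^esub> (TUnit C) \<otimes>\<^bsub>C\<^esub> f) f (LUnit C (Dom C f)) (LUnit C (Cod C f))),
      RUnit = (\<lambda>f. Square (f \<otimes>\<^bsub>C\<^esub> \<one>\<^bsub>C\<^esub> (TUnit C)) f (RUnit C (Dom C f)) (RUnit C (Cod C f))),
      Symm = (\<lambda>f g. Square (f \<otimes>\<^bsub>C\<^esub> g) (g \<otimes>\<^bsub>C\<^esub> f)
                (Symm C (Dom C f) (Dom C g)) (Symm C (Cod C f) (Cod C g)))\<rparr>"


section \<open>The pushout product monoidal structure\<close>

text \<open>For \<open>f: X0 \<rightarrow> X1\<close> and \<open>g: Y0 \<rightarrow> Y1\<close>, the domain of the pushout product is the pushout of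
  \<open>X0 \<otimes> Y1 \<leftarrow> X0 \<otimes> Y0 \<rightarrow> X1 \<otimes> Y0\<close>; \<open>pp_inl\<close> and \<open>pp_inr\<close> are its coprojections from
  \<open>X0 \<otimes> Y1\<close> and \<open>X1 \<otimes> Y0\<close>.\<close>

definition pp_inl :: "('o, 'm, 'z) smcat_scheme \<Rightarrow> 'm \<Rightarrow> 'm \<Rightarrow> 'm" where
  "pp_inl C f g = po_inl C (\<one>\<^bsub>C\<^esub> (Dom C f) \<otimes>\<^bsub>C\<^esub> g) (f \<otimes>\<^bsub>C\<^esub> \<one>\<^bsub>C\<^esub> (Dom C g))"

definition pp_inr :: "('o, 'm, 'z) smcat_scheme \<Rightarrow> 'm \<Rightarrow> 'm \<Rightarrow> 'm" where
  "pp_inr C f g = po_inr C (\<one>\<^bsub>C\<^esub> (Dom C f) \<otimes>\<^bsub>C\<^esub> g) (f \<otimes>\<^bsub>C\<^esub> \<one>\<^bsub>C\<^esub> (Dom C g))"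

definition pp_desc :: "('o, 'm, 'z) smcat_scheme \<Rightarrow> 'm \<Rightarrow> 'm \<Rightarrow> 'm \<Rightarrow> 'm \<Rightarrow> 'm" where
  "pp_desc C f g = po_desc C (\<one>\<^bsub>C\<^esub> (Dom C f) \<otimes>\<^bsub>C\<^esub> g) (f \<otimes>\<^bsub>C\<^esub> \<one>\<^bsub>C\<^esub> (Dom C g))"

definition pushout_product :: "('o, 'm, 'z) smcat_scheme \<Rightarrow> 'm \<Rightarrow> 'm \<Rightarrow> 'm"
    (infixr "\<box>\<index>" 75) where
  "pushout_product C f g =
     pp_desc C f g (f \<otimes>\<^bsub>C\<^esub> \<one>\<^bsub>C\<^esub> (Cod C g)) (\<one>\<^bsub>C\<^esub> (Cod C f) \<otimes>\<^bsub>C\<^esub> g)"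

definition pushout_product_map ::
  "('o, 'm, 'z) smcat_scheme \<Rightarrow> 'm square \<Rightarrow> 'm square \<Rightarrow> 'm square" where
  "pushout_product_map C s t =
     Square (sq_src s \<box>\<^bsub>C\<^esub> sq_src t) (sq_tgt s \<box>\<^bsub>C\<^esub> sq_tgt t)
       (pp_desc C (sq_src s) (sq_src t)
          (pp_inl C (sq_tgt s) (sq_tgt t) \<circ>\<^bsub>C\<^esub> (sq0 s \<otimes>\<^bsub>C\<^esub> sq1 t))
          (pp_inr C (sq_tgt s) (sq_tgt t) \<circ>\<^bsub>C\<^esub> (sq1 s \<otimes>\<^bsub>C\<^esub> sq0 t)))
       (sq1 s \<otimes>\<^bsub>C\<^esub> sq1 t)"

text \<open>The structure isomorphisms are those of \<open>C\<close> on codomains. On domains they are the maps of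
  iterated pushouts that restrict to the structure isomorphisms of \<open>C\<close> on each summand. In the
  associator the summands are \<open>(X0 \<otimes> Y1) \<otimes> Z1\<close>, \<open>(X1 \<otimes> Y0) \<otimes> Z1\<close> and \<open>(X1 \<otimes> Y1) \<otimes> Z0\<close>. In the
  unitors the other summand is \<open>0 \<otimes> X1\<close> or \<open>X1 \<otimes> 0\<close>, which is initial if \<open>C\<close> is closed.\<close>

definition pp_assoc0 :: "('o, 'm, 'z) smcat_scheme \<Rightarrow> 'm \<Rightarrow> 'm \<Rightarrow> 'm \<Rightarrow> 'm" where
  "pp_assoc0 C f g h =
     (THE t. t \<in> hom C (Dom C ((f \<box>\<^bsub>C\<^esub> g) \<box>\<^bsub>C\<^esub> h)) (Dom C (f \<box>\<^bsub>C\<^esub> g \<box>\<^bsub>C\<^esub> h)) \<and>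
        t \<circ>\<^bsub>C\<^esub> pp_inl C (f \<box>\<^bsub>C\<^esub> g) h \<circ>\<^bsub>C\<^esub> (pp_inl C f g \<otimes>\<^bsub>C\<^esub> \<one>\<^bsub>C\<^esub> (Cod C h)) =
          pp_inl C f (g \<box>\<^bsub>C\<^esub> h) \<circ>\<^bsub>C\<^esub> Assoc C (Dom C f) (Cod C g) (Cod C h) \<and>
        t \<circ>\<^bsub>C\<^esub> pp_inl C (f \<box>\<^bsub>C\<^esub> g) h \<circ>\<^bsub>C\<^esub> (pp_inr C f g \<otimes>\<^bsub>C\<^esub> \<one>\<^bsub>C\<^esub> (Cod C h)) =
          pp_inr C f (g \<box>\<^bsub>C\<^esub> h) \<circ>\<^bsub>C\<^esub> (\<one>\<^bsub>C\<^esub> (Cod C f) \<otimes>\<^bsub>C\<^esub> pp_inl C g h) \<circ>\<^bsub>C\<^esub>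
            Assoc C (Cod C f) (Dom C g) (Cod C h) \<and>
        t \<circ>\<^bsub>C\<^esub> pp_inr C (f \<box>\<^bsub>C\<^esub> g) h =
          pp_inr C f (g \<box>\<^bsub>C\<^esub> h) \<circ>\<^bsub>C\<^esub> (\<one>\<^bsub>C\<^esub> (Cod C f) \<otimes>\<^bsub>C\<^esub> pp_inr C g h) \<circ>\<^bsub>C\<^esub>
            Assoc C (Cod C f) (Cod C g) (Dom C h))"

definition pp_unit :: "('o, 'm, 'z) smcat_scheme \<Rightarrow> 'm" where
  "pp_unit C = from_zero C (TUnit C)"

definition pp_lunit0 :: "('o, 'm, 'z) smcat_scheme \<Rightarrow> 'm \<Rightarrow> 'm" where
  "pp_lunit0 C f =
     (THE t. t \<in> hom C (Dom C (pp_unit C \<box>\<^bsub>C\<^esub> f)) (Dom C f) \<and>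
        t \<circ>\<^bsub>C\<^esub> pp_inr C (pp_unit C) f = LUnit C (Dom C f))"

definition pp_runit0 :: "('o, 'm, 'z) smcat_scheme \<Rightarrow> 'm \<Rightarrow> 'm" where
  "pp_runit0 C f =
     (THE t. t \<in> hom C (Dom C (f \<box>\<^bsub>C\<^esub> pp_unit C)) (Dom C f) \<and>
        t \<circ>\<^bsub>C\<^esub> pp_inl C f (pp_unit C) = RUnit C (Dom C f))"

definition pp_symm0 :: "('o, 'm, 'z) smcat_scheme \<Rightarrow> 'm \<Rightarrow> 'm \<Rightarrow> 'm" where
  "pp_symm0 C f g =
     pp_desc C f g (pp_inr C g f \<circ>\<^bsub>C\<^esub> Symm C (Dom C f) (Cod C g))
                   (pp_inl C g f \<circ>\<^bsub>C\<^esub> Symm C (Cod C f) (Dom C g))"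

definition arrow_pushout_product :: "('o, 'm, 'z) smcat_scheme \<Rightarrow> ('m, 'm square) smcat" where
  "arrow_pushout_product C =
     \<lparr>Ob = Ob (arrow_category C), Ar = Ar (arrow_category C),
      Dom = Dom (arrow_category C), Cod = Cod (arrow_category C),
      Idt = Idt (arrow_category C), Comp = Comp (arrow_category C),
      TOb = pushout_product C,
      TAr = pushout_product_map C,
      TUnit = pp_unit C,
      Assoc = (\<lambda>f g h. Square ((f \<box>\<^bsub>C\<^esub> g) \<box>\<^bsub>C\<^esub> h) (f \<box>\<^bsub>C\<^esub> g \<box>\<^bsub>C\<^esub> h)
                 (pp_assoc0 C f g h) (Assoc C (Cod C f) (Cod C g) (Cod C h))),
      LUnit = (\<lambda>f. Square (pp_unit C \<box>\<^bsub>C\<^esub> f) f (pp_lunit0 C f) (LUnit C (Cod C f))),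
      RUnit = (\<lambda>f. Square (f \<box>\<^bsub>C\<^esub> pp_unit C) f (pp_runit0 C f) (RUnit C (Cod C f))),
      Symm = (\<lambda>f g. Square (f \<box>\<^bsub>C\<^esub> g) (g \<box>\<^bsub>C\<^esub> f)
                (pp_symm0 C f g) (Symm C (Cod C f) (Cod C g)))\<rparr>"


section \<open>Cokernel and kernel\<close>

definition coker :: "('o, 'm, 'z) cat_scheme \<Rightarrow> 'm \<Rightarrow> 'm" where
  "coker C f = po_inl C f (to_zero C (Dom C f))"

definition coker_functor ::
  "('o, 'm, 'z) cat_scheme \<Rightarrow> ('m, 'm square, 'm, 'm square) ftor" where
  "coker_functor C =
     \<lparr>ObMap = coker C,
      ArMap = (\<lambda>s. Square (coker C (sq_src s)) (coker C (sq_tgt s)) (sq1 s)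
        (po_desc C (sq_src s) (to_zero C (Dom C (sq_src s)))
           (coker C (sq_tgt s) \<circ>\<^bsub>C\<^esub> sq1 s)
           (po_inr C (sq_tgt s) (to_zero C (Dom C (sq_tgt s))))))\<rparr>"

definition ker :: "('o, 'm, 'z) cat_scheme \<Rightarrow> 'm \<Rightarrow> 'm" where
  "ker C p = pb_fst C p (from_zero C (Cod C p))"

definition ker_functor ::
  "('o, 'm, 'z) cat_scheme \<Rightarrow> ('m, 'm square, 'm, 'm square) ftor" where
  "ker_functor C =
     \<lparr>ObMap = ker C,
      ArMap = (\<lambda>s. Square (ker C (sq_src s)) (ker C (sq_tgt s))
        (pb_lift C (sq_tgt s) (from_zero C (Cod C (sq_tgt s)))
           (sq0 s \<circ>\<^bsub>C\<^esub> ker C (sq_src s))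
           (pb_snd C (sq_src s) (from_zero C (Cod C (sq_src s)))))
        (sq0 s))\<rparr>"

end

theory Submission
  imports Defs
begin

text \<open>
  Every equation here between arrows out of a glued object is checked on the pieces that it is glued
  from, where it becomes an equation of \<open>C\<close>.

  For \<open>f: X0 \<rightarrow> X1\<close> and \<open>g: Y0 \<rightarrow> Y1\<close>, the domain of \<open>f \<box> g\<close> is glued from \<open>X0 \<otimes> Y1\<close> and \<open>X1 \<otimes> Y0\<close>. As \<open>C\<close> is closed, tensoring with an
  object preserves pushouts (\<open>is_pushout_tensor_right\<close>), so iterated pushout products are glued in
  the same way from tensor products in which one factor \<open>X1\<close> is replaced by \<open>X0\<close>. On such a
  summand the coherence conditions of the pushout product are those of \<open>C\<close> for the objects of that
  summand; on codomains they are those of \<open>C\<close> outright. Summands that contain the domain \<open>0\<close> of the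
  unit are initial. The invertibility of the associator comes from two hexagons
  (\<open>pp_assoc0_iso\<close>), which saves gluing an inverse.

  The cokernel functor is monoidal because \<open>coker f \<otimes> coker g\<close> is a cokernel of \<open>f \<box> g\<close>
  (\<open>is_cokernel_pushout_product\<close>): to vanish on \<open>f \<box> g\<close> means to vanish on both \<open>f \<otimes> 1\<close> and
  \<open>1 \<otimes> g\<close>, hence to factor through \<open>coker f \<otimes> 1\<close> and then through \<open>1 \<otimes> coker g\<close>. The
  comparison \<open>coker f \<otimes> coker g \<rightarrow> coker (f \<box> g)\<close> is therefore invertible and is an identity on
  domains. A square out of an epimorphism is determined by its component on domains
  (\<open>cokernel_square_ext\<close>), and there all conditions on a monoidal functor are trivial.

  For the adjunction, squares \<open>coker f \<rightarrow> p\<close> and squares \<open>f \<rightarrow> ker p\<close> both amount to arrows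
  \<open>b: cod f \<rightarrow> dom p\<close> with \<open>p \<circ> b \<circ> f = 0\<close>, so transposition keeps \<open>b\<close>.
\<close>

no_notation comp (infixl "\<circ>" 55)

section \<open>Calculating with arrows\<close>

lemma in_hom: "f \<in> hom C X Y \<longleftrightarrow> f \<in> Ar C \<and> Dom C f = X \<and> Cod C f = Y"
  by (simp add: hom_def)

context category
begin

lemmas [simp] = Dom_Ob Cod_Ob

lemma Idt_simps [simp]:
  assumes "X \<in> Ob C"
  shows "\<one> X \<in> Ar C" "Dom C (\<one> X) = X" "Cod C (\<one> X) = X"
  using Idt_hom[OF assms] by (simp_all add: in_hom)

lemma Comp_simps [simp]:
  assumes "f \<in> Ar C" "g \<in> Ar C" "Dom C g = Cod C f"
  shows "g \<circ> f \<in> Ar C" "Dom C (g \<circ> f) = Dom C f" "Cod C (g \<circ> f) = Cod C g"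
  using Comp_hom[of f "Dom C f" "Cod C f" g "Cod C g"] assms by (simp_all add: in_hom)

lemma Idt_Comp [simp]: "f \<in> Ar C \<Longrightarrow> Cod C f = Y \<Longrightarrow> \<one> Y \<circ> f = f"
  using Comp_Idt_left[of f "Dom C f" Y] by (simp add: in_hom)

lemma Comp_Idt [simp]: "f \<in> Ar C \<Longrightarrow> Dom C f = X \<Longrightarrow> f \<circ> \<one> X = f"
  using Comp_Idt_right[of f X "Cod C f"] by (simp add: in_hom)

lemma assoc [simp]:
  "f \<in> Ar C \<Longrightarrow> g \<in> Ar C \<Longrightarrow> h \<in> Ar C \<Longrightarrow> Dom C g = Cod C f \<Longrightarrow> Dom C h = Cod C g \<Longrightarrow>
   (h \<circ> g) \<circ> f = h \<circ> g \<circ> f"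
  using Comp_assoc[of f "Dom C f" "Dom C g" g "Dom C h" h "Cod C h"] by (simp add: in_hom)

text \<open>The simplifier keeps composites associated to the right, so every equation between composites
  also needs a form in which its left-hand side is only an initial segment of a longer composite.\<close>

lemma Comp_eq_Comp:
  assumes "a \<circ> b = c" "a \<in> Ar C" "b \<in> Ar C" "Dom C a = Cod C b" "k \<in> Ar C" "Cod C k = Dom C b"
  shows "a \<circ> b \<circ> k = c \<circ> k"
  using assms by (metis assoc)

lemma Comp3_eq_Comp:
  assumes "a \<circ> b \<circ> d = c" "a \<in> Ar C" "b \<in> Ar C" "d \<in> Ar C" "Dom C a = Cod C b" "Dom C b = Cod C d"
    and "k \<in> Ar C" "Cod C k = Dom C d"
  shows "a \<circ> b \<circ> d \<circ> k = c \<circ> k"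
proof -
  have "a \<circ> b \<circ> d \<circ> k = (a \<circ> b \<circ> d) \<circ> k"
    using assms(2-8) by simp
  then show ?thesis
    using assms(1) by simp
qed

lemma isoI:
  assumes "f \<in> Ar C" "g \<in> Ar C" "Dom C g = Cod C f" "Cod C g = Dom C f"
    and "g \<circ> f = \<one> (Dom C f)" "f \<circ> g = \<one> (Cod C f)"
  shows "is_iso C f"
  unfolding is_iso_def using assms by (auto simp: in_hom intro: bexI[of _ g])

lemma isoE:
  assumes "is_iso C f"
  obtains g where "f \<in> Ar C" "g \<in> Ar C" "Dom C g = Cod C f" "Cod C g = Dom C f"
    "g \<circ> f = \<one> (Dom C f)" "f \<circ> g = \<one> (Cod C f)"
  using assms that unfolding is_iso_def by (auto simp: in_hom)

lemma iso_Idt: "X \<in> Ob C \<Longrightarrow> is_iso C (\<one> X)"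
  by (rule isoI[of _ "\<one> X"]) simp_all

lemma iso_cancel_right:
  assumes "is_iso C e" "u \<in> Ar C" "v \<in> Ar C" "Dom C u = Cod C e" "Dom C v = Cod C e"
    and "u \<circ> e = v \<circ> e"
  shows "u = v"
proof -
  obtain e' where e: "e \<in> Ar C" "e' \<in> Ar C" "Dom C e' = Cod C e" "Cod C e' = Dom C e"
    "e \<circ> e' = \<one> (Cod C e)"
    using assms(1) by (rule isoE)
  have "(u \<circ> e) \<circ> e' = (v \<circ> e) \<circ> e'"
    using assms(6) by simp
  then show ?thesis
    using assms(2-5) e by simp
qed

lemma is_initialD:
  assumes "is_initial C I"
  shows "I \<in> Ob C"
    and "u \<in> Ar C \<Longrightarrow> v \<in> Ar C \<Longrightarrow> Dom C u = I \<Longrightarrow> Dom C v = I \<Longrightarrow> Cod C u = Cod C v \<Longrightarrow> u = v"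
proof -
  show "I \<in> Ob C"
    using assms by (simp add: is_initial_def)
  assume "u \<in> Ar C" "v \<in> Ar C" "Dom C u = I" "Dom C v = I" "Cod C u = Cod C v"
  then have "u \<in> hom C I (Cod C u)" "v \<in> hom C I (Cod C u)" "Cod C u \<in> Ob C"
    by (auto simp: in_hom)
  then show "u = v"
    using assms unfolding is_initial_def by blast
qed

lemma is_initial_iso:
  assumes "is_initial C I" "is_iso C e" "Dom C e = I"
  shows "is_initial C (Cod C e)"
  unfolding is_initial_def
proof (intro conjI ballI)
  obtain e' where e: "e \<in> Ar C" "e' \<in> Ar C" "Dom C e' = Cod C e" "Cod C e' = Dom C e"
    using assms(2) by (rule isoE)
  show "Cod C e \<in> Ob C"
    using e by simp
  fix X assume "X \<in> Ob C"
  then obtain f where f: "f \<in> hom C I X"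
    using assms(1) unfolding is_initial_def by blast
  show "\<exists>!f. f \<in> hom C (Cod C e) X"
  proof (rule ex1I)
    show "f \<circ> e' \<in> hom C (Cod C e) X"
      using f e assms(3) by (simp add: in_hom)
    fix h assume h: "h \<in> hom C (Cod C e) X"
    show "h = f \<circ> e'"
    proof (rule iso_cancel_right[OF assms(2)])
      show "h \<circ> e = (f \<circ> e') \<circ> e"
        using h f e assms(3) by - (rule is_initialD(2)[OF assms(1)], simp_all add: in_hom)
    qed (use h f e assms(3) in \<open>simp_all add: in_hom\<close>)
  qed
qed


section \<open>Pushouts and pullbacks\<close>

lemma is_pushoutI:
  assumes "f \<in> Ar C" "g \<in> Ar C" "i \<in> Ar C" "j \<in> Ar C"
    and "Dom C f = Dom C g" "Dom C i = Cod C f" "Dom C j = Cod C g" "Cod C i = Cod C j"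
    and "i \<circ> f = j \<circ> g"
    and ext: "\<And>u v. u \<in> Ar C \<Longrightarrow> v \<in> Ar C \<Longrightarrow> Dom C u = Cod C i \<Longrightarrow> Dom C v = Cod C i \<Longrightarrow>
      Cod C u = Cod C v \<Longrightarrow> u \<circ> i = v \<circ> i \<Longrightarrow> u \<circ> j = v \<circ> j \<Longrightarrow> u = v"
    and desc: "\<And>x y. x \<in> Ar C \<Longrightarrow> y \<in> Ar C \<Longrightarrow> Dom C x = Cod C f \<Longrightarrow> Dom C y = Cod C g \<Longrightarrow>
      Cod C x = Cod C y \<Longrightarrow> x \<circ> f = y \<circ> g \<Longrightarrow>
      \<exists>h. h \<in> Ar C \<and> Dom C h = Cod C i \<and> Cod C h = Cod C x \<and> h \<circ> i = x \<and> h \<circ> j = y"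
  shows "is_pushout C f g i j"
  unfolding is_pushout_def
proof (intro conjI ballI impI)
  fix Z x y
  assume "x \<in> hom C (Cod C f) Z" "y \<in> hom C (Cod C g) Z" and eq: "x \<circ> f = y \<circ> g"
  then have xy: "x \<in> Ar C" "Dom C x = Cod C f" "Cod C x = Z" "y \<in> Ar C" "Dom C y = Cod C g" "Cod C y = Z"
    by (simp_all add: in_hom)
  have "\<exists>h. h \<in> Ar C \<and> Dom C h = Cod C i \<and> Cod C h = Cod C x \<and> h \<circ> i = x \<and> h \<circ> j = y"
    by (rule desc) (use xy eq in simp_all)
  then obtain h where h: "h \<in> Ar C \<and> Dom C h = Cod C i \<and> Cod C h = Cod C x \<and> h \<circ> i = x \<and> h \<circ> j = y"
    by (elim exE)
  show "\<exists>!h. h \<in> hom C (Cod C i) Z \<and> h \<circ> i = x \<and> h \<circ> j = y"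
  proof (rule ex1I)
    show "h \<in> hom C (Cod C i) Z \<and> h \<circ> i = x \<and> h \<circ> j = y"
      using h xy by (simp add: in_hom)
    show "k = h" if "k \<in> hom C (Cod C i) Z \<and> k \<circ> i = x \<and> k \<circ> j = y" for k
      using that h xy by - (rule ext, simp_all add: in_hom)
  qed
qed (use assms(1-9) in simp_all)

lemma is_pushoutD:
  assumes "is_pushout C f g i j"
  shows "f \<in> Ar C" "g \<in> Ar C" "i \<in> Ar C" "j \<in> Ar C"
    "Dom C f = Dom C g" "Dom C i = Cod C f" "Dom C j = Cod C g" "Cod C i = Cod C j"
    "i \<circ> f = j \<circ> g"
  using assms unfolding is_pushout_def by simp_all

lemma pushout_ext:
  assumes "is_pushout C f g i j"
    and uv: "u \<in> Ar C" "v \<in> Ar C" "Dom C u = Cod C i" "Dom C v = Cod C i" "Cod C u = Cod C v"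
    and eq: "u \<circ> i = v \<circ> i" "u \<circ> j = v \<circ> j"
  shows "u = v"
proof -
  note p = is_pushoutD[OF assms(1)]
  have "(u \<circ> i) \<circ> f = (u \<circ> j) \<circ> g"
    using p uv by simp
  moreover have "u \<circ> i \<in> hom C (Cod C f) (Cod C u)" "u \<circ> j \<in> hom C (Cod C g) (Cod C u)" "Cod C u \<in> Ob C"
    using p uv by (simp_all add: in_hom)
  ultimately have "\<exists>!h. h \<in> hom C (Cod C i) (Cod C u) \<and> h \<circ> i = u \<circ> i \<and> h \<circ> j = u \<circ> j"
    using assms(1) unfolding is_pushout_def by blast
  moreover have "u \<in> hom C (Cod C i) (Cod C u)" "v \<in> hom C (Cod C i) (Cod C u)"
    using uv by (simp_all add: in_hom)
  ultimately show ?thesis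
    using eq by metis
qed

lemma pushout_desc:
  assumes "is_pushout C f g i j"
    and "x \<in> Ar C" "y \<in> Ar C" "Dom C x = Cod C f" "Dom C y = Cod C g" "Cod C x = Cod C y"
    and "x \<circ> f = y \<circ> g"
  obtains h where "h \<in> Ar C" "Dom C h = Cod C i" "Cod C h = Cod C x" "h \<circ> i = x" "h \<circ> j = y"
proof -
  have "x \<in> hom C (Cod C f) (Cod C x)" "y \<in> hom C (Cod C g) (Cod C x)" "Cod C x \<in> Ob C"
    using assms by (simp_all add: in_hom)
  then have "\<exists>h. h \<in> hom C (Cod C i) (Cod C x) \<and> h \<circ> i = x \<and> h \<circ> j = y"
    using assms(1,7) unfolding is_pushout_def by blast
  then show ?thesis
    using that by (auto simp: in_hom)
qed

end

text \<open>Facts about pullbacks are obtained from those about pushouts by passing to the opposite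
  category.\<close>

definition opposite :: "('o, 'm, 'z) cat_scheme \<Rightarrow> ('o, 'm, 'z) cat_scheme" where
  "opposite C = C\<lparr>Dom := Cod C, Cod := Dom C, Comp := (\<lambda>g f. f \<circ>\<^bsub>C\<^esub> g)\<rparr>"

lemma opposite_simps [simp]:
  "Ob (opposite C) = Ob C" "Ar (opposite C) = Ar C" "Dom (opposite C) = Cod C"
  "Cod (opposite C) = Dom C" "Idt (opposite C) = Idt C"
  "g \<circ>\<^bsub>opposite C\<^esub> f = f \<circ>\<^bsub>C\<^esub> g"
  by (simp_all add: opposite_def)

lemma hom_opposite [simp]: "hom (opposite C) X Y = hom C Y X"
  by (auto simp: in_hom)

lemma opposite_opposite [simp]: "opposite (opposite C) = C"
  by (simp add: opposite_def)

lemma category_opposite: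
  assumes "category C"
  shows "category (opposite C)"
proof -
  interpret category C by fact
  show ?thesis
    by unfold_locales (auto simp: in_hom)
qed

lemma is_pushout_opposite: "is_pushout (opposite C) f g i j \<longleftrightarrow> is_pullback C f g i j"
  unfolding is_pushout_def is_pullback_def by simp

lemma cat_functor_opposite:
  assumes "cat_functor J (opposite C) D"
  shows "cat_functor (opposite J) C D"
proof -
  interpret cat_functor J "opposite C" D by fact
  have "category C"
    using category_opposite[OF B.category_axioms] by simp
  then show ?thesis
    using category_opposite[OF A.category_axioms] ObMap_Ob ArMap_hom ArMap_Idt ArMap_Comp
    by (simp add: cat_functor_def cat_functor_axioms_def)
qed

lemma bicomplete_opposite:
  assumes "bicomplete TYPE('i) C"
  shows "bicomplete TYPE('i) (opposite C)"
  unfolding bicomplete_def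
proof (intro allI impI)
  fix J :: "('i, 'i) cat" and D
  assume "cat_functor J (opposite C) D"
  then have "(\<exists>L p. is_limit (opposite J) C D L p) \<and> (\<exists>L p. is_colimit (opposite J) C D L p)"
    using assms cat_functor_opposite unfolding bicomplete_def by blast
  then show "(\<exists>L p. is_limit J (opposite C) D L p) \<and> (\<exists>L p. is_colimit J (opposite C) D L p)"
    unfolding is_limit_def is_colimit_def is_cone_def is_cocone_def by simp
qed

text \<open>A pushout is a colimit over a category with five arrows, which fits into every infinite type.\<close>

lemma (in category) bicomplete_pushout:
  assumes inf: "infinite (UNIV :: 'i set)" and bi: "bicomplete TYPE('i) C"
    and f: "f \<in> Ar C" and g: "g \<in> Ar C" and fg: "Dom C f = Dom C g"
  shows "\<exists>i j. is_pushout C f g i j"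
  \<comment> \<open>\<open>e 1\<close> is not to become \<open>e (Suc 0)\<close>.\<close>
  supply One_nat_def [simp del]
proof -
  obtain e :: "nat \<Rightarrow> 'i" where "inj e"
    using infinite_countable_subset[OF inf] by blast
  note e = inj_eq[OF this]
  \<comment> \<open>The walking span: \<open>e 0\<close>, \<open>e 1\<close>, \<open>e 2\<close> are the objects and their own identities,
    \<open>e 3: e 0 \<rightarrow> e 1\<close> and \<open>e 4: e 0 \<rightarrow> e 2\<close>.\<close>
  define J :: "('i, 'i) cat" where "J =
    \<lparr>Ob = {e 0, e 1, e 2}, Ar = {e 0, e 1, e 2, e 3, e 4},
     Dom = (\<lambda>u. if u = e 3 \<or> u = e 4 then e 0 else u),
     Cod = (\<lambda>u. if u = e 3 then e 1 else if u = e 4 then e 2 else u),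
     Idt = (\<lambda>X. X), Comp = (\<lambda>v u. if u \<in> {e 0, e 1, e 2} then v else u)\<rparr>"
  have J_Ob: "Ob J = {e 0, e 1, e 2}" and J_Ar: "Ar J = {e 0, e 1, e 2, e 3, e 4}"
    by (simp_all add: J_def)
  have J_simps: "Dom J (e 0) = e 0" "Dom J (e 1) = e 1" "Dom J (e 2) = e 2" "Dom J (e 3) = e 0"
    "Dom J (e 4) = e 0" "Cod J (e 0) = e 0" "Cod J (e 1) = e 1" "Cod J (e 2) = e 2"
    "Cod J (e 3) = e 1" "Cod J (e 4) = e 2" "Idt J X = X" "v \<circ>\<^bsub>J\<^esub> e 0 = v" "v \<circ>\<^bsub>J\<^esub> e 1 = v"
    "v \<circ>\<^bsub>J\<^esub> e 2 = v" "v \<circ>\<^bsub>J\<^esub> e 3 = e 3" "v \<circ>\<^bsub>J\<^esub> e 4 = e 4" for v X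
    by (simp_all add: J_def e)
  have J: "category J"
    by unfold_locales (auto simp: in_hom J_Ob J_Ar J_simps e)
  define D :: "('i, 'i, 'o, 'm) ftor" where "D =
    \<lparr>ObMap = (\<lambda>X. if X = e 0 then Dom C f else if X = e 1 then Cod C f else Cod C g),
     ArMap = (\<lambda>u. if u = e 0 then \<one> (Dom C f) else if u = e 1 then \<one> (Cod C f)
       else if u = e 2 then \<one> (Cod C g) else if u = e 3 then f else g)\<rparr>"
  have D_simps: "ObMap D (e 0) = Dom C f" "ObMap D (e 1) = Cod C f" "ObMap D (e 2) = Cod C g"
    "ArMap D (e 0) = \<one> (Dom C f)" "ArMap D (e 1) = \<one> (Cod C f)" "ArMap D (e 2) = \<one> (Cod C g)"
    "ArMap D (e 3) = f" "ArMap D (e 4) = g"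
    by (simp_all add: D_def e)
  have "cat_functor_axioms J C D"
    by unfold_locales (use f g fg in \<open>auto simp: in_hom J_Ob J_Ar J_simps D_simps e\<close>)
  then have "cat_functor J C D"
    using J category_axioms by (simp add: cat_functor_def)
  then obtain L p where col: "is_colimit J C D L p"
    using bi unfolding bicomplete_def by blast
  have p: "L \<in> Ob C" "p (e 0) \<in> hom C (Dom C f) L" "p (e 1) \<in> hom C (Cod C f) L"
    "p (e 2) \<in> hom C (Cod C g) L" "p (e 1) \<circ> f = p (e 0)" "p (e 2) \<circ> g = p (e 0)"
    using col unfolding is_colimit_def is_cocone_def by (simp_all add: J_Ob J_Ar J_simps D_simps)
  have univ: "\<exists>!h. h \<in> hom C L (Cod C x) \<and> h \<circ> p (e 0) = x \<circ> f \<and> h \<circ> p (e 1) = x \<and> h \<circ> p (e 2) = y"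
    if "x \<in> Ar C" "y \<in> Ar C" "Dom C x = Cod C f" "Dom C y = Cod C g" "Cod C x = Cod C y"
      "x \<circ> f = y \<circ> g" for x y
  proof -
    define q where "q = (\<lambda>X. if X = e 0 then x \<circ> f else if X = e 1 then x else y)"
    have q: "q (e 0) = x \<circ> f" "q (e 1) = x" "q (e 2) = y"
      by (simp_all add: q_def e)
    have "is_cocone J C D (Cod C x) q"
      using that f g fg unfolding is_cocone_def by (simp add: in_hom J_Ob J_Ar J_simps D_simps q)
    then have "\<exists>!h. h \<in> hom C L (Cod C x) \<and> (\<forall>j \<in> Ob J. h \<circ> p j = q j)"
      using col unfolding is_colimit_def by blast
    then show ?thesis
      by (simp add: J_Ob q)
  qed
  have "is_pushout C f g (p (e 1)) (p (e 2))"
  proof (rule is_pushoutI)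
    fix u v
    assume uv: "u \<in> Ar C" "v \<in> Ar C" "Dom C u = Cod C (p (e 1))" "Dom C v = Cod C (p (e 1))"
      "Cod C u = Cod C v" "u \<circ> p (e 1) = v \<circ> p (e 1)" "u \<circ> p (e 2) = v \<circ> p (e 2)"
    have u: "(u \<circ> p (e 1)) \<circ> f = u \<circ> p (e 0)" "(u \<circ> p (e 2)) \<circ> g = u \<circ> p (e 0)"
      and v: "(v \<circ> p (e 1)) \<circ> f = v \<circ> p (e 0)"
      using p uv(1-5) f g by (simp_all add: in_hom)
    have "\<exists>!h. h \<in> hom C L (Cod C u) \<and> h \<circ> p (e 0) = u \<circ> p (e 0) \<and>
        h \<circ> p (e 1) = u \<circ> p (e 1) \<and> h \<circ> p (e 2) = u \<circ> p (e 2)"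
      using univ[of "u \<circ> p (e 1)" "u \<circ> p (e 2)"] p uv(1-5) unfolding u by (simp add: in_hom)
    moreover have "u \<circ> p (e 0) = v \<circ> p (e 0)"
      using u(1) v uv(6) by simp
    moreover have "u \<in> hom C L (Cod C u)" "v \<in> hom C L (Cod C u)"
      using uv(1-5) p by (simp_all add: in_hom)
    ultimately show "u = v"
      using uv(6,7) by metis
  next
    fix x y
    assume xy: "x \<in> Ar C" "y \<in> Ar C" "Dom C x = Cod C f" "Dom C y = Cod C g" "Cod C x = Cod C y"
      "x \<circ> f = y \<circ> g"
    show "\<exists>h. h \<in> Ar C \<and> Dom C h = Cod C (p (e 1)) \<and> Cod C h = Cod C x \<and>
        h \<circ> p (e 1) = x \<and> h \<circ> p (e 2) = y"
      using univ[OF xy] p by (auto simp: in_hom)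
  qed (use p f g fg in \<open>simp_all add: in_hom\<close>)
  then show ?thesis
    by blast
qed

lemma (in category) bicomplete_pullback:
  assumes "infinite (UNIV :: 'i set)" "bicomplete TYPE('i) C"
    and "f \<in> Ar C" "g \<in> Ar C" "Cod C f = Cod C g"
  shows "\<exists>p q. is_pullback C f g p q"
  using category.bicomplete_pushout[OF category_opposite[OF category_axioms] assms(1)
      bicomplete_opposite[OF assms(2)], of f g] assms(3-5)
  by (simp add: is_pushout_opposite)

context category
begin

lemmas is_pullbackD =
  category.is_pushoutD[OF category_opposite[OF category_axioms], unfolded is_pushout_opposite,
    simplified]

lemmas pullback_ext =
  category.pushout_ext[OF category_opposite[OF category_axioms], unfolded is_pushout_opposite,
    simplified]

lemmas pullback_lift =
  category.pushout_desc[OF category_opposite[OF category_axioms], unfolded is_pushout_opposite,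
    simplified]

end

section \<open>Zero arrows and cokernels\<close>

locale pointed_category = category C for C :: "('o, 'm, 'z) cat_scheme" (structure) +
  assumes pointed: "pointed C"
    and pushouts: "f \<in> Ar C \<Longrightarrow> g \<in> Ar C \<Longrightarrow> Dom C f = Dom C g \<Longrightarrow> \<exists>i j. is_pushout C f g i j"
    and pullbacks: "f \<in> Ar C \<Longrightarrow> g \<in> Ar C \<Longrightarrow> Cod C f = Cod C g \<Longrightarrow> \<exists>p q. is_pullback C f g p q"
begin

lemma zero_initial: "is_initial C (zero_ob C)"
  unfolding zero_ob_def by (rule someI_ex) (use pointed in \<open>auto simp: pointed_def\<close>)

text \<open>The chosen initial object need not be the one that is assumed to be terminal as well, but the
  two are isomorphic.\<close>

lemma zero_terminal: "is_terminal C (zero_ob C)"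
proof -
  obtain Z where Z: "is_initial C Z" "is_terminal C Z"
    using pointed by (auto simp: pointed_def)
  have ob: "zero_ob C \<in> Ob C" "Z \<in> Ob C"
    using zero_initial Z by (simp_all add: is_initialD(1))
  obtain i where i: "i \<in> hom C (zero_ob C) Z"
    using zero_initial ob unfolding is_initial_def by blast
  obtain j where j: "j \<in> hom C Z (zero_ob C)"
    using Z ob unfolding is_initial_def by blast
  have ji: "j \<circ> i = \<one> (zero_ob C)"
    using i j ob by - (rule is_initialD(2)[OF zero_initial], simp_all add: in_hom)
  show ?thesis
    unfolding is_terminal_def
  proof (intro conjI ballI ob)
    fix X assume "X \<in> Ob C"
    then obtain t where t: "t \<in> hom C X Z" and t_unique: "\<And>t'. t' \<in> hom C X Z \<Longrightarrow> t' = t"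
      using Z(2) unfolding is_terminal_def by blast
    have "u = j \<circ> t" if u: "u \<in> hom C X (zero_ob C)" for u
    proof -
      have "i \<circ> u = t"
        using i u by - (rule t_unique, simp add: in_hom)
      moreover have "u = (j \<circ> i) \<circ> u"
        using u unfolding ji by (simp add: in_hom)
      ultimately show ?thesis
        using i j u by (simp add: in_hom)
    qed
    moreover have "j \<circ> t \<in> hom C X (zero_ob C)"
      using j t by (simp add: in_hom)
    ultimately show "\<exists>!f. f \<in> hom C X (zero_ob C)"
      by blast
  qed
qed

lemma zero_ob_Ob [simp]: "zero_ob C \<in> Ob C"
  using zero_initial by (rule is_initialD(1))

lemma from_zero_simps [simp]:
  assumes "X \<in> Ob C"
  shows "from_zero C X \<in> Ar C" "Dom C (from_zero C X) = zero_ob C" "Cod C (from_zero C X) = X"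
proof -
  have "from_zero C X \<in> hom C (zero_ob C) X"
    unfolding from_zero_def
    by (rule theI') (use zero_initial assms in \<open>simp add: is_initial_def\<close>)
  then show "from_zero C X \<in> Ar C" "Dom C (from_zero C X) = zero_ob C" "Cod C (from_zero C X) = X"
    by (simp_all add: in_hom)
qed

lemma to_zero_simps [simp]:
  assumes "X \<in> Ob C"
  shows "to_zero C X \<in> Ar C" "Dom C (to_zero C X) = X" "Cod C (to_zero C X) = zero_ob C"
proof -
  have "to_zero C X \<in> hom C X (zero_ob C)"
    unfolding to_zero_def
    by (rule theI') (use zero_terminal assms in \<open>simp add: is_terminal_def\<close>)
  then show "to_zero C X \<in> Ar C" "Dom C (to_zero C X) = X" "Cod C (to_zero C X) = zero_ob C"
    by (simp_all add: in_hom)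
qed

lemma from_zero_ext:
  "u \<in> Ar C \<Longrightarrow> v \<in> Ar C \<Longrightarrow> Dom C u = zero_ob C \<Longrightarrow> Dom C v = zero_ob C \<Longrightarrow> Cod C u = Cod C v \<Longrightarrow> u = v"
  by (rule is_initialD(2)[OF zero_initial])

lemma to_zero_ext:
  assumes "u \<in> Ar C" "v \<in> Ar C" "Cod C u = zero_ob C" "Cod C v = zero_ob C" "Dom C u = Dom C v"
  shows "u = v"
proof -
  have "u \<in> hom C (Dom C u) (zero_ob C)" "v \<in> hom C (Dom C u) (zero_ob C)" "Dom C u \<in> Ob C"
    using assms by (simp_all add: in_hom)
  then show ?thesis
    using zero_terminal unfolding is_terminal_def by blast
qed

definition zero_arrow :: "'o \<Rightarrow> 'o \<Rightarrow> 'm" where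
  "zero_arrow X Y = from_zero C Y \<circ> to_zero C X"

lemma zero_arrow_simps [simp]:
  assumes "X \<in> Ob C" "Y \<in> Ob C"
  shows "zero_arrow X Y \<in> Ar C" "Dom C (zero_arrow X Y) = X" "Cod C (zero_arrow X Y) = Y"
  using assms by (simp_all add: zero_arrow_def)

lemma Comp_zero_arrow [simp]:
  assumes "f \<in> Ar C" "Dom C f = Y" "X \<in> Ob C"
  shows "f \<circ> zero_arrow X Y = zero_arrow X (Cod C f)"
proof -
  have Y: "Y \<in> Ob C"
    using assms by auto
  have "f \<circ> from_zero C Y = from_zero C (Cod C f)"
    using assms Y by - (rule from_zero_ext, simp_all)
  then have "(f \<circ> from_zero C Y) \<circ> to_zero C X = from_zero C (Cod C f) \<circ> to_zero C X"
    by simp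
  then show ?thesis
    using assms Y by (simp add: zero_arrow_def)
qed

lemma zero_arrow_Comp [simp]:
  assumes "f \<in> Ar C" "Cod C f = X" "Y \<in> Ob C"
  shows "zero_arrow X Y \<circ> f = zero_arrow (Dom C f) Y"
proof -
  have X: "X \<in> Ob C"
    using assms by auto
  have "to_zero C X \<circ> f = to_zero C (Dom C f)"
    using assms X by - (rule to_zero_ext, simp_all)
  then show ?thesis
    using assms X by (simp add: zero_arrow_def)
qed

text \<open>There is only one arrow out of an initial object to \<open>Cod y\<close>, and the zero arrow is one.\<close>

lemma from_initial_to_zero:
  assumes "is_initial C I" "t \<in> Ar C" "Cod C t = I" "y \<in> Ar C" "Dom C y = I"
  shows "y \<circ> t = zero_arrow (Dom C t) (Cod C y)"
proof -
  have I: "I \<in> Ob C"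
    using assms(1) by (rule is_initialD(1))
  have "y = zero_arrow I (Cod C y)"
    using assms I by - (rule is_initialD(2)[OF assms(1)], simp_all)
  then have "y \<circ> t = zero_arrow I (Cod C y) \<circ> t"
    by simp
  then show ?thesis
    using assms by simp
qed

text \<open>The universal property is stated with right cancellation in place of uniqueness of the
  factorization. It does not depend on the chosen pushouts and can therefore be transported
  along tensor products.\<close>

definition is_cokernel :: "'m \<Rightarrow> 'm \<Rightarrow> bool" where
  "is_cokernel f p \<longleftrightarrow> f \<in> Ar C \<and> p \<in> Ar C \<and> Dom C p = Cod C f \<and>
     p \<circ> f = zero_arrow (Dom C f) (Cod C p) \<and>
     (\<forall>u v. u \<in> Ar C \<longrightarrow> v \<in> Ar C \<longrightarrow> Dom C u = Cod C p \<longrightarrow> Dom C v = Cod C p \<longrightarrow>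
        u \<circ> p = v \<circ> p \<longrightarrow> u = v) \<and>
     (\<forall>x. x \<in> Ar C \<longrightarrow> Dom C x = Cod C f \<longrightarrow> x \<circ> f = zero_arrow (Dom C f) (Cod C x) \<longrightarrow>
        (\<exists>h. h \<in> Ar C \<and> Dom C h = Cod C p \<and> Cod C h = Cod C x \<and> h \<circ> p = x))"

lemma is_cokernelI:
  assumes "f \<in> Ar C" "p \<in> Ar C" "Dom C p = Cod C f"
    and "p \<circ> f = zero_arrow (Dom C f) (Cod C p)"
    and "\<And>u v. u \<in> Ar C \<Longrightarrow> v \<in> Ar C \<Longrightarrow> Dom C u = Cod C p \<Longrightarrow> Dom C v = Cod C p \<Longrightarrow>
        u \<circ> p = v \<circ> p \<Longrightarrow> Cod C u = Cod C v \<Longrightarrow> u = v"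
    and "\<And>x. x \<in> Ar C \<Longrightarrow> Dom C x = Cod C f \<Longrightarrow> x \<circ> f = zero_arrow (Dom C f) (Cod C x) \<Longrightarrow>
        \<exists>h. h \<in> Ar C \<and> Dom C h = Cod C p \<and> Cod C h = Cod C x \<and> h \<circ> p = x"
  shows "is_cokernel f p"
  unfolding is_cokernel_def
proof (intro conjI allI impI)
  fix u v assume *: "u \<in> Ar C" "v \<in> Ar C" "Dom C u = Cod C p" "Dom C v = Cod C p" "u \<circ> p = v \<circ> p"
  then have "Cod C u = Cod C v"
    using assms(2) by (metis Comp_simps(3))
  then show "u = v"
    using * by - (rule assms(5))
qed (use assms in blast)+

lemma is_cokernelD:
  assumes "is_cokernel f p"
  shows "f \<in> Ar C" "p \<in> Ar C" "Dom C p = Cod C f"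
    "p \<circ> f = zero_arrow (Dom C f) (Cod C p)"
  using assms unfolding is_cokernel_def by simp_all

lemma cokernel_ext:
  "is_cokernel f p \<Longrightarrow> u \<in> Ar C \<Longrightarrow> v \<in> Ar C \<Longrightarrow> Dom C u = Cod C p \<Longrightarrow> Dom C v = Cod C p \<Longrightarrow>
   u \<circ> p = v \<circ> p \<Longrightarrow> u = v"
  unfolding is_cokernel_def by blast

lemma cokernel_desc:
  assumes "is_cokernel f p" "x \<in> Ar C" "Dom C x = Cod C f"
    and "x \<circ> f = zero_arrow (Dom C f) (Cod C x)"
  obtains h where "h \<in> Ar C" "Dom C h = Cod C p" "Cod C h = Cod C x" "h \<circ> p = x"
  using assms unfolding is_cokernel_def by blast

lemma cokernels_iso:
  assumes "is_cokernel f p" "is_cokernel f q"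
  obtains m where "is_iso C m" "Dom C m = Cod C p" "Cod C m = Cod C q" "m \<circ> p = q"
proof -
  note p = is_cokernelD[OF assms(1)] and q = is_cokernelD[OF assms(2)]
  obtain m where m: "m \<in> Ar C" "Dom C m = Cod C p" "Cod C m = Cod C q" "m \<circ> p = q"
    using cokernel_desc[OF assms(1) q(2-4)] .
  obtain n where n: "n \<in> Ar C" "Dom C n = Cod C q" "Cod C n = Cod C p" "n \<circ> q = p"
    using cokernel_desc[OF assms(2) p(2-4)] .
  have "n \<circ> m = \<one> (Cod C p)"
    using m n p by - (rule cokernel_ext[OF assms(1)], simp_all)
  moreover have "m \<circ> n = \<one> (Cod C q)"
    using m n q by - (rule cokernel_ext[OF assms(2)], simp_all)
  ultimately have "is_iso C m"
    using m n by (intro isoI[of m n]) simp_all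
  then show ?thesis
    using that m by blast
qed

text \<open>The corner of the pushout may be any initial object. After tensoring a cokernel with \<open>W\<close> it
  is \<open>zero_ob C \<otimes>\<^sub>o W\<close>.\<close>

lemma cokernel_of_pushout:
  assumes po: "is_pushout C f t p s" and I: "is_initial C (Cod C t)"
  shows "is_cokernel f p"
proof (rule is_cokernelI)
  note d = is_pushoutD[OF po]
  show "f \<in> Ar C" "p \<in> Ar C" "Dom C p = Cod C f"
    using d by simp_all
  show "p \<circ> f = zero_arrow (Dom C f) (Cod C p)"
    using from_initial_to_zero[OF I, of t s] d by simp
  fix u v
  assume uv: "u \<in> Ar C" "v \<in> Ar C" "Dom C u = Cod C p" "Dom C v = Cod C p" "u \<circ> p = v \<circ> p"
    "Cod C u = Cod C v"
  then have "u \<circ> s = v \<circ> s"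
    using d by - (rule is_initialD(2)[OF I], simp_all)
  then show "u = v"
    using uv by - (rule pushout_ext[OF po], simp_all)
next
  note d = is_pushoutD[OF po]
  fix x assume x: "x \<in> Ar C" "Dom C x = Cod C f" "x \<circ> f = zero_arrow (Dom C f) (Cod C x)"
  have "x \<circ> f = zero_arrow (Cod C t) (Cod C x) \<circ> t"
    using x d by simp
  then show "\<exists>h. h \<in> Ar C \<and> Dom C h = Cod C p \<and> Cod C h = Cod C x \<and> h \<circ> p = x"
    using pushout_desc[OF po, of x "zero_arrow (Cod C t) (Cod C x)"] x d
    by (metis Cod_Ob zero_arrow_simps)
qed

lemma pushout_of_cokernel:
  assumes "is_cokernel f p"
  shows "is_pushout C f (to_zero C (Dom C f)) p (from_zero C (Cod C p))"
proof (rule is_pushoutI)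
  note p = is_cokernelD[OF assms(1)]
  fix u v
  assume "u \<in> Ar C" "v \<in> Ar C" "Dom C u = Cod C p" "Dom C v = Cod C p" "u \<circ> p = v \<circ> p"
  then show "u = v"
    by (rule cokernel_ext[OF assms(1)])
next
  note p = is_cokernelD[OF assms(1)]
  fix x y
  assume xy: "x \<in> Ar C" "y \<in> Ar C" "Dom C x = Cod C f" "Dom C y = Cod C (to_zero C (Dom C f))"
    "Cod C x = Cod C y" "x \<circ> f = y \<circ> to_zero C (Dom C f)"
  have "x \<circ> f = zero_arrow (Dom C f) (Cod C x)"
    using from_initial_to_zero[OF zero_initial, of "to_zero C (Dom C f)" y] xy p by simp
  then obtain h where h: "h \<in> Ar C" "Dom C h = Cod C p" "Cod C h = Cod C x" "h \<circ> p = x"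
    using cokernel_desc[OF assms(1) xy(1,3)] by blast
  have "h \<circ> from_zero C (Cod C p) = y"
    using h xy p by - (rule from_zero_ext, simp_all)
  then show "\<exists>h. h \<in> Ar C \<and> Dom C h = Cod C p \<and> Cod C h = Cod C x \<and> h \<circ> p = x \<and>
      h \<circ> from_zero C (Cod C p) = y"
    using h by blast
qed (use is_cokernelD[OF assms(1)] in \<open>simp_all add: zero_arrow_def\<close>)

lemma is_pushout_po_in:
  assumes "f \<in> Ar C" "g \<in> Ar C" "Dom C f = Dom C g"
  shows "is_pushout C f g (po_inl C f g) (po_inr C f g)"
proof -
  have "\<exists>ij. case ij of (i, j) \<Rightarrow> is_pushout C f g i j"
    using pushouts[OF assms] by auto
  from someI_ex[OF this] show ?thesis
    by (simp add: po_inl_def po_inr_def po_in_def case_prod_unfold)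
qed

lemma po_desc_simps:
  assumes fg: "f \<in> Ar C" "g \<in> Ar C" "Dom C f = Dom C g"
    and xy: "x \<in> Ar C" "y \<in> Ar C" "Dom C x = Cod C f" "Dom C y = Cod C g" "Cod C x = Cod C y"
    and eq: "x \<circ> f = y \<circ> g"
  shows "po_desc C f g x y \<in> Ar C" "Dom C (po_desc C f g x y) = Cod C (po_inl C f g)"
    "Cod C (po_desc C f g x y) = Cod C x"
    "po_desc C f g x y \<circ> po_inl C f g = x" "po_desc C f g x y \<circ> po_inr C f g = y"
proof -
  note po = is_pushout_po_in[OF fg]
  obtain h where h: "h \<in> Ar C" "Dom C h = Cod C (po_inl C f g)" "Cod C h = Cod C x"
    "h \<circ> po_inl C f g = x" "h \<circ> po_inr C f g = y"
    using pushout_desc[OF po xy eq] .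
  have "po_desc C f g x y = h"
    unfolding po_desc_def
  proof (rule the_equality)
    show "h \<in> hom C (po_ob C f g) (Cod C x) \<and> h \<circ> po_inl C f g = x \<and> h \<circ> po_inr C f g = y"
      using h by (simp add: in_hom po_ob_def)
    show "k = h" if "k \<in> hom C (po_ob C f g) (Cod C x) \<and> k \<circ> po_inl C f g = x \<and> k \<circ> po_inr C f g = y" for k
      using that h by - (rule pushout_ext[OF po], simp_all add: in_hom po_ob_def)
  qed
  then show "po_desc C f g x y \<in> Ar C" "Dom C (po_desc C f g x y) = Cod C (po_inl C f g)"
    "Cod C (po_desc C f g x y) = Cod C x"
    "po_desc C f g x y \<circ> po_inl C f g = x" "po_desc C f g x y \<circ> po_inr C f g = y"
    using h by simp_all
qed

lemma is_pullback_pb_pr: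
  assumes "f \<in> Ar C" "g \<in> Ar C" "Cod C f = Cod C g"
  shows "is_pullback C f g (pb_fst C f g) (pb_snd C f g)"
proof -
  have "\<exists>pq. case pq of (p, q) \<Rightarrow> is_pullback C f g p q"
    using pullbacks[OF assms] by auto
  from someI_ex[OF this] show ?thesis
    by (simp add: pb_fst_def pb_snd_def pb_pr_def case_prod_unfold)
qed

lemma pb_lift_simps:
  assumes fg: "f \<in> Ar C" "g \<in> Ar C" "Cod C f = Cod C g"
    and xy: "x \<in> Ar C" "y \<in> Ar C" "Cod C x = Dom C f" "Cod C y = Dom C g" "Dom C x = Dom C y"
    and eq: "f \<circ> x = g \<circ> y"
  shows "pb_lift C f g x y \<in> Ar C" "Cod C (pb_lift C f g x y) = Dom C (pb_fst C f g)"
    "Dom C (pb_lift C f g x y) = Dom C x"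
    "pb_fst C f g \<circ> pb_lift C f g x y = x" "pb_snd C f g \<circ> pb_lift C f g x y = y"
proof -
  note pb = is_pullback_pb_pr[OF fg]
  obtain h where h: "h \<in> Ar C" "Cod C h = Dom C (pb_fst C f g)" "Dom C h = Dom C x"
    "pb_fst C f g \<circ> h = x" "pb_snd C f g \<circ> h = y"
    using pullback_lift[OF pb xy eq] .
  have "pb_lift C f g x y = h"
    unfolding pb_lift_def
  proof (rule the_equality)
    show "h \<in> hom C (Dom C x) (pb_ob C f g) \<and> pb_fst C f g \<circ> h = x \<and> pb_snd C f g \<circ> h = y"
      using h by (simp add: in_hom pb_ob_def)
    show "k = h" if "k \<in> hom C (Dom C x) (pb_ob C f g) \<and> pb_fst C f g \<circ> k = x \<and> pb_snd C f g \<circ> k = y" for k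
      using that h by - (rule pullback_ext[OF pb], simp_all add: in_hom pb_ob_def)
  qed
  then show "pb_lift C f g x y \<in> Ar C" "Cod C (pb_lift C f g x y) = Dom C (pb_fst C f g)"
    "Dom C (pb_lift C f g x y) = Dom C x"
    "pb_fst C f g \<circ> pb_lift C f g x y = x" "pb_snd C f g \<circ> pb_lift C f g x y = y"
    using h by simp_all
qed

lemma is_cokernel_coker: "f \<in> Ar C \<Longrightarrow> is_cokernel f (coker C f)"
  unfolding coker_def
  by (rule cokernel_of_pushout[OF is_pushout_po_in]) (simp_all add: zero_initial)

lemma coker_simps [simp]:
  assumes "f \<in> Ar C"
  shows "coker C f \<in> Ar C" "Dom C (coker C f) = Cod C f"
  using is_cokernelD[OF is_cokernel_coker[OF assms]] by simp_all

end

section \<open>Tensor products and colimits\<close>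

context symmetric_monoidal_category
begin

declare TUnit_Ob [simp] TOb_Ob [simp] TAr_Idt [simp]

lemma TAr_simps [simp]:
  assumes "f \<in> Ar C" "g \<in> Ar C"
  shows "f \<otimes> g \<in> Ar C" "Dom C (f \<otimes> g) = Dom C f \<otimes>\<^sub>o Dom C g" "Cod C (f \<otimes> g) = Cod C f \<otimes>\<^sub>o Cod C g"
  using TAr_hom[of f "Dom C f" "Cod C f" g "Dom C g" "Cod C g"] assms by (simp_all add: in_hom)

lemma Comp_TAr:
  assumes "f \<in> Ar C" "f' \<in> Ar C" "Dom C f' = Cod C f" "g \<in> Ar C" "g' \<in> Ar C" "Dom C g' = Cod C g"
  shows "(f' \<otimes> g') \<circ> (f \<otimes> g) = (f' \<circ> f) \<otimes> (g' \<circ> g)"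
  using TAr_Comp[of f "Dom C f" "Cod C f" f' "Cod C f'" g "Dom C g" "Cod C g" g' "Cod C g'"] assms
  by (simp add: in_hom)

lemma Comp_TAr_Comp:
  assumes "f \<in> Ar C" "f' \<in> Ar C" "Dom C f' = Cod C f" "g \<in> Ar C" "g' \<in> Ar C" "Dom C g' = Cod C g"
    and "k \<in> Ar C" "Cod C k = Dom C f \<otimes>\<^sub>o Dom C g"
  shows "(f' \<otimes> g') \<circ> (f \<otimes> g) \<circ> k = ((f' \<circ> f) \<otimes> (g' \<circ> g)) \<circ> k"
  using assms Comp_TAr[OF assms(1-6)] by (metis TAr_simps assoc)

text \<open>Tensor products of composites with an identity are split, so that a composite of whiskered
  arrows has a normal form.\<close>

lemma whisker_right:
  assumes "f \<in> Ar C" "f' \<in> Ar C" "Dom C f' = Cod C f" "W \<in> Ob C"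
  shows "(f' \<circ> f) \<otimes> \<one> W = (f' \<otimes> \<one> W) \<circ> (f \<otimes> \<one> W)"
  using assms by (simp add: Comp_TAr)

lemma whisker_left:
  assumes "f \<in> Ar C" "f' \<in> Ar C" "Dom C f' = Cod C f" "W \<in> Ob C"
  shows "\<one> W \<otimes> (f' \<circ> f) = (\<one> W \<otimes> f') \<circ> (\<one> W \<otimes> f)"
  using assms by (simp add: Comp_TAr)

lemmas whisker = whisker_right whisker_left

lemma Assoc_simps [simp]:
  assumes "X \<in> Ob C" "Y \<in> Ob C" "Z \<in> Ob C"
  shows "Assoc C X Y Z \<in> Ar C" "Dom C (Assoc C X Y Z) = (X \<otimes>\<^sub>o Y) \<otimes>\<^sub>o Z"
    "Cod C (Assoc C X Y Z) = X \<otimes>\<^sub>o Y \<otimes>\<^sub>o Z"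
  using Assoc_hom[OF assms] by (simp_all add: in_hom)

lemma LUnit_simps [simp]:
  assumes "X \<in> Ob C"
  shows "LUnit C X \<in> Ar C" "Dom C (LUnit C X) = TUnit C \<otimes>\<^sub>o X" "Cod C (LUnit C X) = X"
  using LUnit_hom[OF assms] by (simp_all add: in_hom)

lemma RUnit_simps [simp]:
  assumes "X \<in> Ob C"
  shows "RUnit C X \<in> Ar C" "Dom C (RUnit C X) = X \<otimes>\<^sub>o TUnit C" "Cod C (RUnit C X) = X"
  using RUnit_hom[OF assms] by (simp_all add: in_hom)

lemma Symm_simps [simp]:
  assumes "X \<in> Ob C" "Y \<in> Ob C"
  shows "Symm C X Y \<in> Ar C" "Dom C (Symm C X Y) = X \<otimes>\<^sub>o Y" "Cod C (Symm C X Y) = Y \<otimes>\<^sub>o X"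
  using Symm_hom[OF assms] by (simp_all add: in_hom)

lemma Symm_iso: "X \<in> Ob C \<Longrightarrow> Y \<in> Ob C \<Longrightarrow> is_iso C (Symm C X Y)"
  by (rule isoI[of _ "Symm C Y X"]) (simp_all add: Symm_Symm)

text \<open>Naturality is oriented so that the structure isomorphisms of \<open>C\<close> move to the right, towards
  the source of a composite. Together with whiskering this brings both sides of a coherence condition
  into the form of a coprojection after a composite of structure isomorphisms.\<close>

lemma Symm_nat:
  "f \<in> Ar C \<Longrightarrow> g \<in> Ar C \<Longrightarrow> Cod C f = X \<Longrightarrow> Cod C g = Y \<Longrightarrow>
   Symm C X Y \<circ> (f \<otimes> g) = (g \<otimes> f) \<circ> Symm C (Dom C f) (Dom C g)"
  using Symm_natural[of f "Dom C f" X g "Dom C g" Y] by (simp add: in_hom)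

lemma Assoc_nat:
  "f \<in> Ar C \<Longrightarrow> g \<in> Ar C \<Longrightarrow> h \<in> Ar C \<Longrightarrow> Cod C f = X \<Longrightarrow> Cod C g = Y \<Longrightarrow> Cod C h = Z \<Longrightarrow>
   Assoc C X Y Z \<circ> ((f \<otimes> g) \<otimes> h) = (f \<otimes> g \<otimes> h) \<circ> Assoc C (Dom C f) (Dom C g) (Dom C h)"
  using Assoc_natural[of f "Dom C f" X g "Dom C g" Y h "Dom C h" Z] by (simp add: in_hom)

text \<open>A tensor product of identities simplifies to an identity, which hides it from
  \<open>Assoc_nat\<close>.\<close>

lemma Assoc_nat_Idt:
  "X \<in> Ob C \<Longrightarrow> Y \<in> Ob C \<Longrightarrow> h \<in> Ar C \<Longrightarrow> Cod C h = Z \<Longrightarrow>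
   Assoc C X Y Z \<circ> (\<one> (X \<otimes>\<^sub>o Y) \<otimes> h) = (\<one> X \<otimes> \<one> Y \<otimes> h) \<circ> Assoc C X Y (Dom C h)"
  using Assoc_nat[of "\<one> X" "\<one> Y" h X Y Z] by simp

lemma LUnit_nat:
  "f \<in> Ar C \<Longrightarrow> Cod C f = X \<Longrightarrow> LUnit C X \<circ> (\<one> (TUnit C) \<otimes> f) = f \<circ> LUnit C (Dom C f)"
  using LUnit_natural[of f "Dom C f" X] by (simp add: in_hom)

lemma RUnit_nat:
  "f \<in> Ar C \<Longrightarrow> Cod C f = X \<Longrightarrow> RUnit C X \<circ> (f \<otimes> \<one> (TUnit C)) = f \<circ> RUnit C (Dom C f)"
  using RUnit_natural[of f "Dom C f" X] by (simp add: in_hom)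

lemma Symm_nat_Comp:
  "f \<in> Ar C \<Longrightarrow> g \<in> Ar C \<Longrightarrow> Cod C f = X \<Longrightarrow> Cod C g = Y \<Longrightarrow> k \<in> Ar C \<Longrightarrow>
   Cod C k = Dom C f \<otimes>\<^sub>o Dom C g \<Longrightarrow>
   Symm C X Y \<circ> (f \<otimes> g) \<circ> k = (g \<otimes> f) \<circ> Symm C (Dom C f) (Dom C g) \<circ> k"
  by (subst Comp_eq_Comp[OF Symm_nat]) auto

lemma Assoc_nat_Comp:
  "f \<in> Ar C \<Longrightarrow> g \<in> Ar C \<Longrightarrow> h \<in> Ar C \<Longrightarrow> Cod C f = X \<Longrightarrow> Cod C g = Y \<Longrightarrow> Cod C h = Z \<Longrightarrow>
   k \<in> Ar C \<Longrightarrow> Cod C k = (Dom C f \<otimes>\<^sub>o Dom C g) \<otimes>\<^sub>o Dom C h \<Longrightarrow>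
   Assoc C X Y Z \<circ> ((f \<otimes> g) \<otimes> h) \<circ> k =
   (f \<otimes> g \<otimes> h) \<circ> Assoc C (Dom C f) (Dom C g) (Dom C h) \<circ> k"
  by (subst Comp_eq_Comp[OF Assoc_nat]) auto

lemma Assoc_nat_Idt_Comp:
  "X \<in> Ob C \<Longrightarrow> Y \<in> Ob C \<Longrightarrow> h \<in> Ar C \<Longrightarrow> Cod C h = Z \<Longrightarrow>
   k \<in> Ar C \<Longrightarrow> Cod C k = (X \<otimes>\<^sub>o Y) \<otimes>\<^sub>o Dom C h \<Longrightarrow>
   Assoc C X Y Z \<circ> (\<one> (X \<otimes>\<^sub>o Y) \<otimes> h) \<circ> k = (\<one> X \<otimes> \<one> Y \<otimes> h) \<circ> Assoc C X Y (Dom C h) \<circ> k"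
  by (subst Comp_eq_Comp[OF Assoc_nat_Idt]) auto

lemmas structure_nat = Symm_nat Assoc_nat Assoc_nat_Idt LUnit_nat RUnit_nat
  Symm_nat_Comp Assoc_nat_Comp Assoc_nat_Idt_Comp

text \<open>Conjugation by the symmetry carries tensoring on the right over to tensoring on the
  left.\<close>

lemma is_pushout_tensor_swap:
  assumes po: "is_pushout C (f \<otimes> \<one> W) (g \<otimes> \<one> W) (i \<otimes> \<one> W) (j \<otimes> \<one> W)"
    and W: "W \<in> Ob C" and ar: "f \<in> Ar C" "g \<in> Ar C" "i \<in> Ar C" "j \<in> Ar C"
    and sq: "Dom C f = Dom C g" "Dom C i = Cod C f" "Dom C j = Cod C g" "Cod C i = Cod C j"
      "i \<circ> f = j \<circ> g"
  shows "is_pushout C (\<one> W \<otimes> f) (\<one> W \<otimes> g) (\<one> W \<otimes> i) (\<one> W \<otimes> j)"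
proof (rule is_pushoutI)
  show "(\<one> W \<otimes> i) \<circ> (\<one> W \<otimes> f) = (\<one> W \<otimes> j) \<circ> (\<one> W \<otimes> g)"
    using W ar sq by (simp add: Comp_TAr)
  fix u v
  assume uv: "u \<in> Ar C" "v \<in> Ar C" "Dom C u = Cod C (\<one> W \<otimes> i)" "Dom C v = Cod C (\<one> W \<otimes> i)"
    "Cod C u = Cod C v" "u \<circ> (\<one> W \<otimes> i) = v \<circ> (\<one> W \<otimes> i)" "u \<circ> (\<one> W \<otimes> j) = v \<circ> (\<one> W \<otimes> j)"
  have "u \<circ> (\<one> W \<otimes> i) \<circ> Symm C (Dom C i) W = v \<circ> (\<one> W \<otimes> i) \<circ> Symm C (Dom C i) W"
    "u \<circ> (\<one> W \<otimes> j) \<circ> Symm C (Dom C j) W = v \<circ> (\<one> W \<otimes> j) \<circ> Symm C (Dom C j) W"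
    using uv W ar by (simp_all add: Comp_eq_Comp[OF uv(6)] Comp_eq_Comp[OF uv(7)] sq)
  then have "u \<circ> Symm C (Cod C i) W = v \<circ> Symm C (Cod C i) W"
    using uv(1-5) W ar sq by - (rule pushout_ext[OF po], simp_all add: structure_nat)
  then show "u = v"
    using uv(1-5) W ar by - (rule iso_cancel_right[OF Symm_iso[of "Cod C i" W]], simp_all)
next
  fix x y
  assume xy: "x \<in> Ar C" "y \<in> Ar C" "Dom C x = Cod C (\<one> W \<otimes> f)" "Dom C y = Cod C (\<one> W \<otimes> g)"
    "Cod C x = Cod C y" "x \<circ> (\<one> W \<otimes> f) = y \<circ> (\<one> W \<otimes> g)"
  have "x \<circ> (\<one> W \<otimes> f) \<circ> Symm C (Dom C f) W = y \<circ> (\<one> W \<otimes> g) \<circ> Symm C (Dom C g) W"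
    using xy W ar sq by (simp add: Comp_eq_Comp[OF xy(6)])
  then have eq: "(x \<circ> Symm C (Cod C f) W) \<circ> (f \<otimes> \<one> W) = (y \<circ> Symm C (Cod C g) W) \<circ> (g \<otimes> \<one> W)"
    using xy(1-5) W ar sq by (simp add: structure_nat)
  obtain h where h: "h \<in> Ar C" "Dom C h = Cod C (i \<otimes> \<one> W)" "Cod C h = Cod C (x \<circ> Symm C (Cod C f) W)"
    "h \<circ> (i \<otimes> \<one> W) = x \<circ> Symm C (Cod C f) W" "h \<circ> (j \<otimes> \<one> W) = y \<circ> Symm C (Cod C g) W"
    by (rule pushout_desc[OF po _ _ _ _ _ eq]) (use xy(1-5) W ar in simp_all)
  have "h \<circ> (i \<otimes> \<one> W) \<circ> Symm C W (Dom C i) = x \<circ> Symm C (Cod C f) W \<circ> Symm C W (Cod C f)"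
    "h \<circ> (j \<otimes> \<one> W) \<circ> Symm C W (Dom C j) = y \<circ> Symm C (Cod C g) W \<circ> Symm C W (Cod C g)"
    using h(1-3) xy(1-5) W ar sq by (simp_all add: Comp_eq_Comp[OF h(4)] Comp_eq_Comp[OF h(5)])
  then have "(h \<circ> Symm C W (Cod C i)) \<circ> (\<one> W \<otimes> i) = x" "(h \<circ> Symm C W (Cod C i)) \<circ> (\<one> W \<otimes> j) = y"
    using h(1-3) xy(1-5) W ar sq by (simp_all add: structure_nat Symm_Symm)
  then show "\<exists>h. h \<in> Ar C \<and> Dom C h = Cod C (\<one> W \<otimes> i) \<and> Cod C h = Cod C x \<and>
      h \<circ> (\<one> W \<otimes> i) = x \<and> h \<circ> (\<one> W \<otimes> j) = y"
    using h(1-3) xy(1-5) W ar by (intro exI[of _ "h \<circ> Symm C W (Cod C i)"]) simp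
qed (use W ar sq in simp_all)

end

locale pointed_closed_monoidal_category =
  symmetric_monoidal_category C + pointed_category C
  for C :: "('o, 'm, 'z) smcat_scheme" (structure) +
  assumes closed: "closed_monoidal C"
begin

text \<open>Tensoring with \<open>W\<close> has a right adjoint \<open>G\<close>: precomposition with \<open>a \<otimes> \<one> W\<close> corresponds to
  precomposition with \<open>a\<close>.\<close>

lemma tensor_adjunction:
  assumes W: "W \<in> Ob C"
  obtains G \<phi> where "\<And>Z. Z \<in> Ob C \<Longrightarrow> G Z \<in> Ob C"
    and "\<And>X Z. X \<in> Ob C \<Longrightarrow> Z \<in> Ob C \<Longrightarrow> bij_betw (\<phi> X Z) (hom C (X \<otimes>\<^sub>o W) Z) (hom C X (G Z))"
    and "\<And>a h. a \<in> Ar C \<Longrightarrow> h \<in> Ar C \<Longrightarrow> Dom C h = Cod C a \<otimes>\<^sub>o W \<Longrightarrow>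
      \<phi> (Dom C a) (Cod C h) (h \<circ> (a \<otimes> \<one> W)) = \<phi> (Cod C a) (Cod C h) h \<circ> a"
proof -
  obtain G where "is_right_adjoint C C (tensor_right C W) G"
    using closed W by (auto simp: closed_monoidal_def)
  then obtain \<phi> where G: "cat_functor C C G"
    and bij: "\<forall>X \<in> Ob C. \<forall>Z \<in> Ob C. bij_betw (\<phi> X Z) (hom C (X \<otimes>\<^sub>o W) Z) (hom C X (ObMap G Z))"
    and nat: "\<forall>X \<in> Ob C. \<forall>X' \<in> Ob C. \<forall>Y \<in> Ob C. \<forall>Y' \<in> Ob C.
      \<forall>a \<in> hom C X' X. \<forall>h \<in> hom C (X \<otimes>\<^sub>o W) Y. \<forall>b \<in> hom C Y Y'.
      \<phi> X' Y' (b \<circ> h \<circ> (a \<otimes> \<one> W)) = ArMap G b \<circ> \<phi> X Y h \<circ> a"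
    unfolding is_right_adjoint_def tensor_right_def by (elim conjE exE) simp
  interpret G: cat_functor C C G by fact
  have "\<phi> (Dom C a) (Cod C h) (h \<circ> (a \<otimes> \<one> W)) = \<phi> (Cod C a) (Cod C h) h \<circ> a"
    if a: "a \<in> Ar C" and h: "h \<in> Ar C" "Dom C h = Cod C a \<otimes>\<^sub>o W" for a h
  proof -
    have "\<phi> (Cod C a) (Cod C h) h \<in> hom C (Cod C a) (ObMap G (Cod C h))"
      using bij[rule_format, of "Cod C a" "Cod C h"] a h by (auto simp: in_hom dest!: bij_betwE)
    then show ?thesis
      using nat[rule_format, of "Cod C a" "Dom C a" "Cod C h" "Cod C h" a h "\<one> (Cod C h)"] a h W
      by (simp add: in_hom G.ArMap_Idt G.ObMap_Ob)
  qed
  then show ?thesis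
    using that[of "ObMap G" \<phi>] bij G.ObMap_Ob by blast
qed

text \<open>A left adjoint preserves pushouts: the bijection turns cocones on the tensored span into
  cocones on the original one.\<close>

lemma is_pushout_tensor_right:
  assumes po: "is_pushout C f g i j" and W: "W \<in> Ob C"
  shows "is_pushout C (f \<otimes> \<one> W) (g \<otimes> \<one> W) (i \<otimes> \<one> W) (j \<otimes> \<one> W)"
proof -
  note d = is_pushoutD[OF po]
  obtain G \<phi> where G: "\<And>Z. Z \<in> Ob C \<Longrightarrow> G Z \<in> Ob C"
    and bij: "\<And>X Z. X \<in> Ob C \<Longrightarrow> Z \<in> Ob C \<Longrightarrow> bij_betw (\<phi> X Z) (hom C (X \<otimes>\<^sub>o W) Z) (hom C X (G Z))"
    and nat: "\<And>a h. a \<in> Ar C \<Longrightarrow> h \<in> Ar C \<Longrightarrow> Dom C h = Cod C a \<otimes>\<^sub>o W \<Longrightarrow>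
      \<phi> (Dom C a) (Cod C h) (h \<circ> (a \<otimes> \<one> W)) = \<phi> (Cod C a) (Cod C h) h \<circ> a"
    by (rule tensor_adjunction[OF W]) (rule that)
  have \<phi>: "\<phi> X Z h \<in> Ar C" "Dom C (\<phi> X Z h) = X" "Cod C (\<phi> X Z h) = G Z"
    if "X \<in> Ob C" "h \<in> Ar C" "Dom C h = X \<otimes>\<^sub>o W" "Cod C h = Z" for X Z h
    using bij[of X Z] that by (auto simp: in_hom dest!: bij_betwE)
  have inj: "h = k"
    if "X \<in> Ob C" "h \<in> Ar C" "k \<in> Ar C" "Dom C h = X \<otimes>\<^sub>o W" "Dom C k = X \<otimes>\<^sub>o W" "Cod C h = Z" "Cod C k = Z"
      "\<phi> X Z h = \<phi> X Z k" for X Z h k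
    using inj_onD[OF bij_betw_imp_inj_on[OF bij[of X Z]], of h k] that by (auto simp: in_hom)
  show ?thesis
  proof (rule is_pushoutI)
    show "(i \<otimes> \<one> W) \<circ> (f \<otimes> \<one> W) = (j \<otimes> \<one> W) \<circ> (g \<otimes> \<one> W)"
      using d W by (simp add: Comp_TAr)
    fix u v
    assume uv: "u \<in> Ar C" "v \<in> Ar C" "Dom C u = Cod C (i \<otimes> \<one> W)" "Dom C v = Cod C (i \<otimes> \<one> W)"
      "Cod C u = Cod C v" "u \<circ> (i \<otimes> \<one> W) = v \<circ> (i \<otimes> \<one> W)" "u \<circ> (j \<otimes> \<one> W) = v \<circ> (j \<otimes> \<one> W)"
    have "\<phi> (Cod C i) (Cod C u) u \<circ> i = \<phi> (Cod C i) (Cod C u) v \<circ> i"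
      "\<phi> (Cod C i) (Cod C u) u \<circ> j = \<phi> (Cod C i) (Cod C u) v \<circ> j"
      using nat[of i u] nat[of i v] nat[of j u] nat[of j v] uv d W by simp_all
    then have "\<phi> (Cod C i) (Cod C u) u = \<phi> (Cod C i) (Cod C u) v"
      using uv(1-5) d W by - (rule pushout_ext[OF po], simp_all add: \<phi>)
    then show "u = v"
      using uv(1-5) d W by - (rule inj, simp_all)
  next
    fix x y
    assume xy: "x \<in> Ar C" "y \<in> Ar C" "Dom C x = Cod C (f \<otimes> \<one> W)" "Dom C y = Cod C (g \<otimes> \<one> W)"
      "Cod C x = Cod C y" "x \<circ> (f \<otimes> \<one> W) = y \<circ> (g \<otimes> \<one> W)"
    have eq: "\<phi> (Cod C f) (Cod C x) x \<circ> f = \<phi> (Cod C g) (Cod C x) y \<circ> g"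
      using nat[of f x] nat[of g y] xy d W by simp
    obtain k where k: "k \<in> Ar C" "Dom C k = Cod C i" "Cod C k = Cod C (\<phi> (Cod C f) (Cod C x) x)"
      "k \<circ> i = \<phi> (Cod C f) (Cod C x) x" "k \<circ> j = \<phi> (Cod C g) (Cod C x) y"
      by (rule pushout_desc[OF po _ _ _ _ _ eq]) (use xy(1-5) d W in \<open>simp_all add: \<phi>\<close>)
    have "k \<in> \<phi> (Cod C i) (Cod C x) ` hom C (Cod C i \<otimes>\<^sub>o W) (Cod C x)"
      using bij[of "Cod C i" "Cod C x"] k(1-3) xy(1-5) d W by (simp add: bij_betw_def in_hom \<phi>)
    then obtain h where h: "h \<in> Ar C" "Dom C h = Cod C i \<otimes>\<^sub>o W" "Cod C h = Cod C x"
      "\<phi> (Cod C i) (Cod C x) h = k"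
      by (auto simp: in_hom)
    have "h \<circ> (i \<otimes> \<one> W) = x"
      by (rule inj[of "Cod C f" _ _ "Cod C x"]) (use nat[of i h] h k xy(1-5) d W in simp_all)
    moreover have "h \<circ> (j \<otimes> \<one> W) = y"
      by (rule inj[of "Cod C g" _ _ "Cod C x"]) (use nat[of j h] h k xy(1-5) d W in simp_all)
    ultimately show "\<exists>h. h \<in> Ar C \<and> Dom C h = Cod C (i \<otimes> \<one> W) \<and> Cod C h = Cod C x \<and>
        h \<circ> (i \<otimes> \<one> W) = x \<and> h \<circ> (j \<otimes> \<one> W) = y"
      using h d W by auto
  qed (use d W in simp_all)
qed

lemma is_pushout_tensor_left:
  assumes "is_pushout C f g i j" and "W \<in> Ob C"
  shows "is_pushout C (\<one> W \<otimes> f) (\<one> W \<otimes> g) (\<one> W \<otimes> i) (\<one> W \<otimes> j)"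
  using is_pushoutD[OF assms(1)] assms(2)
  by (intro is_pushout_tensor_swap is_pushout_tensor_right assms)

text \<open>Arrows \<open>I \<otimes>\<^sub>o W \<rightarrow> Z\<close> correspond to arrows out of \<open>I\<close>.\<close>

lemma is_initial_tensor_right:
  assumes "is_initial C I" "W \<in> Ob C"
  shows "is_initial C (I \<otimes>\<^sub>o W)"
proof -
  note I = is_initialD(1)[OF assms(1)]
  obtain G \<phi> where G: "\<And>Z. Z \<in> Ob C \<Longrightarrow> G Z \<in> Ob C"
    and bij: "\<And>X Z. X \<in> Ob C \<Longrightarrow> Z \<in> Ob C \<Longrightarrow>
      bij_betw (\<phi> X Z) (hom C (X \<otimes>\<^sub>o W) Z) (hom C X (G Z))"
    by (rule tensor_adjunction[OF assms(2)]) (rule that)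
  have "\<exists>!f. f \<in> hom C (I \<otimes>\<^sub>o W) Z" if Z: "Z \<in> Ob C" for Z
  proof -
    obtain t where "hom C I (G Z) = {t}"
      using assms(1) G[OF Z] unfolding is_initial_def by blast
    then have "card (hom C (I \<otimes>\<^sub>o W) Z) = 1"
      using bij_betw_same_card[OF bij[OF I Z]] by simp
    then show ?thesis
      by (auto simp: card_1_singleton_iff)
  qed
  then show ?thesis
    using I assms(2) by (simp add: is_initial_def)
qed

lemma is_initial_tensor_left:
  assumes "is_initial C I" "W \<in> Ob C"
  shows "is_initial C (W \<otimes>\<^sub>o I)"
  using is_initial_iso[OF is_initial_tensor_right[OF assms] Symm_iso[of I W]]
    is_initialD(1)[OF assms(1)] assms(2) by simp

lemma is_cokernel_tensor_right:
  assumes "is_cokernel f p" "W \<in> Ob C"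
  shows "is_cokernel (f \<otimes> \<one> W) (p \<otimes> \<one> W)"
  by (rule cokernel_of_pushout[OF is_pushout_tensor_right[OF pushout_of_cokernel]])
    (use assms is_cokernelD(1)[OF assms(1)] in \<open>simp_all add: is_initial_tensor_right zero_initial\<close>)

lemma is_cokernel_tensor_left:
  assumes "is_cokernel f p" "W \<in> Ob C"
  shows "is_cokernel (\<one> W \<otimes> f) (\<one> W \<otimes> p)"
  by (rule cokernel_of_pushout[OF is_pushout_tensor_left[OF pushout_of_cokernel]])
    (use assms is_cokernelD(1)[OF assms(1)] in \<open>simp_all add: is_initial_tensor_left zero_initial\<close>)

end

section \<open>The arrow category\<close>

lemma arrow_category_simps [simp]:
  "Ob (arrow_category C) = Ar C" "Dom (arrow_category C) = sq_src" "Cod (arrow_category C) = sq_tgt"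
  "Idt (arrow_category C) f = Square f f (Idt C (Dom C f)) (Idt C (Cod C f))"
  "t \<circ>\<^bsub>arrow_category C\<^esub> s =
     Square (sq_src s) (sq_tgt t) (sq0 t \<circ>\<^bsub>C\<^esub> sq0 s) (sq1 t \<circ>\<^bsub>C\<^esub> sq1 s)"
  by (simp_all add: arrow_category_def)

lemma in_Ar_arrow_category:
  "s \<in> Ar (arrow_category C) \<longleftrightarrow>
     sq_src s \<in> Ar C \<and> sq_tgt s \<in> Ar C \<and>
     sq0 s \<in> Ar C \<and> Dom C (sq0 s) = Dom C (sq_src s) \<and> Cod C (sq0 s) = Dom C (sq_tgt s) \<and>
     sq1 s \<in> Ar C \<and> Dom C (sq1 s) = Cod C (sq_src s) \<and> Cod C (sq1 s) = Cod C (sq_tgt s) \<and>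
     sq1 s \<circ>\<^bsub>C\<^esub> sq_src s = sq_tgt s \<circ>\<^bsub>C\<^esub> sq0 s"
  by (cases s) (auto simp: arrow_category_def in_hom)

text \<open>The two monoidal structures on arrows share the underlying category, so what depends on that
  alone is transferred to them.\<close>

lemma
  shows arrow_tensor_simps [simp]:
    "Ob (arrow_tensor C) = Ar C" "Ar (arrow_tensor C) = Ar (arrow_category C)"
    "Dom (arrow_tensor C) = sq_src" "Cod (arrow_tensor C) = sq_tgt"
    "Idt (arrow_tensor C) = Idt (arrow_category C)"
    "Comp (arrow_tensor C) = Comp (arrow_category C)"
  and arrow_pushout_product_simps [simp]:
    "Ob (arrow_pushout_product C) = Ar C" "Ar (arrow_pushout_product C) = Ar (arrow_category C)"
    "Dom (arrow_pushout_product C) = sq_src" "Cod (arrow_pushout_product C) = sq_tgt"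
    "Idt (arrow_pushout_product C) = Idt (arrow_category C)"
    "Comp (arrow_pushout_product C) = Comp (arrow_category C)"
  by (simp_all add: arrow_tensor_def arrow_pushout_product_def)

lemma
  shows hom_arrow_tensor [simp]: "hom (arrow_tensor C) = hom (arrow_category C)"
    and hom_arrow_pushout_product [simp]: "hom (arrow_pushout_product C) = hom (arrow_category C)"
  by (simp_all add: hom_def fun_eq_iff)

lemma
  shows is_iso_arrow_tensor [simp]: "is_iso (arrow_tensor C) s = is_iso (arrow_category C) s"
    and is_iso_arrow_pushout_product [simp]:
      "is_iso (arrow_pushout_product C) s = is_iso (arrow_category C) s"
  by (simp_all add: is_iso_def)

lemma arrow_tensor_structure:
  "TOb (arrow_tensor C) f g = f \<otimes>\<^bsub>C\<^esub> g"
  "TAr (arrow_tensor C) s t = Square (sq_src s \<otimes>\<^bsub>C\<^esub> sq_src t) (sq_tgt s \<otimes>\<^bsub>C\<^esub> sq_tgt t)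
     (sq0 s \<otimes>\<^bsub>C\<^esub> sq0 t) (sq1 s \<otimes>\<^bsub>C\<^esub> sq1 t)"
  "TUnit (arrow_tensor C) = \<one>\<^bsub>C\<^esub> (TUnit C)"
  "Assoc (arrow_tensor C) f g h = Square ((f \<otimes>\<^bsub>C\<^esub> g) \<otimes>\<^bsub>C\<^esub> h) (f \<otimes>\<^bsub>C\<^esub> g \<otimes>\<^bsub>C\<^esub> h)
     (Assoc C (Dom C f) (Dom C g) (Dom C h)) (Assoc C (Cod C f) (Cod C g) (Cod C h))"
  "LUnit (arrow_tensor C) f =
     Square (\<one>\<^bsub>C\<^esub> (TUnit C) \<otimes>\<^bsub>C\<^esub> f) f (LUnit C (Dom C f)) (LUnit C (Cod C f))"
  "RUnit (arrow_tensor C) f =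
     Square (f \<otimes>\<^bsub>C\<^esub> \<one>\<^bsub>C\<^esub> (TUnit C)) f (RUnit C (Dom C f)) (RUnit C (Cod C f))"
  "Symm (arrow_tensor C) f g = Square (f \<otimes>\<^bsub>C\<^esub> g) (g \<otimes>\<^bsub>C\<^esub> f)
     (Symm C (Dom C f) (Dom C g)) (Symm C (Cod C f) (Cod C g))"
  by (simp_all add: arrow_tensor_def)

lemma arrow_pushout_product_structure:
  "TOb (arrow_pushout_product C) f g = f \<box>\<^bsub>C\<^esub> g"
  "TAr (arrow_pushout_product C) s t = pushout_product_map C s t"
  "TUnit (arrow_pushout_product C) = pp_unit C"
  "Assoc (arrow_pushout_product C) f g h = Square ((f \<box>\<^bsub>C\<^esub> g) \<box>\<^bsub>C\<^esub> h) (f \<box>\<^bsub>C\<^esub> g \<box>\<^bsub>C\<^esub> h)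
     (pp_assoc0 C f g h) (Assoc C (Cod C f) (Cod C g) (Cod C h))"
  "LUnit (arrow_pushout_product C) f =
     Square (pp_unit C \<box>\<^bsub>C\<^esub> f) f (pp_lunit0 C f) (LUnit C (Cod C f))"
  "RUnit (arrow_pushout_product C) f =
     Square (f \<box>\<^bsub>C\<^esub> pp_unit C) f (pp_runit0 C f) (RUnit C (Cod C f))"
  "Symm (arrow_pushout_product C) f g = Square (f \<box>\<^bsub>C\<^esub> g) (g \<box>\<^bsub>C\<^esub> f)
     (pp_symm0 C f g) (Symm C (Cod C f) (Cod C g))"
  by (simp_all add: arrow_pushout_product_def)

context category
begin

lemma paste_squares:
  assumes "b \<circ> f = g \<circ> a" "b' \<circ> g = h \<circ> a'"
    and "f \<in> Ar C" "a \<in> Ar C" "b \<in> Ar C" "g \<in> Ar C" "a' \<in> Ar C" "b' \<in> Ar C" "h \<in> Ar C"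
    and "Dom C b = Cod C f" "Dom C g = Cod C a" "Dom C b' = Cod C b" "Cod C b = Cod C g"
      "Dom C a' = Dom C g" "Dom C h = Cod C a'"
  shows "b' \<circ> b \<circ> f = h \<circ> a' \<circ> a"
  using assms Comp_eq_Comp[OF assms(2), of a] by simp

lemma category_arrow_category: "category (arrow_category C)"
  by unfold_locales (auto simp: in_hom in_Ar_arrow_category intro!: paste_squares)

lemma is_iso_Square:
  assumes sq: "Square f g a b \<in> Ar (arrow_category C)" and ab: "is_iso C a" "is_iso C b"
  shows "is_iso (arrow_category C) (Square f g a b)"
proof -
  obtain a' where a: "a' \<in> Ar C" "Dom C a' = Cod C a" "Cod C a' = Dom C a"
    "a' \<circ> a = \<one> (Dom C a)" "a \<circ> a' = \<one> (Cod C a)"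
    using ab(1) by (rule isoE)
  obtain b' where b: "b' \<in> Ar C" "Dom C b' = Cod C b" "Cod C b' = Dom C b"
    "b' \<circ> b = \<one> (Dom C b)" "b \<circ> b' = \<one> (Cod C b)"
    using ab(2) by (rule isoE)
  note sq' = sq[unfolded in_Ar_arrow_category, simplified]
  have "b \<circ> f \<circ> a' = g"
    using Comp_eq_Comp[of b f "g \<circ> a" a'] sq' a by simp
  moreover have "b' \<circ> b \<circ> f \<circ> a' = f \<circ> a'"
    using Comp_eq_Comp[OF b(4), of "f \<circ> a'"] sq' a b by simp
  ultimately have "f \<circ> a' = b' \<circ> g"
    by simp
  then have "Square g f a' b' \<in> Ar (arrow_category C)"
    using sq' a b by (simp add: in_Ar_arrow_category)
  then show ?thesis
    using sq sq' a b by (intro category.isoI[OF category_arrow_category, of _ "Square g f a' b'"]) simp_all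
qed

end

context symmetric_monoidal_category
begin

lemma category_arrow_tensor: "category (arrow_tensor C)"
  using category_arrow_category unfolding category_def by simp

lemma category_arrow_pushout_product: "category (arrow_pushout_product C)"
  using category_arrow_category unfolding category_def by simp

lemma symmetric_monoidal_arrow_tensor: "symmetric_monoidal_category (arrow_tensor C)"
  unfolding symmetric_monoidal_category_def
proof (rule conjI[OF category_arrow_tensor])
  show "symmetric_monoidal_category_axioms (arrow_tensor C)"
    by unfold_locales
      (auto simp: arrow_tensor_structure in_hom in_Ar_arrow_category Comp_TAr structure_nat Symm_Symm pentagon triangle hexagon
        intro!: is_iso_Square Assoc_iso LUnit_iso RUnit_iso)
qed

end

section \<open>The pushout product\<close>

context pointed_closed_monoidal_category
begin

lemma pushout_product_pushout:
  assumes "f \<in> Ar C" "g \<in> Ar C"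
  shows "is_pushout C (\<one> (Dom C f) \<otimes> g) (f \<otimes> \<one> (Dom C g)) (pp_inl C f g) (pp_inr C f g)"
  unfolding pp_inl_def pp_inr_def by (rule is_pushout_po_in) (use assms in simp_all)

lemma pp_desc_simps:
  assumes "f \<in> Ar C" "g \<in> Ar C"
    and "x \<in> Ar C" "y \<in> Ar C" "Dom C x = Dom C f \<otimes>\<^sub>o Cod C g" "Dom C y = Cod C f \<otimes>\<^sub>o Dom C g"
      "Cod C x = Cod C y"
    and "x \<circ> (\<one> (Dom C f) \<otimes> g) = y \<circ> (f \<otimes> \<one> (Dom C g))"
  shows "pp_desc C f g x y \<in> Ar C" "Dom C (pp_desc C f g x y) = Cod C (pp_inl C f g)"
    "Cod C (pp_desc C f g x y) = Cod C x"
    "pp_desc C f g x y \<circ> pp_inl C f g = x" "pp_desc C f g x y \<circ> pp_inr C f g = y"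
  using po_desc_simps[of "\<one> (Dom C f) \<otimes> g" "f \<otimes> \<one> (Dom C g)" x y] assms
  by (simp_all add: pp_desc_def pp_inl_def pp_inr_def)

lemma pushout_product_simps [simp]:
  assumes "f \<in> Ar C" "g \<in> Ar C"
  shows "f \<box> g \<in> Ar C" "Cod C (f \<box> g) = Cod C f \<otimes>\<^sub>o Cod C g"
    "pp_inl C f g \<in> Ar C" "Dom C (pp_inl C f g) = Dom C f \<otimes>\<^sub>o Cod C g"
    "Cod C (pp_inl C f g) = Dom C (f \<box> g)"
    "pp_inr C f g \<in> Ar C" "Dom C (pp_inr C f g) = Cod C f \<otimes>\<^sub>o Dom C g"
    "Cod C (pp_inr C f g) = Dom C (f \<box> g)"
    and pushout_product_inl: "(f \<box> g) \<circ> pp_inl C f g = f \<otimes> \<one> (Cod C g)"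
    and pushout_product_inr: "(f \<box> g) \<circ> pp_inr C f g = \<one> (Cod C f) \<otimes> g"
proof -
  note po = is_pushoutD[OF pushout_product_pushout[OF assms]]
  have eq: "(f \<otimes> \<one> (Cod C g)) \<circ> (\<one> (Dom C f) \<otimes> g) = (\<one> (Cod C f) \<otimes> g) \<circ> (f \<otimes> \<one> (Dom C g))"
    using assms by (simp add: Comp_TAr)
  note d = pp_desc_simps[OF assms _ _ _ _ _ eq, simplified assms TAr_simps Idt_simps Dom_Ob Cod_Ob,
      folded pushout_product_def]
  show "f \<box> g \<in> Ar C" "Cod C (f \<box> g) = Cod C f \<otimes>\<^sub>o Cod C g"
    "pp_inl C f g \<in> Ar C" "Dom C (pp_inl C f g) = Dom C f \<otimes>\<^sub>o Cod C g"
    "Cod C (pp_inl C f g) = Dom C (f \<box> g)"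
    "pp_inr C f g \<in> Ar C" "Dom C (pp_inr C f g) = Cod C f \<otimes>\<^sub>o Dom C g"
    "Cod C (pp_inr C f g) = Dom C (f \<box> g)"
    "(f \<box> g) \<circ> pp_inl C f g = f \<otimes> \<one> (Cod C g)"
    "(f \<box> g) \<circ> pp_inr C f g = \<one> (Cod C f) \<otimes> g"
    using assms po d by simp_all
qed

text \<open>The defining relation of the pushout, precomposed with \<open>\<one> (Dom C f) \<otimes> b\<close>. In iterated
  pushout products \<open>b\<close> is a coprojection of \<open>g = g1 \<box> g2\<close>, and \<open>g \<circ> b\<close> then simplifies further.\<close>

lemma pushout_product_glue:
  assumes "f \<in> Ar C" "g \<in> Ar C" "b \<in> Ar C" "Cod C b = Dom C g"
  shows "pp_inr C f g \<circ> (f \<otimes> b) = pp_inl C f g \<circ> (\<one> (Dom C f) \<otimes> (g \<circ> b))"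
proof -
  note po = is_pushoutD[OF pushout_product_pushout[OF assms(1,2)]]
  have "pp_inr C f g \<circ> (f \<otimes> b) = pp_inr C f g \<circ> (f \<otimes> \<one> (Dom C g)) \<circ> (\<one> (Dom C f) \<otimes> b)"
    using assms by (simp add: Comp_TAr)
  also have "\<dots> = pp_inl C f g \<circ> (\<one> (Dom C f) \<otimes> g) \<circ> (\<one> (Dom C f) \<otimes> b)"
    using Comp_eq_Comp[OF po(9)[symmetric], of "\<one> (Dom C f) \<otimes> b"] assms by simp
  also have "\<dots> = pp_inl C f g \<circ> (\<one> (Dom C f) \<otimes> (g \<circ> b))"
    using assms by (simp add: Comp_TAr)
  finally show ?thesis .
qed

lemma pushout_product_ext:
  assumes "f \<in> Ar C" "g \<in> Ar C"
    and "u \<in> Ar C" "v \<in> Ar C" "Dom C u = Dom C (f \<box> g)" "Dom C v = Dom C (f \<box> g)" "Cod C u = Cod C v"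
    and "u \<circ> pp_inl C f g = v \<circ> pp_inl C f g" "u \<circ> pp_inr C f g = v \<circ> pp_inr C f g"
  shows "u = v"
  by (rule pushout_ext[OF pushout_product_pushout[OF assms(1,2)]]) (use assms in simp_all)

lemma pushout_product_ext_right:
  assumes "f \<in> Ar C" "g \<in> Ar C" "W \<in> Ob C"
    and "u \<in> Ar C" "v \<in> Ar C" "Dom C u = Dom C (f \<box> g) \<otimes>\<^sub>o W" "Dom C v = Dom C (f \<box> g) \<otimes>\<^sub>o W"
      "Cod C u = Cod C v"
    and "u \<circ> (pp_inl C f g \<otimes> \<one> W) = v \<circ> (pp_inl C f g \<otimes> \<one> W)"
      "u \<circ> (pp_inr C f g \<otimes> \<one> W) = v \<circ> (pp_inr C f g \<otimes> \<one> W)"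
  shows "u = v"
  by (rule pushout_ext[OF is_pushout_tensor_right[OF pushout_product_pushout[OF assms(1,2)] assms(3)]])
    (use assms in simp_all)

lemma pushout_product_ext_right_right:
  assumes "f \<in> Ar C" "g \<in> Ar C" "V \<in> Ob C" "W \<in> Ob C"
    and "u \<in> Ar C" "v \<in> Ar C" "Dom C u = (Dom C (f \<box> g) \<otimes>\<^sub>o V) \<otimes>\<^sub>o W"
      "Dom C v = (Dom C (f \<box> g) \<otimes>\<^sub>o V) \<otimes>\<^sub>o W" "Cod C u = Cod C v"
    and "u \<circ> ((pp_inl C f g \<otimes> \<one> V) \<otimes> \<one> W) = v \<circ> ((pp_inl C f g \<otimes> \<one> V) \<otimes> \<one> W)"
      "u \<circ> ((pp_inr C f g \<otimes> \<one> V) \<otimes> \<one> W) = v \<circ> ((pp_inr C f g \<otimes> \<one> V) \<otimes> \<one> W)"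
  shows "u = v"
  by (rule pushout_ext[OF is_pushout_tensor_right[OF is_pushout_tensor_right[OF
          pushout_product_pushout[OF assms(1,2)] assms(3)] assms(4)]])
    (use assms in simp_all)

lemma pushout_product_ext_left:
  assumes "f \<in> Ar C" "g \<in> Ar C" "W \<in> Ob C"
    and "u \<in> Ar C" "v \<in> Ar C" "Dom C u = W \<otimes>\<^sub>o Dom C (f \<box> g)" "Dom C v = W \<otimes>\<^sub>o Dom C (f \<box> g)"
      "Cod C u = Cod C v"
    and "u \<circ> (\<one> W \<otimes> pp_inl C f g) = v \<circ> (\<one> W \<otimes> pp_inl C f g)"
      "u \<circ> (\<one> W \<otimes> pp_inr C f g) = v \<circ> (\<one> W \<otimes> pp_inr C f g)"
  shows "u = v"
  by (rule pushout_ext[OF is_pushout_tensor_left[OF pushout_product_pushout[OF assms(1,2)] assms(3)]])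
    (use assms in simp_all)

text \<open>The domain of \<open>(f \<box> g) \<box> h\<close> is covered by \<open>(X0 \<otimes> Y1) \<otimes> Z1\<close>, \<open>(X1 \<otimes> Y0) \<otimes> Z1\<close> and
  \<open>(X1 \<otimes> Y1) \<otimes> Z0\<close>, since tensoring with \<open>Z1\<close> keeps the coprojections of \<open>f \<box> g\<close> jointly
  epic.\<close>

lemma pushout_product_ext3:
  assumes "f \<in> Ar C" "g \<in> Ar C" "h \<in> Ar C"
    and "u \<in> Ar C" "v \<in> Ar C" "Dom C u = Dom C ((f \<box> g) \<box> h)" "Dom C v = Dom C ((f \<box> g) \<box> h)"
      "Cod C u = Cod C v"
    and "u \<circ> pp_inl C (f \<box> g) h \<circ> (pp_inl C f g \<otimes> \<one> (Cod C h)) =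
         v \<circ> pp_inl C (f \<box> g) h \<circ> (pp_inl C f g \<otimes> \<one> (Cod C h))"
      "u \<circ> pp_inl C (f \<box> g) h \<circ> (pp_inr C f g \<otimes> \<one> (Cod C h)) =
       v \<circ> pp_inl C (f \<box> g) h \<circ> (pp_inr C f g \<otimes> \<one> (Cod C h))"
      "u \<circ> pp_inr C (f \<box> g) h = v \<circ> pp_inr C (f \<box> g) h"
  shows "u = v"
proof (rule pushout_product_ext[of "f \<box> g" h])
  show "u \<circ> pp_inl C (f \<box> g) h = v \<circ> pp_inl C (f \<box> g) h"
    by (rule pushout_product_ext_right[of f g "Cod C h"]) (use assms in simp_all)
qed (use assms in simp_all)

lemma pushout_product_map_simps [simp]:
  "sq_src (pushout_product_map C s t) = sq_src s \<box> sq_src t"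
  "sq_tgt (pushout_product_map C s t) = sq_tgt s \<box> sq_tgt t"
  "sq1 (pushout_product_map C s t) = sq1 s \<otimes> sq1 t"
  by (simp_all add: pushout_product_map_def)

lemma pushout_product_map0:
  assumes s: "s \<in> Ar (arrow_category C)" and t: "t \<in> Ar (arrow_category C)"
    and src: "sq_src s = f" "sq_src t = g" "sq_tgt s = f'" "sq_tgt t = g'"
  shows "sq0 (pushout_product_map C s t) \<in> Ar C"
    "Dom C (sq0 (pushout_product_map C s t)) = Dom C (f \<box> g)"
    "Cod C (sq0 (pushout_product_map C s t)) = Dom C (f' \<box> g')"
    "sq0 (pushout_product_map C s t) \<circ> pp_inl C f g = pp_inl C f' g' \<circ> (sq0 s \<otimes> sq1 t)"
    "sq0 (pushout_product_map C s t) \<circ> pp_inr C f g = pp_inr C f' g' \<circ> (sq1 s \<otimes> sq0 t)"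
proof -
  note st = s[unfolded in_Ar_arrow_category src] t[unfolded in_Ar_arrow_category src]
  have "(pp_inl C f' g' \<circ> (sq0 s \<otimes> sq1 t)) \<circ> (\<one> (Dom C f) \<otimes> g) =
      pp_inl C f' g' \<circ> (\<one> (Dom C f') \<otimes> g') \<circ> (sq0 s \<otimes> sq0 t)"
    using st by (simp add: Comp_TAr)
  also have "\<dots> = (pp_inl C f' g' \<circ> (\<one> (Dom C f') \<otimes> g')) \<circ> (sq0 s \<otimes> sq0 t)"
    using st by simp
  also have "\<dots> = (pp_inr C f' g' \<circ> (f' \<otimes> \<one> (Dom C g'))) \<circ> (sq0 s \<otimes> sq0 t)"
    using is_pushoutD(9)[OF pushout_product_pushout[of f' g']] st by simp
  also have "\<dots> = (pp_inr C f' g' \<circ> (sq1 s \<otimes> sq0 t)) \<circ> (f \<otimes> \<one> (Dom C g))"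
    using st by (simp add: Comp_TAr)
  finally have eq: "(pp_inl C f' g' \<circ> (sq0 s \<otimes> sq1 t)) \<circ> (\<one> (Dom C f) \<otimes> g) =
    (pp_inr C f' g' \<circ> (sq1 s \<otimes> sq0 t)) \<circ> (f \<otimes> \<one> (Dom C g))" .
  show "sq0 (pushout_product_map C s t) \<in> Ar C"
    "Dom C (sq0 (pushout_product_map C s t)) = Dom C (f \<box> g)"
    "Cod C (sq0 (pushout_product_map C s t)) = Dom C (f' \<box> g')"
    "sq0 (pushout_product_map C s t) \<circ> pp_inl C f g = pp_inl C f' g' \<circ> (sq0 s \<otimes> sq1 t)"
    "sq0 (pushout_product_map C s t) \<circ> pp_inr C f g = pp_inr C f' g' \<circ> (sq1 s \<otimes> sq0 t)"
    using pp_desc_simps[OF _ _ _ _ _ _ _ eq] st by (simp_all add: pushout_product_map_def src)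
qed

text \<open>On each summand the square commutes by functoriality of the tensor product.\<close>

lemma pushout_product_map_Ar:
  assumes "s \<in> Ar (arrow_category C)" "t \<in> Ar (arrow_category C)"
  shows "pushout_product_map C s t \<in> Ar (arrow_category C)"
proof -
  note m = pushout_product_map0[OF assms refl refl refl refl]
  note st = assms[unfolded in_Ar_arrow_category]
  have "(sq1 s \<otimes> sq1 t) \<circ> (sq_src s \<box> sq_src t) =
      (sq_tgt s \<box> sq_tgt t) \<circ> sq0 (pushout_product_map C s t)"
  proof (rule pushout_product_ext[of "sq_src s" "sq_src t"])
    show "((sq1 s \<otimes> sq1 t) \<circ> (sq_src s \<box> sq_src t)) \<circ> pp_inl C (sq_src s) (sq_src t) =
        ((sq_tgt s \<box> sq_tgt t) \<circ> sq0 (pushout_product_map C s t)) \<circ> pp_inl C (sq_src s) (sq_src t)"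
      using st m by (simp add: Comp_eq_Comp[OF pushout_product_inl] pushout_product_inl Comp_TAr)
    show "((sq1 s \<otimes> sq1 t) \<circ> (sq_src s \<box> sq_src t)) \<circ> pp_inr C (sq_src s) (sq_src t) =
        ((sq_tgt s \<box> sq_tgt t) \<circ> sq0 (pushout_product_map C s t)) \<circ> pp_inr C (sq_src s) (sq_src t)"
      using st m by (simp add: Comp_eq_Comp[OF pushout_product_inr] pushout_product_inr Comp_TAr)
  qed (use st m in simp_all)
  then show ?thesis
    using st m by (simp add: in_Ar_arrow_category)
qed

text \<open>In iterated products the defining equations of the induced map occur inside a tensor
  product.\<close>

lemma pushout_product_map_whisker:
  assumes s: "s \<in> Ar (arrow_category C)" and t: "t \<in> Ar (arrow_category C)"
    and src: "sq_src s = f" "sq_src t = g" "sq_tgt s = f'" "sq_tgt t = g'"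
    and u: "u \<in> Ar C"
  shows "(sq0 (pushout_product_map C s t) \<otimes> u) \<circ> (pp_inl C f g \<otimes> \<one> (Dom C u)) =
      (pp_inl C f' g' \<otimes> \<one> (Cod C u)) \<circ> ((sq0 s \<otimes> sq1 t) \<otimes> u)"
    "(sq0 (pushout_product_map C s t) \<otimes> u) \<circ> (pp_inr C f g \<otimes> \<one> (Dom C u)) =
      (pp_inr C f' g' \<otimes> \<one> (Cod C u)) \<circ> ((sq1 s \<otimes> sq0 t) \<otimes> u)"
    "(u \<otimes> sq0 (pushout_product_map C s t)) \<circ> (\<one> (Dom C u) \<otimes> pp_inl C f g) =
      (\<one> (Cod C u) \<otimes> pp_inl C f' g') \<circ> (u \<otimes> (sq0 s \<otimes> sq1 t))"
    "(u \<otimes> sq0 (pushout_product_map C s t)) \<circ> (\<one> (Dom C u) \<otimes> pp_inr C f g) =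
      (\<one> (Cod C u) \<otimes> pp_inr C f' g') \<circ> (u \<otimes> (sq1 s \<otimes> sq0 t))"
  using pushout_product_map0[OF s t src] u s[unfolded in_Ar_arrow_category src]
    t[unfolded in_Ar_arrow_category src]
  by (simp_all add: Comp_TAr)


subsection \<open>Symmetry\<close>

lemma pp_symm0_simps [simp]:
  assumes "f \<in> Ar C" "g \<in> Ar C"
  shows "pp_symm0 C f g \<in> Ar C" "Dom C (pp_symm0 C f g) = Dom C (f \<box> g)"
    "Cod C (pp_symm0 C f g) = Dom C (g \<box> f)"
    and pp_symm0_inl: "pp_symm0 C f g \<circ> pp_inl C f g = pp_inr C g f \<circ> Symm C (Dom C f) (Cod C g)"
    and pp_symm0_inr: "pp_symm0 C f g \<circ> pp_inr C f g = pp_inl C g f \<circ> Symm C (Cod C f) (Dom C g)"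
proof -
  have "(pp_inr C g f \<circ> Symm C (Dom C f) (Cod C g)) \<circ> (\<one> (Dom C f) \<otimes> g) =
      (pp_inr C g f \<circ> (g \<otimes> \<one> (Dom C f))) \<circ> Symm C (Dom C f) (Dom C g)"
    using assms by (simp add: structure_nat)
  also have "\<dots> = (pp_inl C g f \<circ> (\<one> (Dom C g) \<otimes> f)) \<circ> Symm C (Dom C f) (Dom C g)"
    using assms by (simp add: pushout_product_glue)
  also have "\<dots> = (pp_inl C g f \<circ> Symm C (Cod C f) (Dom C g)) \<circ> (f \<otimes> \<one> (Dom C g))"
    using assms by (simp add: structure_nat)
  finally show "pp_symm0 C f g \<in> Ar C" "Dom C (pp_symm0 C f g) = Dom C (f \<box> g)"
    "Cod C (pp_symm0 C f g) = Dom C (g \<box> f)"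
    "pp_symm0 C f g \<circ> pp_inl C f g = pp_inr C g f \<circ> Symm C (Dom C f) (Cod C g)"
    "pp_symm0 C f g \<circ> pp_inr C f g = pp_inl C g f \<circ> Symm C (Cod C f) (Dom C g)"
    using pp_desc_simps[of f g "pp_inr C g f \<circ> Symm C (Dom C f) (Cod C g)"
        "pp_inl C g f \<circ> Symm C (Cod C f) (Dom C g)"] assms
    by (simp_all add: pp_symm0_def)
qed

lemma pp_symm0_symm0:
  assumes "f \<in> Ar C" "g \<in> Ar C"
  shows "pp_symm0 C g f \<circ> pp_symm0 C f g = \<one> (Dom C (f \<box> g))"
  by (rule pushout_product_ext[of f g])
    (use assms in \<open>simp_all add: pp_symm0_inl pp_symm0_inr Comp_eq_Comp[OF pp_symm0_inl]
      Comp_eq_Comp[OF pp_symm0_inr] Symm_Symm\<close>)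

lemma pp_symm0_square:
  assumes "f \<in> Ar C" "g \<in> Ar C"
  shows "Symm C (Cod C f) (Cod C g) \<circ> (f \<box> g) = (g \<box> f) \<circ> pp_symm0 C f g"
  by (rule pushout_product_ext[of f g])
    (use assms in \<open>simp_all add: pp_symm0_inl pp_symm0_inr pushout_product_inl pushout_product_inr
      Comp_eq_Comp[OF pushout_product_inl] Comp_eq_Comp[OF pushout_product_inr] structure_nat\<close>)

lemma pp_symm0_natural:
  assumes s: "s \<in> Ar (arrow_category C)" and t: "t \<in> Ar (arrow_category C)"
  shows "pp_symm0 C (sq_tgt s) (sq_tgt t) \<circ> sq0 (pushout_product_map C s t) =
    sq0 (pushout_product_map C t s) \<circ> pp_symm0 C (sq_src s) (sq_src t)"
proof -
  note st = s[unfolded in_Ar_arrow_category] t[unfolded in_Ar_arrow_category]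
  note m = pushout_product_map0[OF s t refl refl refl refl]
    and m' = pushout_product_map0[OF t s refl refl refl refl]
  show ?thesis
    by (rule pushout_product_ext[of "sq_src s" "sq_src t"])
      (use st m m' in \<open>simp_all add: pp_symm0_inl pp_symm0_inr Comp_eq_Comp[OF pp_symm0_inl]
      Comp_eq_Comp[OF pp_symm0_inr] Comp_eq_Comp[OF m'(4)] Comp_eq_Comp[OF m'(5)] structure_nat\<close>)
qed


subsection \<open>Units\<close>

lemma pp_unit_simps [simp]:
  "pp_unit C \<in> Ar C" "Dom C (pp_unit C) = zero_ob C" "Cod C (pp_unit C) = TUnit C"
  by (simp_all add: pp_unit_def)

text \<open>The other summand \<open>0 \<otimes> X1\<close> of \<open>pp_unit C \<box> f\<close> is initial.\<close>

lemma pp_unit_left_ext: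
  assumes "f \<in> Ar C"
    and "u \<in> Ar C" "v \<in> Ar C" "Dom C u = Dom C (pp_unit C \<box> f)" "Dom C v = Dom C (pp_unit C \<box> f)"
      "Cod C u = Cod C v"
    and "u \<circ> pp_inr C (pp_unit C) f = v \<circ> pp_inr C (pp_unit C) f"
  shows "u = v"
proof (rule pushout_product_ext[of "pp_unit C" f])
  show "u \<circ> pp_inl C (pp_unit C) f = v \<circ> pp_inl C (pp_unit C) f"
    by (rule is_initialD(2)[OF is_initial_tensor_right[OF zero_initial, of "Cod C f"]])
      (use assms in simp_all)
qed (use assms in simp_all)

lemma pp_unit_right_ext:
  assumes "f \<in> Ar C"
    and "u \<in> Ar C" "v \<in> Ar C" "Dom C u = Dom C (f \<box> pp_unit C)" "Dom C v = Dom C (f \<box> pp_unit C)"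
      "Cod C u = Cod C v"
    and "u \<circ> pp_inl C f (pp_unit C) = v \<circ> pp_inl C f (pp_unit C)"
  shows "u = v"
proof (rule pushout_product_ext[of f "pp_unit C"])
  show "u \<circ> pp_inr C f (pp_unit C) = v \<circ> pp_inr C f (pp_unit C)"
    by (rule is_initialD(2)[OF is_initial_tensor_left[OF zero_initial, of "Cod C f"]])
      (use assms in simp_all)
qed (use assms in simp_all)

lemma pp_lunit0_simps [simp]:
  assumes f: "f \<in> Ar C"
  shows "pp_lunit0 C f \<in> Ar C" "Dom C (pp_lunit0 C f) = Dom C (pp_unit C \<box> f)"
    "Cod C (pp_lunit0 C f) = Dom C f"
    and pp_lunit0_inr: "pp_lunit0 C f \<circ> pp_inr C (pp_unit C) f = LUnit C (Dom C f)"
proof -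
  let ?z = "zero_arrow (zero_ob C \<otimes>\<^sub>o Cod C f) (Dom C f)"
  have "?z \<circ> (\<one> (zero_ob C) \<otimes> f) = LUnit C (Dom C f) \<circ> (pp_unit C \<otimes> \<one> (Dom C f))"
    by (rule is_initialD(2)[OF is_initial_tensor_right[OF zero_initial, of "Dom C f"]])
      (use f in simp_all)
  then have ex: "pp_desc C (pp_unit C) f ?z (LUnit C (Dom C f)) \<in> Ar C"
    "Dom C (pp_desc C (pp_unit C) f ?z (LUnit C (Dom C f))) = Dom C (pp_unit C \<box> f)"
    "Cod C (pp_desc C (pp_unit C) f ?z (LUnit C (Dom C f))) = Dom C f"
    "pp_desc C (pp_unit C) f ?z (LUnit C (Dom C f)) \<circ> pp_inr C (pp_unit C) f = LUnit C (Dom C f)"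
    using pp_desc_simps[of "pp_unit C" f ?z "LUnit C (Dom C f)"] f by simp_all
  have "pp_lunit0 C f = pp_desc C (pp_unit C) f ?z (LUnit C (Dom C f))"
    unfolding pp_lunit0_def in_hom
  proof (rule the_equality)
    fix t
    assume "(t \<in> Ar C \<and> Dom C t = Dom C (pp_unit C \<box> f) \<and> Cod C t = Dom C f) \<and>
      t \<circ> pp_inr C (pp_unit C) f = LUnit C (Dom C f)"
    then show "t = pp_desc C (pp_unit C) f ?z (LUnit C (Dom C f))"
      using ex f by - (rule pp_unit_left_ext[of f], simp_all)
  qed (use ex in simp)
  then show "pp_lunit0 C f \<in> Ar C" "Dom C (pp_lunit0 C f) = Dom C (pp_unit C \<box> f)"
    "Cod C (pp_lunit0 C f) = Dom C f"
    "pp_lunit0 C f \<circ> pp_inr C (pp_unit C) f = LUnit C (Dom C f)"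
    using ex by simp_all
qed

lemma pp_runit0_simps [simp]:
  assumes f: "f \<in> Ar C"
  shows "pp_runit0 C f \<in> Ar C" "Dom C (pp_runit0 C f) = Dom C (f \<box> pp_unit C)"
    "Cod C (pp_runit0 C f) = Dom C f"
    and pp_runit0_inl: "pp_runit0 C f \<circ> pp_inl C f (pp_unit C) = RUnit C (Dom C f)"
proof -
  let ?z = "zero_arrow (Cod C f \<otimes>\<^sub>o zero_ob C) (Dom C f)"
  have "RUnit C (Dom C f) \<circ> (\<one> (Dom C f) \<otimes> pp_unit C) = ?z \<circ> (f \<otimes> \<one> (zero_ob C))"
    by (rule is_initialD(2)[OF is_initial_tensor_left[OF zero_initial, of "Dom C f"]])
      (use f in simp_all)
  then have ex: "pp_desc C f (pp_unit C) (RUnit C (Dom C f)) ?z \<in> Ar C"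
    "Dom C (pp_desc C f (pp_unit C) (RUnit C (Dom C f)) ?z) = Dom C (f \<box> pp_unit C)"
    "Cod C (pp_desc C f (pp_unit C) (RUnit C (Dom C f)) ?z) = Dom C f"
    "pp_desc C f (pp_unit C) (RUnit C (Dom C f)) ?z \<circ> pp_inl C f (pp_unit C) = RUnit C (Dom C f)"
    using pp_desc_simps[of f "pp_unit C" "RUnit C (Dom C f)" ?z] f by simp_all
  have "pp_runit0 C f = pp_desc C f (pp_unit C) (RUnit C (Dom C f)) ?z"
    unfolding pp_runit0_def in_hom
  proof (rule the_equality)
    fix t
    assume "(t \<in> Ar C \<and> Dom C t = Dom C (f \<box> pp_unit C) \<and> Cod C t = Dom C f) \<and>
      t \<circ> pp_inl C f (pp_unit C) = RUnit C (Dom C f)"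
    then show "t = pp_desc C f (pp_unit C) (RUnit C (Dom C f)) ?z"
      using ex f by - (rule pp_unit_right_ext[of f], simp_all)
  qed (use ex in simp)
  then show "pp_runit0 C f \<in> Ar C" "Dom C (pp_runit0 C f) = Dom C (f \<box> pp_unit C)"
    "Cod C (pp_runit0 C f) = Dom C f"
    "pp_runit0 C f \<circ> pp_inl C f (pp_unit C) = RUnit C (Dom C f)"
    using ex by simp_all
qed

text \<open>The coprojection from \<open>S \<otimes> X0\<close>, composed with the inverse of the unitor of \<open>C\<close>, is the
  inverse.\<close>

lemma pp_lunit0_iso:
  assumes f: "f \<in> Ar C"
  shows "is_iso C (pp_lunit0 C f)"
proof -
  obtain l where l: "l \<in> Ar C" "Dom C l = Dom C f" "Cod C l = TUnit C \<otimes>\<^sub>o Dom C f"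
    "l \<circ> LUnit C (Dom C f) = \<one> (TUnit C \<otimes>\<^sub>o Dom C f)" "LUnit C (Dom C f) \<circ> l = \<one> (Dom C f)"
    using LUnit_iso[of "Dom C f"] f by (auto elim: isoE)
  have "(pp_inr C (pp_unit C) f \<circ> l) \<circ> pp_lunit0 C f = \<one> (Dom C (pp_unit C \<box> f))"
    by (rule pp_unit_left_ext[of f]) (use f l in \<open>simp_all add: pp_lunit0_inr\<close>)
  then show ?thesis
    using f l Comp_eq_Comp[OF pp_lunit0_inr[OF f], of l]
    by (intro isoI[of _ "pp_inr C (pp_unit C) f \<circ> l"]) simp_all
qed

lemma pp_runit0_iso:
  assumes f: "f \<in> Ar C"
  shows "is_iso C (pp_runit0 C f)"
proof -
  obtain r where r: "r \<in> Ar C" "Dom C r = Dom C f" "Cod C r = Dom C f \<otimes>\<^sub>o TUnit C"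
    "r \<circ> RUnit C (Dom C f) = \<one> (Dom C f \<otimes>\<^sub>o TUnit C)" "RUnit C (Dom C f) \<circ> r = \<one> (Dom C f)"
    using RUnit_iso[of "Dom C f"] f by (auto elim: isoE)
  have "(pp_inl C f (pp_unit C) \<circ> r) \<circ> pp_runit0 C f = \<one> (Dom C (f \<box> pp_unit C))"
    by (rule pp_unit_right_ext[of f]) (use f r in \<open>simp_all add: pp_runit0_inl\<close>)
  then show ?thesis
    using f r Comp_eq_Comp[OF pp_runit0_inl[OF f], of r]
    by (intro isoI[of _ "pp_inl C f (pp_unit C) \<circ> r"]) simp_all
qed

lemma pp_lunit0_square:
  assumes "f \<in> Ar C"
  shows "LUnit C (Cod C f) \<circ> (pp_unit C \<box> f) = f \<circ> pp_lunit0 C f"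
  by (rule pp_unit_left_ext[of f])
    (use assms in \<open>simp_all add: pushout_product_inr pp_lunit0_inr structure_nat\<close>)

lemma pp_runit0_square:
  assumes "f \<in> Ar C"
  shows "RUnit C (Cod C f) \<circ> (f \<box> pp_unit C) = f \<circ> pp_runit0 C f"
  by (rule pp_unit_right_ext[of f])
    (use assms in \<open>simp_all add: pushout_product_inl pp_runit0_inl structure_nat\<close>)

lemma pp_unit_Idt_Ar: "Square (pp_unit C) (pp_unit C) (\<one> (zero_ob C)) (\<one> (TUnit C)) \<in> Ar (arrow_category C)"
  by (simp add: in_Ar_arrow_category)

lemma pp_lunit0_natural:
  assumes s: "s \<in> Ar (arrow_category C)"
  shows "pp_lunit0 C (sq_tgt s) \<circ> sq0 (pushout_product_map C
      (Square (pp_unit C) (pp_unit C) (\<one> (zero_ob C)) (\<one> (TUnit C))) s) =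
    sq0 s \<circ> pp_lunit0 C (sq_src s)"
proof -
  note st = s[unfolded in_Ar_arrow_category]
  note m = pushout_product_map0[OF pp_unit_Idt_Ar s refl refl refl refl, simplified]
  show ?thesis
    by (rule pp_unit_left_ext[of "sq_src s"])
      (use st m in \<open>simp_all add: pp_lunit0_inr Comp_eq_Comp[OF pp_lunit0_inr] structure_nat\<close>)
qed

lemma pp_runit0_natural:
  assumes s: "s \<in> Ar (arrow_category C)"
  shows "pp_runit0 C (sq_tgt s) \<circ> sq0 (pushout_product_map C s
      (Square (pp_unit C) (pp_unit C) (\<one> (zero_ob C)) (\<one> (TUnit C)))) =
    sq0 s \<circ> pp_runit0 C (sq_src s)"
proof -
  note st = s[unfolded in_Ar_arrow_category]
  note m = pushout_product_map0[OF s pp_unit_Idt_Ar refl refl refl refl, simplified]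
  show ?thesis
    by (rule pp_unit_right_ext[of "sq_src s"])
      (use st m in \<open>simp_all add: pp_runit0_inl Comp_eq_Comp[OF pp_runit0_inl] structure_nat\<close>)
qed


subsection \<open>Associativity\<close>

text \<open>The domain of \<open>(f \<box> g) \<box> h\<close> is a pushout of pushouts. The arrow is first glued on
  \<open>Dom C (f \<box> g) \<otimes>\<^sub>o Z1\<close>, which is a pushout by closedness, and then extended over the last summand.\<close>

lemma pp_assoc0_exists:
  assumes f: "f \<in> Ar C" and g: "g \<in> Ar C" and h: "h \<in> Ar C"
  obtains t where "t \<in> Ar C" "Dom C t = Dom C ((f \<box> g) \<box> h)" "Cod C t = Dom C (f \<box> g \<box> h)"
    "t \<circ> pp_inl C (f \<box> g) h \<circ> (pp_inl C f g \<otimes> \<one> (Cod C h)) =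
      pp_inl C f (g \<box> h) \<circ> Assoc C (Dom C f) (Cod C g) (Cod C h)"
    "t \<circ> pp_inl C (f \<box> g) h \<circ> (pp_inr C f g \<otimes> \<one> (Cod C h)) =
      pp_inr C f (g \<box> h) \<circ> (\<one> (Cod C f) \<otimes> pp_inl C g h) \<circ> Assoc C (Cod C f) (Dom C g) (Cod C h)"
    "t \<circ> pp_inr C (f \<box> g) h =
      pp_inr C f (g \<box> h) \<circ> (\<one> (Cod C f) \<otimes> pp_inr C g h) \<circ> Assoc C (Cod C f) (Cod C g) (Dom C h)"
proof -
  let ?x = "pp_inl C f (g \<box> h) \<circ> Assoc C (Dom C f) (Cod C g) (Cod C h)"
  let ?y = "pp_inr C f (g \<box> h) \<circ> (\<one> (Cod C f) \<otimes> pp_inl C g h) \<circ> Assoc C (Cod C f) (Dom C g) (Cod C h)"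
  let ?z = "pp_inr C f (g \<box> h) \<circ> (\<one> (Cod C f) \<otimes> pp_inr C g h) \<circ> Assoc C (Cod C f) (Cod C g) (Dom C h)"
  note fgh = f g h
  \<comment> \<open>On the overlap of two summands, \<open>f\<close> is moved out of the way by the gluing relation of the
    outer pushout product.\<close>
  have glue_l: "pp_inr C f (g \<box> h) \<circ> (f \<otimes> pp_inl C g h) = pp_inl C f (g \<box> h) \<circ> (\<one> (Dom C f) \<otimes> (g \<otimes> \<one> (Cod C h)))"
    using fgh by (simp add: pushout_product_glue pushout_product_inl)
  have glue_r: "pp_inr C f (g \<box> h) \<circ> (f \<otimes> pp_inr C g h) = pp_inl C f (g \<box> h) \<circ> (\<one> (Dom C f) \<otimes> (\<one> (Cod C g) \<otimes> h))"
    using fgh by (simp add: pushout_product_glue pushout_product_inr)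
  have xy: "?x \<circ> ((\<one> (Dom C f) \<otimes> g) \<otimes> \<one> (Cod C h)) = ?y \<circ> ((f \<otimes> \<one> (Dom C g)) \<otimes> \<one> (Cod C h))"
    using fgh by (simp add: structure_nat Comp_TAr Comp_TAr_Comp Comp_eq_Comp[OF glue_l])
  obtain u where u: "u \<in> Ar C" "Dom C u = Dom C (f \<box> g) \<otimes>\<^sub>o Cod C h" "Cod C u = Dom C (f \<box> g \<box> h)"
    "u \<circ> (pp_inl C f g \<otimes> \<one> (Cod C h)) = ?x" "u \<circ> (pp_inr C f g \<otimes> \<one> (Cod C h)) = ?y"
    using pushout_desc[OF is_pushout_tensor_right[OF pushout_product_pushout[OF f g], of "Cod C h"] _ _ _ _ _ xy]
      fgh by auto
  have ux: "u \<circ> (pp_inl C f g \<otimes> h) = ?x \<circ> (\<one> (Dom C f \<otimes>\<^sub>o Cod C g) \<otimes> h)"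
    using Comp_eq_Comp[OF u(4), of "\<one> (Dom C f \<otimes>\<^sub>o Cod C g) \<otimes> h"] fgh u(1-3) by (simp add: Comp_TAr)
  have uy: "u \<circ> (pp_inr C f g \<otimes> h) = ?y \<circ> (\<one> (Cod C f \<otimes>\<^sub>o Dom C g) \<otimes> h)"
    using Comp_eq_Comp[OF u(5), of "\<one> (Cod C f \<otimes>\<^sub>o Dom C g) \<otimes> h"] fgh u(1-3) by (simp add: Comp_TAr)
  have uz: "u \<circ> (\<one> (Dom C (f \<box> g)) \<otimes> h) = ?z \<circ> ((f \<box> g) \<otimes> \<one> (Dom C h))"
  proof (rule pushout_product_ext_right[of f g "Dom C h"])
    show "(u \<circ> (\<one> (Dom C (f \<box> g)) \<otimes> h)) \<circ> (pp_inl C f g \<otimes> \<one> (Dom C h)) =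
        (?z \<circ> ((f \<box> g) \<otimes> \<one> (Dom C h))) \<circ> (pp_inl C f g \<otimes> \<one> (Dom C h))"
      using fgh u(1-3) by (simp add: Comp_TAr Comp_TAr_Comp ux pushout_product_inl structure_nat Comp_eq_Comp[OF glue_r])
    show "(u \<circ> (\<one> (Dom C (f \<box> g)) \<otimes> h)) \<circ> (pp_inr C f g \<otimes> \<one> (Dom C h)) =
        (?z \<circ> ((f \<box> g) \<otimes> \<one> (Dom C h))) \<circ> (pp_inr C f g \<otimes> \<one> (Dom C h))"
      using fgh u(1-3) by (simp add: Comp_TAr Comp_TAr_Comp uy pushout_product_inr structure_nat pushout_product_glue)
  qed (use fgh u(1-3) in simp_all)
  have "pp_desc C (f \<box> g) h u ?z \<circ> pp_inl C (f \<box> g) h \<circ> (pp_inl C f g \<otimes> \<one> (Cod C h)) = ?x"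
    "pp_desc C (f \<box> g) h u ?z \<circ> pp_inl C (f \<box> g) h \<circ> (pp_inr C f g \<otimes> \<one> (Cod C h)) = ?y"
    using fgh u pp_desc_simps[OF _ _ _ _ _ _ _ uz] by (simp_all add: Comp_eq_Comp[OF pp_desc_simps(4)[OF _ _ _ _ _ _ _ uz]])
  then show ?thesis
    using that[of "pp_desc C (f \<box> g) h u ?z"] fgh u pp_desc_simps[OF _ _ _ _ _ _ _ uz] by simp
qed

lemma pp_assoc0_simps [simp]:
  assumes "f \<in> Ar C" "g \<in> Ar C" "h \<in> Ar C"
  shows "pp_assoc0 C f g h \<in> Ar C" "Dom C (pp_assoc0 C f g h) = Dom C ((f \<box> g) \<box> h)"
    "Cod C (pp_assoc0 C f g h) = Dom C (f \<box> g \<box> h)"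
    and pp_assoc0_inl_inl: "pp_assoc0 C f g h \<circ> pp_inl C (f \<box> g) h \<circ> (pp_inl C f g \<otimes> \<one> (Cod C h)) =
      pp_inl C f (g \<box> h) \<circ> Assoc C (Dom C f) (Cod C g) (Cod C h)"
    and pp_assoc0_inl_inr: "pp_assoc0 C f g h \<circ> pp_inl C (f \<box> g) h \<circ> (pp_inr C f g \<otimes> \<one> (Cod C h)) =
      pp_inr C f (g \<box> h) \<circ> (\<one> (Cod C f) \<otimes> pp_inl C g h) \<circ> Assoc C (Cod C f) (Dom C g) (Cod C h)"
    and pp_assoc0_inr: "pp_assoc0 C f g h \<circ> pp_inr C (f \<box> g) h =
      pp_inr C f (g \<box> h) \<circ> (\<one> (Cod C f) \<otimes> pp_inr C g h) \<circ> Assoc C (Cod C f) (Cod C g) (Dom C h)"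
proof -
  obtain t where t: "t \<in> Ar C" "Dom C t = Dom C ((f \<box> g) \<box> h)" "Cod C t = Dom C (f \<box> g \<box> h)"
    "t \<circ> pp_inl C (f \<box> g) h \<circ> (pp_inl C f g \<otimes> \<one> (Cod C h)) =
      pp_inl C f (g \<box> h) \<circ> Assoc C (Dom C f) (Cod C g) (Cod C h)"
    "t \<circ> pp_inl C (f \<box> g) h \<circ> (pp_inr C f g \<otimes> \<one> (Cod C h)) =
      pp_inr C f (g \<box> h) \<circ> (\<one> (Cod C f) \<otimes> pp_inl C g h) \<circ> Assoc C (Cod C f) (Dom C g) (Cod C h)"
    "t \<circ> pp_inr C (f \<box> g) h =
      pp_inr C f (g \<box> h) \<circ> (\<one> (Cod C f) \<otimes> pp_inr C g h) \<circ> Assoc C (Cod C f) (Cod C g) (Dom C h)"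
    by (rule pp_assoc0_exists[OF assms])
  have "pp_assoc0 C f g h = t"
    unfolding pp_assoc0_def in_hom
    by (rule the_equality) (use t assms in simp, rule pushout_product_ext3[of f g h], use t assms in simp_all)
  then show "pp_assoc0 C f g h \<in> Ar C" "Dom C (pp_assoc0 C f g h) = Dom C ((f \<box> g) \<box> h)"
    "Cod C (pp_assoc0 C f g h) = Dom C (f \<box> g \<box> h)"
    "pp_assoc0 C f g h \<circ> pp_inl C (f \<box> g) h \<circ> (pp_inl C f g \<otimes> \<one> (Cod C h)) =
      pp_inl C f (g \<box> h) \<circ> Assoc C (Dom C f) (Cod C g) (Cod C h)"
    "pp_assoc0 C f g h \<circ> pp_inl C (f \<box> g) h \<circ> (pp_inr C f g \<otimes> \<one> (Cod C h)) =
      pp_inr C f (g \<box> h) \<circ> (\<one> (Cod C f) \<otimes> pp_inl C g h) \<circ> Assoc C (Cod C f) (Dom C g) (Cod C h)"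
    "pp_assoc0 C f g h \<circ> pp_inr C (f \<box> g) h =
      pp_inr C f (g \<box> h) \<circ> (\<one> (Cod C f) \<otimes> pp_inr C g h) \<circ> Assoc C (Cod C f) (Cod C g) (Dom C h)"
    using t by simp_all
qed

lemma pp_assoc0_square:
  assumes "f \<in> Ar C" "g \<in> Ar C" "h \<in> Ar C"
  shows "Assoc C (Cod C f) (Cod C g) (Cod C h) \<circ> ((f \<box> g) \<box> h) = (f \<box> g \<box> h) \<circ> pp_assoc0 C f g h"
  by (rule pushout_product_ext3[of f g h])
    (use assms in \<open>simp_all add: pp_assoc0_inl_inl pp_assoc0_inl_inr pp_assoc0_inr
      pushout_product_inl pushout_product_inr Comp_eq_Comp[OF pushout_product_inl]
      Comp_eq_Comp[OF pushout_product_inr] Comp_TAr Comp_TAr_Comp structure_nat\<close>)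

text \<open>On each summand this is naturality of the associator of \<open>C\<close>.\<close>

lemma pp_assoc0_natural:
  assumes s: "s \<in> Ar (arrow_category C)" and t: "t \<in> Ar (arrow_category C)"
    and u: "u \<in> Ar (arrow_category C)"
    and src: "sq_src s = f" "sq_src t = g" "sq_src u = h"
    and tgt: "sq_tgt s = f'" "sq_tgt t = g'" "sq_tgt u = h'"
  shows "pp_assoc0 C f' g' h' \<circ> sq0 (pushout_product_map C (pushout_product_map C s t) u) =
    sq0 (pushout_product_map C s (pushout_product_map C t u)) \<circ> pp_assoc0 C f g h"
proof -
  let ?M = "sq0 (pushout_product_map C (pushout_product_map C s t) u)"
  let ?N = "sq0 (pushout_product_map C s (pushout_product_map C t u))"
  note ar = s[unfolded in_Ar_arrow_category src tgt] t[unfolded in_Ar_arrow_category src tgt]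
    u[unfolded in_Ar_arrow_category src tgt]
  note st = pushout_product_map_Ar[OF s t] and tu = pushout_product_map_Ar[OF t u]
  note m = pushout_product_map0[OF s t src(1,2) tgt(1,2)]
    and n = pushout_product_map0[OF t u src(2,3) tgt(2,3)]
  have M: "?M \<in> Ar C" "Dom C ?M = Dom C ((f \<box> g) \<box> h)" "Cod C ?M = Dom C ((f' \<box> g') \<box> h')"
    "?M \<circ> pp_inl C (f \<box> g) h = pp_inl C (f' \<box> g') h' \<circ> (sq0 (pushout_product_map C s t) \<otimes> sq1 u)"
    "?M \<circ> pp_inr C (f \<box> g) h = pp_inr C (f' \<box> g') h' \<circ> ((sq1 s \<otimes> sq1 t) \<otimes> sq0 u)"
    using pushout_product_map0[OF st u refl src(3) refl tgt(3)] src tgt by simp_all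
  have N: "?N \<in> Ar C" "Dom C ?N = Dom C (f \<box> g \<box> h)" "Cod C ?N = Dom C (f' \<box> g' \<box> h')"
    "?N \<circ> pp_inl C f (g \<box> h) = pp_inl C f' (g' \<box> h') \<circ> (sq0 s \<otimes> sq1 t \<otimes> sq1 u)"
    "?N \<circ> pp_inr C f (g \<box> h) = pp_inr C f' (g' \<box> h') \<circ> (sq1 s \<otimes> sq0 (pushout_product_map C t u))"
    using pushout_product_map0[OF s tu src(1) refl tgt(1) refl] src tgt by simp_all
  have wm: "(sq0 (pushout_product_map C s t) \<otimes> sq1 u) \<circ> (pp_inl C f g \<otimes> \<one> (Cod C h)) =
      (pp_inl C f' g' \<otimes> \<one> (Cod C h')) \<circ> ((sq0 s \<otimes> sq1 t) \<otimes> sq1 u)"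
    "(sq0 (pushout_product_map C s t) \<otimes> sq1 u) \<circ> (pp_inr C f g \<otimes> \<one> (Cod C h)) =
      (pp_inr C f' g' \<otimes> \<one> (Cod C h')) \<circ> ((sq1 s \<otimes> sq0 t) \<otimes> sq1 u)"
    and wn: "(sq1 s \<otimes> sq0 (pushout_product_map C t u)) \<circ> (\<one> (Cod C f) \<otimes> pp_inl C g h) =
      (\<one> (Cod C f') \<otimes> pp_inl C g' h') \<circ> (sq1 s \<otimes> sq0 t \<otimes> sq1 u)"
    "(sq1 s \<otimes> sq0 (pushout_product_map C t u)) \<circ> (\<one> (Cod C f) \<otimes> pp_inr C g h) =
      (\<one> (Cod C f') \<otimes> pp_inr C g' h') \<circ> (sq1 s \<otimes> sq1 t \<otimes> sq0 u)"
    using pushout_product_map_whisker(1,2)[OF s t src(1,2) tgt(1,2), of "sq1 u"]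
      pushout_product_map_whisker(3,4)[OF t u src(2,3) tgt(2,3), of "sq1 s"] ar by simp_all
  note simps = Comp_eq_Comp[OF M(4)] M(5) Comp_eq_Comp[OF M(5)] N(4) Comp_eq_Comp[OF N(4)] Comp_eq_Comp[OF N(5)]
    wm wn Comp_eq_Comp[OF wn(1)] Comp_eq_Comp[OF wn(2)]
    pp_assoc0_inl_inl pp_assoc0_inl_inr pp_assoc0_inr Comp3_eq_Comp[OF pp_assoc0_inl_inl]
    Comp3_eq_Comp[OF pp_assoc0_inl_inr] Comp_eq_Comp[OF pp_assoc0_inr] structure_nat
  show ?thesis
  proof (rule pushout_product_ext3[of f g h])
    show "(pp_assoc0 C f' g' h' \<circ> ?M) \<circ> pp_inl C (f \<box> g) h \<circ> (pp_inl C f g \<otimes> \<one> (Cod C h)) =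
        (?N \<circ> pp_assoc0 C f g h) \<circ> pp_inl C (f \<box> g) h \<circ> (pp_inl C f g \<otimes> \<one> (Cod C h))"
      using ar M(1-3) N(1-3) m(1-3) n(1-3) by (simp add: simps)
    show "(pp_assoc0 C f' g' h' \<circ> ?M) \<circ> pp_inl C (f \<box> g) h \<circ> (pp_inr C f g \<otimes> \<one> (Cod C h)) =
        (?N \<circ> pp_assoc0 C f g h) \<circ> pp_inl C (f \<box> g) h \<circ> (pp_inr C f g \<otimes> \<one> (Cod C h))"
      using ar M(1-3) N(1-3) m(1-3) n(1-3) by (simp add: simps)
    show "(pp_assoc0 C f' g' h' \<circ> ?M) \<circ> pp_inr C (f \<box> g) h =
        (?N \<circ> pp_assoc0 C f g h) \<circ> pp_inr C (f \<box> g) h"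
      using ar M(1-3) N(1-3) m(1-3) n(1-3) by (simp add: simps)
  qed (use ar M(1-3) N(1-3) in simp_all)
qed

text \<open>The coherence conditions tensor structure isomorphisms with identities, and
  \<open>pushout_product_map0\<close> applies to these squares once they are known to commute.\<close>

lemma Idt_square_Ar: "f \<in> Ar C \<Longrightarrow> Square f f (\<one> (Dom C f)) (\<one> (Cod C f)) \<in> Ar (arrow_category C)"
  by (simp add: in_Ar_arrow_category)

lemma symm_square_Ar:
  "f \<in> Ar C \<Longrightarrow> g \<in> Ar C \<Longrightarrow>
   Square (f \<box> g) (g \<box> f) (pp_symm0 C f g) (Symm C (Cod C f) (Cod C g)) \<in> Ar (arrow_category C)"
  by (simp add: in_Ar_arrow_category pp_symm0_square)

lemma assoc_square_Ar:
  "f \<in> Ar C \<Longrightarrow> g \<in> Ar C \<Longrightarrow> h \<in> Ar C \<Longrightarrow>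
   Square ((f \<box> g) \<box> h) (f \<box> g \<box> h) (pp_assoc0 C f g h) (Assoc C (Cod C f) (Cod C g) (Cod C h))
     \<in> Ar (arrow_category C)"
  by (simp add: in_Ar_arrow_category pp_assoc0_square)

lemma lunit_square_Ar:
  "f \<in> Ar C \<Longrightarrow> Square (pp_unit C \<box> f) f (pp_lunit0 C f) (LUnit C (Cod C f)) \<in> Ar (arrow_category C)"
  by (simp add: in_Ar_arrow_category pp_lunit0_square)

lemma runit_square_Ar:
  "f \<in> Ar C \<Longrightarrow> Square (f \<box> pp_unit C) f (pp_runit0 C f) (RUnit C (Cod C f)) \<in> Ar (arrow_category C)"
  by (simp add: in_Ar_arrow_category pp_runit0_square)

text \<open>Equations of composites can be used inside whiskered composites in normal form.\<close>

lemma whisker_eq2: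
  assumes "a \<circ> b = c" "a \<in> Ar C" "b \<in> Ar C" "Dom C a = Cod C b" "W \<in> Ob C"
  shows "(a \<otimes> \<one> W) \<circ> (b \<otimes> \<one> W) = c \<otimes> \<one> W" "(\<one> W \<otimes> a) \<circ> (\<one> W \<otimes> b) = \<one> W \<otimes> c"
  using assms by (auto simp: Comp_TAr)

lemma whisker_eq3:
  assumes "a \<circ> b \<circ> d = c" "a \<in> Ar C" "b \<in> Ar C" "d \<in> Ar C" "Dom C a = Cod C b" "Dom C b = Cod C d" "W \<in> Ob C"
  shows "(a \<otimes> \<one> W) \<circ> (b \<otimes> \<one> W) \<circ> (d \<otimes> \<one> W) = c \<otimes> \<one> W"
    "(\<one> W \<otimes> a) \<circ> (\<one> W \<otimes> b) \<circ> (\<one> W \<otimes> d) = \<one> W \<otimes> c"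
  using assms by (auto simp: Comp_TAr)

text \<open>On each of the three summands this is the hexagon of \<open>C\<close>, with one factor replaced by its
  domain.\<close>

lemma pp_hexagon0:
  assumes f: "f \<in> Ar C" and g: "g \<in> Ar C" and h: "h \<in> Ar C"
  shows "pp_assoc0 C g h f \<circ> pp_symm0 C f (g \<box> h) \<circ> pp_assoc0 C f g h =
    sq0 (pushout_product_map C (Square g g (\<one> (Dom C g)) (\<one> (Cod C g)))
      (Square (f \<box> h) (h \<box> f) (pp_symm0 C f h) (Symm C (Cod C f) (Cod C h)))) \<circ>
    pp_assoc0 C g f h \<circ>
    sq0 (pushout_product_map C
      (Square (f \<box> g) (g \<box> f) (pp_symm0 C f g) (Symm C (Cod C f) (Cod C g)))
      (Square h h (\<one> (Dom C h)) (\<one> (Cod C h))))"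
    (is "?L = ?M \<circ> _ \<circ> ?N")
proof -
  note fgh = f g h
  note M = pushout_product_map0[OF Idt_square_Ar[OF g] symm_square_Ar[OF f h] refl refl refl refl, simplified]
  note N = pushout_product_map0[OF symm_square_Ar[OF f g] Idt_square_Ar[OF h] refl refl refl refl, simplified]
  note hex = hexagon[symmetric] Comp3_eq_Comp[OF hexagon[symmetric]]
  note simps = M(4,5) N(4,5) Comp_eq_Comp[OF M(4)] Comp_eq_Comp[OF M(5)] Comp_eq_Comp[OF N(4)] Comp_eq_Comp[OF N(5)]
    pp_assoc0_inl_inl pp_assoc0_inl_inr pp_assoc0_inr Comp3_eq_Comp[OF pp_assoc0_inl_inl]
    Comp3_eq_Comp[OF pp_assoc0_inl_inr] Comp_eq_Comp[OF pp_assoc0_inr]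
    pp_symm0_inl pp_symm0_inr Comp_eq_Comp[OF pp_symm0_inl] Comp_eq_Comp[OF pp_symm0_inr]
    whisker_eq2[OF pp_symm0_inl] whisker_eq2[OF pp_symm0_inr]
    Comp_eq_Comp[OF whisker_eq2(1)[OF pp_symm0_inl]] Comp_eq_Comp[OF whisker_eq2(1)[OF pp_symm0_inr]]
    Comp_eq_Comp[OF whisker_eq2(2)[OF pp_symm0_inl]] Comp_eq_Comp[OF whisker_eq2(2)[OF pp_symm0_inr]]
    structure_nat whisker hex
  show ?thesis
    by (rule pushout_product_ext3[of f g h]) (use fgh M(1-3) N(1-3) in \<open>simp_all add: simps\<close>)
qed

text \<open>The associator carries the summands of its source to those of its target, up to isomorphisms
  of \<open>C\<close>, and the latter are jointly epic as well.\<close>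

lemma pp_assoc0_epi:
  assumes f: "f \<in> Ar C" and g: "g \<in> Ar C" and h: "h \<in> Ar C"
    and uv: "u \<in> Ar C" "v \<in> Ar C" "Dom C u = Dom C (f \<box> g \<box> h)" "Dom C v = Dom C (f \<box> g \<box> h)"
    and eq: "u \<circ> pp_assoc0 C f g h = v \<circ> pp_assoc0 C f g h"
  shows "u = v"
proof -
  note fgh = f g h
  have cod: "Cod C u = Cod C v"
    using arg_cong[OF eq, of "Cod C"] fgh uv by simp
  have eqk: "u \<circ> pp_assoc0 C f g h \<circ> k = v \<circ> pp_assoc0 C f g h \<circ> k"
    if "k \<in> Ar C" "Cod C k = Dom C ((f \<box> g) \<box> h)" for k
    using Comp_eq_Comp[OF eq, of k] fgh uv that by simp
  note simps = pp_assoc0_inl_inl pp_assoc0_inl_inr pp_assoc0_inr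
  have "u \<circ> pp_inl C f (g \<box> h) = v \<circ> pp_inl C f (g \<box> h)"
    by (rule iso_cancel_right[OF Assoc_iso[of "Dom C f" "Cod C g" "Cod C h"]])
      (use fgh uv eqk[of "pp_inl C (f \<box> g) h \<circ> (pp_inl C f g \<otimes> \<one> (Cod C h))"] in \<open>simp_all add: simps\<close>)
  moreover have "u \<circ> pp_inr C f (g \<box> h) = v \<circ> pp_inr C f (g \<box> h)"
  proof (rule pushout_product_ext_left[of g h "Cod C f"])
    show "(u \<circ> pp_inr C f (g \<box> h)) \<circ> (\<one> (Cod C f) \<otimes> pp_inl C g h) =
        (v \<circ> pp_inr C f (g \<box> h)) \<circ> (\<one> (Cod C f) \<otimes> pp_inl C g h)"
      by (rule iso_cancel_right[OF Assoc_iso[of "Cod C f" "Dom C g" "Cod C h"]])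
        (use fgh uv eqk[of "pp_inl C (f \<box> g) h \<circ> (pp_inr C f g \<otimes> \<one> (Cod C h))"] in \<open>simp_all add: simps\<close>)
    show "(u \<circ> pp_inr C f (g \<box> h)) \<circ> (\<one> (Cod C f) \<otimes> pp_inr C g h) =
        (v \<circ> pp_inr C f (g \<box> h)) \<circ> (\<one> (Cod C f) \<otimes> pp_inr C g h)"
      by (rule iso_cancel_right[OF Assoc_iso[of "Cod C f" "Cod C g" "Dom C h"]])
        (use fgh uv eqk[of "pp_inr C (f \<box> g) h"] in \<open>simp_all add: simps\<close>)
  qed (use fgh uv cod in simp_all)
  ultimately show ?thesis
    using fgh uv cod by - (rule pushout_product_ext[of f "g \<box> h"], simp_all)
qed

lemma pushout_product_map0_Comp:
  assumes s: "s \<in> Ar (arrow_category C)" and t: "t \<in> Ar (arrow_category C)"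
    and s': "s' \<in> Ar (arrow_category C)" and t': "t' \<in> Ar (arrow_category C)"
    and eq: "sq_src s' = sq_tgt s" "sq_src t' = sq_tgt t"
  shows "sq0 (pushout_product_map C (s' \<circ>\<^bsub>arrow_category C\<^esub> s) (t' \<circ>\<^bsub>arrow_category C\<^esub> t)) =
    sq0 (pushout_product_map C s' t') \<circ> sq0 (pushout_product_map C s t)"
proof -
  have st: "s' \<circ>\<^bsub>arrow_category C\<^esub> s \<in> Ar (arrow_category C)" "t' \<circ>\<^bsub>arrow_category C\<^esub> t \<in> Ar (arrow_category C)"
    using category.Comp_simps(1)[OF category_arrow_category] assms by simp_all
  note ar = s[unfolded in_Ar_arrow_category] t[unfolded in_Ar_arrow_category]
    s'[unfolded in_Ar_arrow_category] t'[unfolded in_Ar_arrow_category]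
  note m = pushout_product_map0[OF s t refl refl refl refl]
    and m' = pushout_product_map0[OF s' t' eq refl refl]
    and m'' = pushout_product_map0[OF st refl refl refl refl, simplified]
  show ?thesis
    by (rule pushout_product_ext[of "sq_src s" "sq_src t"])
      (use ar eq m(1-3) m'(1-3) m''(1-3) in \<open>simp_all add: m(4,5) m'' Comp_eq_Comp[OF m'(4)] Comp_eq_Comp[OF m'(5)] Comp_TAr\<close>)
qed

lemma pushout_product_map0_Idt:
  assumes "f \<in> Ar C" "g \<in> Ar C"
  shows "sq0 (pushout_product_map C (Square f f (\<one> (Dom C f)) (\<one> (Cod C f)))
    (Square g g (\<one> (Dom C g)) (\<one> (Cod C g)))) = \<one> (Dom C (f \<box> g))"
  using pushout_product_map0[OF Idt_square_Ar Idt_square_Ar refl refl refl refl, OF assms, simplified] assms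
  by - (rule pushout_product_ext[of f g], simp_all)

text \<open>The associator is an epimorphism, so a left inverse suffices. The hexagon provides one, as it
  relates the associators of permuted factors through isomorphisms.\<close>

lemma pp_assoc0_iso:
  assumes f: "f \<in> Ar C" and g: "g \<in> Ar C" and h: "h \<in> Ar C"
  shows "is_iso C (pp_assoc0 C f g h)"
proof -
  define I where "I k = Square k k (\<one> (Dom C k)) (\<one> (Cod C k))" for k
  define S where "S k l = Square (k \<box> l) (l \<box> k) (pp_symm0 C k l) (Symm C (Cod C k) (Cod C l))" for k l
  define P where "P s t = sq0 (pushout_product_map C s t)" for s t
  note fgh = f g h
  have I: "I k \<in> Ar (arrow_category C)" "sq_src (I k) = k" "sq_tgt (I k) = k"
    "I k \<circ>\<^bsub>arrow_category C\<^esub> I k = I k" if "k \<in> Ar C" for k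
    unfolding I_def using Idt_square_Ar[OF that] that by simp_all
  have S: "S k l \<in> Ar (arrow_category C)" "sq_src (S k l) = k \<box> l" "sq_tgt (S k l) = l \<box> k"
    "S l k \<circ>\<^bsub>arrow_category C\<^esub> S k l = I (k \<box> l)" if "k \<in> Ar C" "l \<in> Ar C" for k l
    unfolding S_def I_def using symm_square_Ar[OF that] that by (simp_all add: pp_symm0_symm0 Symm_Symm)
  have P: "P s t \<in> Ar C" "Dom C (P s t) = Dom C (sq_src s \<box> sq_src t)" "Cod C (P s t) = Dom C (sq_tgt s \<box> sq_tgt t)"
    if "s \<in> Ar (arrow_category C)" "t \<in> Ar (arrow_category C)" for s t
    unfolding P_def using pushout_product_map0[OF that refl refl refl refl] by simp_all
  have inv_l: "P (I k) (S m l) \<circ> P (I k) (S l m) = \<one> (Dom C (k \<box> l \<box> m))"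
    and inv_r: "P (S m l) (I k) \<circ> P (S l m) (I k) = \<one> (Dom C ((l \<box> m) \<box> k))"
    if "k \<in> Ar C" "l \<in> Ar C" "m \<in> Ar C" for k l m
    using pushout_product_map0_Comp[of "I k" "S l m" "I k" "S m l"]
      pushout_product_map0_Comp[of "S l m" "I k" "S m l" "I k"] that I[of k] S[of l m] S[of m l]
      pushout_product_map0_Idt[of k "l \<box> m"] pushout_product_map0_Idt[of "l \<box> m" k]
    by (simp_all add: P_def del: arrow_category_simps) (simp_all add: I_def)
  have hexagon: "pp_assoc0 C l m k \<circ> pp_symm0 C k (l \<box> m) \<circ> pp_assoc0 C k l m =
      P (I l) (S k m) \<circ> pp_assoc0 C l k m \<circ> P (S k l) (I m)"
    if "k \<in> Ar C" "l \<in> Ar C" "m \<in> Ar C" for k l m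
    using pp_hexagon0[OF that] by (simp add: P_def I_def S_def)
  note ty = fgh P I S

  \<comment> \<open>One hexagon expresses \<open>pp_assoc0 C f h g\<close> through \<open>pp_assoc0 C h f g\<close> and \<open>pp_assoc0 C f g h\<close>,
    another one expresses \<open>pp_assoc0 C h f g\<close> through \<open>pp_assoc0 C f h g\<close>. Once they are combined,
    cancelling the epimorphism \<open>pp_assoc0 C h f g\<close> leaves a left inverse of \<open>pp_assoc0 C f g h\<close>.\<close>
  define R where "R = P (I h) (S g f) \<circ> pp_assoc0 C h g f \<circ> pp_symm0 C f (h \<box> g) \<circ> P (I f) (S g h)"
  have R: "R \<in> Ar C" "Dom C R = Dom C (f \<box> g \<box> h)" "Cod C R = Dom C (h \<box> f \<box> g)"
    unfolding R_def using ty by simp_all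
  have h2: "P (I f) (S g h) \<circ> pp_assoc0 C f g h \<circ> pp_symm0 C h (f \<box> g) \<circ> pp_assoc0 C h f g =
      pp_assoc0 C f h g \<circ> P (S h f) (I g)"
    unfolding hexagon[OF h f g] using ty Comp_eq_Comp[OF inv_l[OF f h g]] by simp
  have h1: "pp_assoc0 C h g f \<circ> pp_symm0 C f (h \<box> g) \<circ> pp_assoc0 C f h g \<circ> P (S h f) (I g) =
      P (I h) (S f g) \<circ> pp_assoc0 C h f g"
    using Comp3_eq_Comp[OF hexagon[OF f h g], of "P (S h f) (I g)"] ty inv_r[OF g h f] by simp
  have "(R \<circ> pp_assoc0 C f g h \<circ> pp_symm0 C h (f \<box> g)) \<circ> pp_assoc0 C h f g =
      P (I h) (S g f) \<circ> P (I h) (S f g) \<circ> pp_assoc0 C h f g"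
    unfolding R_def using ty by (simp add: h2 h1)
  also have "\<dots> = \<one> (Dom C (h \<box> f \<box> g)) \<circ> pp_assoc0 C h f g"
    using ty Comp_eq_Comp[OF inv_l[OF h f g]] by simp
  finally have split: "R \<circ> pp_assoc0 C f g h \<circ> pp_symm0 C h (f \<box> g) = \<one> (Dom C (h \<box> f \<box> g))"
    using ty R by - (rule pp_assoc0_epi[OF h f g], simp_all)
  let ?L = "pp_symm0 C h (f \<box> g) \<circ> R"
  have "R \<circ> pp_assoc0 C f g h = pp_symm0 C (f \<box> g) h"
    using Comp3_eq_Comp[OF split, of "pp_symm0 C (f \<box> g) h"] ty R by (simp add: pp_symm0_symm0)
  then have left: "?L \<circ> pp_assoc0 C f g h = \<one> (Dom C ((f \<box> g) \<box> h))"
    using ty R by (simp add: pp_symm0_symm0)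
  have "(pp_assoc0 C f g h \<circ> ?L) \<circ> pp_assoc0 C f g h = \<one> (Dom C (f \<box> g \<box> h)) \<circ> pp_assoc0 C f g h"
    using left ty R by simp
  then have "pp_assoc0 C f g h \<circ> ?L = \<one> (Dom C (f \<box> g \<box> h))"
    using ty R by - (rule pp_assoc0_epi[OF f g h], simp_all)
  with left show ?thesis
    using ty R by - (rule isoI[of _ ?L], simp_all)
qed

text \<open>Of the three summands, \<open>(X1 \<otimes> 0) \<otimes> Y1\<close> is initial, and on the two others this is the triangle of
  \<open>C\<close>.\<close>

lemma pp_triangle0:
  assumes f: "f \<in> Ar C" and g: "g \<in> Ar C"
  shows "sq0 (pushout_product_map C (Square f f (\<one> (Dom C f)) (\<one> (Cod C f)))
      (Square (pp_unit C \<box> g) g (pp_lunit0 C g) (LUnit C (Cod C g)))) \<circ> pp_assoc0 C f (pp_unit C) g =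
    sq0 (pushout_product_map C (Square (f \<box> pp_unit C) f (pp_runit0 C f) (RUnit C (Cod C f)))
      (Square g g (\<one> (Dom C g)) (\<one> (Cod C g))))"
proof -
  note fg = f g
  note M = pushout_product_map0[OF Idt_square_Ar[OF f] lunit_square_Ar[OF g] refl refl refl refl, simplified]
  note N = pushout_product_map0[OF runit_square_Ar[OF f] Idt_square_Ar[OF g] refl refl refl refl, simplified]
  note simps = Comp_eq_Comp[OF M(4)] Comp_eq_Comp[OF M(5)] N(4,5) Comp_eq_Comp[OF N(4)]
    pp_assoc0_inl_inl pp_assoc0_inr whisker_eq2[OF pp_runit0_inl]
    Comp_eq_Comp[OF whisker_eq2(2)[OF pp_lunit0_inr]] triangle
  show ?thesis
  proof (rule pushout_product_ext3[of f "pp_unit C" g], goal_cases)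
    \<comment> \<open>the summand \<open>(X1 \<otimes> 0) \<otimes> Y1\<close>\<close>
    case 10
    show ?case
      by (rule is_initialD(2)[OF is_initial_tensor_right[OF is_initial_tensor_left[OF zero_initial, of "Cod C f"], of "Cod C g"]])
        (use fg M(1-3) N(1-3) in simp_all)
  qed (use fg M(1-3) N(1-3) in \<open>simp_all add: simps\<close>)
qed

text \<open>The four summands are the tensor products with exactly one factor replaced by its domain.\<close>

lemma pushout_product_ext4:
  assumes e: "e \<in> Ar C" and f: "f \<in> Ar C" and g: "g \<in> Ar C" and h: "h \<in> Ar C"
    and uv: "u \<in> Ar C" "v \<in> Ar C" "Dom C u = Dom C (((e \<box> f) \<box> g) \<box> h)"
      "Dom C v = Dom C (((e \<box> f) \<box> g) \<box> h)" "Cod C u = Cod C v"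
    and "u \<circ> pp_inl C ((e \<box> f) \<box> g) h \<circ> (pp_inl C (e \<box> f) g \<otimes> \<one> (Cod C h)) \<circ> ((pp_inl C e f \<otimes> \<one> (Cod C g)) \<otimes> \<one> (Cod C h)) =
         v \<circ> pp_inl C ((e \<box> f) \<box> g) h \<circ> (pp_inl C (e \<box> f) g \<otimes> \<one> (Cod C h)) \<circ> ((pp_inl C e f \<otimes> \<one> (Cod C g)) \<otimes> \<one> (Cod C h))"
      "u \<circ> pp_inl C ((e \<box> f) \<box> g) h \<circ> (pp_inl C (e \<box> f) g \<otimes> \<one> (Cod C h)) \<circ> ((pp_inr C e f \<otimes> \<one> (Cod C g)) \<otimes> \<one> (Cod C h)) =
       v \<circ> pp_inl C ((e \<box> f) \<box> g) h \<circ> (pp_inl C (e \<box> f) g \<otimes> \<one> (Cod C h)) \<circ> ((pp_inr C e f \<otimes> \<one> (Cod C g)) \<otimes> \<one> (Cod C h))"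
      "u \<circ> pp_inl C ((e \<box> f) \<box> g) h \<circ> (pp_inr C (e \<box> f) g \<otimes> \<one> (Cod C h)) =
       v \<circ> pp_inl C ((e \<box> f) \<box> g) h \<circ> (pp_inr C (e \<box> f) g \<otimes> \<one> (Cod C h))"
      "u \<circ> pp_inr C ((e \<box> f) \<box> g) h = v \<circ> pp_inr C ((e \<box> f) \<box> g) h"
  shows "u = v"
proof (rule pushout_product_ext3[of "e \<box> f" g h])
  show "u \<circ> pp_inl C ((e \<box> f) \<box> g) h \<circ> (pp_inl C (e \<box> f) g \<otimes> \<one> (Cod C h)) =
    v \<circ> pp_inl C ((e \<box> f) \<box> g) h \<circ> (pp_inl C (e \<box> f) g \<otimes> \<one> (Cod C h))"
    by (rule pushout_product_ext_right_right[of e f "Cod C g" "Cod C h"]) (use assms in simp_all)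
qed (use assms in simp_all)

text \<open>On each of the four summands this is the pentagon of \<open>C\<close>.\<close>

lemma pp_pentagon0:
  assumes e: "e \<in> Ar C" and f: "f \<in> Ar C" and g: "g \<in> Ar C" and h: "h \<in> Ar C"
  shows "sq0 (pushout_product_map C (Square e e (\<one> (Dom C e)) (\<one> (Cod C e)))
      (Square ((f \<box> g) \<box> h) (f \<box> g \<box> h) (pp_assoc0 C f g h) (Assoc C (Cod C f) (Cod C g) (Cod C h)))) \<circ>
    pp_assoc0 C e (f \<box> g) h \<circ>
    sq0 (pushout_product_map C
      (Square ((e \<box> f) \<box> g) (e \<box> f \<box> g) (pp_assoc0 C e f g) (Assoc C (Cod C e) (Cod C f) (Cod C g)))
      (Square h h (\<one> (Dom C h)) (\<one> (Cod C h)))) =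
    pp_assoc0 C e f (g \<box> h) \<circ> pp_assoc0 C (e \<box> f) g h"
proof -
  note efgh = e f g h
  note M = pushout_product_map0[OF Idt_square_Ar[OF e] assoc_square_Ar[OF f g h] refl refl refl refl, simplified]
  note N = pushout_product_map0[OF assoc_square_Ar[OF e f g] Idt_square_Ar[OF h] refl refl refl refl, simplified]
  note a = pp_assoc0_inl_inl pp_assoc0_inl_inr pp_assoc0_inr
  note b = a(1,2)[OF e f pushout_product_simps(1)[OF g h], unfolded pushout_product_simps(2)[OF g h]]
  note a' = Comp3_eq_Comp[OF a(1)] Comp3_eq_Comp[OF a(2)] Comp_eq_Comp[OF a(3)]
  note wa = whisker_eq3[OF a(1)] whisker_eq3[OF a(2)] whisker_eq2[OF a(3)]
  note wa' = Comp3_eq_Comp[OF whisker_eq3(1)[OF a(1)]] Comp3_eq_Comp[OF whisker_eq3(1)[OF a(2)]]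
    Comp3_eq_Comp[OF whisker_eq3(2)[OF a(1)]] Comp3_eq_Comp[OF whisker_eq3(2)[OF a(2)]]
    Comp_eq_Comp[OF whisker_eq2(1)[OF a(3)]] Comp_eq_Comp[OF whisker_eq2(2)[OF a(3)]]
  note simps = Comp_eq_Comp[OF M(4)] Comp_eq_Comp[OF M(5)] N(5) Comp_eq_Comp[OF N(4)] Comp_eq_Comp[OF N(5)]
    Comp3_eq_Comp[OF b(1)] Comp3_eq_Comp[OF b(2)] a a' wa wa' structure_nat whisker pentagon Comp3_eq_Comp[OF pentagon]
  show ?thesis
    by (rule pushout_product_ext4[of e f g h]) (use efgh M(1-3) N(1-3) in \<open>simp_all add: simps\<close>)
qed

lemma square_parts [simp]:
  assumes "s \<in> Ar (arrow_category C)"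
  shows "sq_src s \<in> Ar C" "sq_tgt s \<in> Ar C"
    "sq0 s \<in> Ar C" "Dom C (sq0 s) = Dom C (sq_src s)" "Cod C (sq0 s) = Dom C (sq_tgt s)"
    "sq1 s \<in> Ar C" "Dom C (sq1 s) = Cod C (sq_src s)" "Cod C (sq1 s) = Cod C (sq_tgt s)"
    and square_commutes: "sq1 s \<circ> sq_src s = sq_tgt s \<circ> sq0 s"
  using assms by (simp_all add: in_Ar_arrow_category)

lemma symmetric_monoidal_arrow_pushout_product:
  "symmetric_monoidal_category (arrow_pushout_product C)"
  unfolding symmetric_monoidal_category_def
proof (rule conjI[OF category_arrow_pushout_product])
  note natural = pp_assoc0_natural[OF _ _ _ refl refl refl refl refl refl] pp_symm0_natural
    pp_lunit0_natural pp_runit0_natural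
  note squares = Idt_square_Ar assoc_square_Ar lunit_square_Ar runit_square_Ar symm_square_Ar
  show "symmetric_monoidal_category_axioms (arrow_pushout_product C)"
    by unfold_locales
      (auto simp: arrow_pushout_product_structure in_hom square.expand squares pushout_product_map_Ar
        pushout_product_map0_Idt pushout_product_map0_Comp[simplified] natural
        pp_hexagon0 pp_pentagon0 pp_triangle0 pp_symm0_symm0
        Comp_TAr structure_nat Symm_Symm pentagon triangle hexagon
        intro!: is_iso_Square Assoc_iso LUnit_iso RUnit_iso pp_assoc0_iso pp_lunit0_iso pp_runit0_iso)
qed


section \<open>The cokernel functor is monoidal\<close>

text \<open>An arrow vanishes on \<open>f \<box> g\<close> if and only if it vanishes on \<open>f \<otimes> \<one> (Cod C g)\<close> and on
  \<open>\<one> (Cod C f) \<otimes> g\<close>. It then factors through \<open>p \<otimes> \<one> (Cod C g)\<close>; the factor vanishes on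
  \<open>\<one> (Cod C p) \<otimes> g\<close> because \<open>p \<otimes> \<one> (Dom C g)\<close> is an epimorphism, and so factors through
  \<open>\<one> (Cod C p) \<otimes> q\<close>.\<close>

lemma is_cokernel_pushout_product:
  assumes p: "is_cokernel f p" and q: "is_cokernel g q"
  shows "is_cokernel (f \<box> g) (p \<otimes> q)"
proof (rule is_cokernelI)
  note d = is_cokernelD[OF p] is_cokernelD[OF q]
  have d': "(p \<otimes> \<one> W) \<circ> (f \<otimes> \<one> W) = zero_arrow (Dom C f \<otimes>\<^sub>o W) (Cod C p \<otimes>\<^sub>o W)"
    "(\<one> W \<otimes> q) \<circ> (\<one> W \<otimes> g) = zero_arrow (W \<otimes>\<^sub>o Dom C g) (W \<otimes>\<^sub>o Cod C q)" if "W \<in> Ob C" for W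
    using is_cokernelD(4)[OF is_cokernel_tensor_right[OF p that]]
      is_cokernelD(4)[OF is_cokernel_tensor_left[OF q that]] d that by simp_all
  have pq: "p \<otimes> q = (\<one> (Cod C p) \<otimes> q) \<circ> (p \<otimes> \<one> (Cod C g))" "p \<otimes> q = (p \<otimes> \<one> (Cod C q)) \<circ> (\<one> (Cod C f) \<otimes> q)"
    using d by (simp_all add: Comp_TAr)
  note ep = is_cokernel_tensor_right[OF p] and eq = is_cokernel_tensor_left[OF q]
  show "f \<box> g \<in> Ar C" "p \<otimes> q \<in> Ar C" "Dom C (p \<otimes> q) = Cod C (f \<box> g)"
    using d by simp_all
  show "(p \<otimes> q) \<circ> (f \<box> g) = zero_arrow (Dom C (f \<box> g)) (Cod C (p \<otimes> q))"
  proof (rule pushout_product_ext[of f g])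
    show "((p \<otimes> q) \<circ> (f \<box> g)) \<circ> pp_inl C f g = zero_arrow (Dom C (f \<box> g)) (Cod C (p \<otimes> q)) \<circ> pp_inl C f g"
      using d by (simp add: pushout_product_inl) (simp add: pq(1) d')
    show "((p \<otimes> q) \<circ> (f \<box> g)) \<circ> pp_inr C f g = zero_arrow (Dom C (f \<box> g)) (Cod C (p \<otimes> q)) \<circ> pp_inr C f g"
      using d by (simp add: pushout_product_inr) (simp add: pq(2) d')
  qed (use d in simp_all)
  fix u v
  assume uv: "u \<in> Ar C" "v \<in> Ar C" "Dom C u = Cod C (p \<otimes> q)" "Dom C v = Cod C (p \<otimes> q)"
    "u \<circ> (p \<otimes> q) = v \<circ> (p \<otimes> q)" "Cod C u = Cod C v"
  have "u \<circ> (\<one> (Cod C p) \<otimes> q) = v \<circ> (\<one> (Cod C p) \<otimes> q)"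
    by (rule cokernel_ext[OF ep[of "Cod C g"]]) (use uv d in \<open>simp_all add: pq(1)\<close>)
  then show "u = v"
    using uv d by - (rule cokernel_ext[OF eq[of "Cod C p"]], simp_all)
next
  note d = is_cokernelD[OF p] is_cokernelD[OF q]
  note ep = is_cokernel_tensor_right[OF p] and eq = is_cokernel_tensor_left[OF q]
  fix x
  assume x: "x \<in> Ar C" "Dom C x = Cod C (f \<box> g)" "x \<circ> (f \<box> g) = zero_arrow (Dom C (f \<box> g)) (Cod C x)"
  have xf: "x \<circ> (f \<otimes> \<one> (Cod C g)) = zero_arrow (Dom C f \<otimes>\<^sub>o Cod C g) (Cod C x)"
    using Comp_eq_Comp[OF x(3), of "pp_inl C f g"] x(1,2) d by (simp add: pushout_product_inl)
  have xg: "x \<circ> (\<one> (Cod C f) \<otimes> g) = zero_arrow (Cod C f \<otimes>\<^sub>o Dom C g) (Cod C x)"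
    using Comp_eq_Comp[OF x(3), of "pp_inr C f g"] x(1,2) d by (simp add: pushout_product_inr)
  obtain y where y: "y \<in> Ar C" "Dom C y = Cod C p \<otimes>\<^sub>o Cod C g" "Cod C y = Cod C x"
    "y \<circ> (p \<otimes> \<one> (Cod C g)) = x"
    using cokernel_desc[OF ep[of "Cod C g"], of x] x(1,2) xf d by auto
  have "y \<circ> (\<one> (Cod C p) \<otimes> g) = zero_arrow (Cod C p \<otimes>\<^sub>o Dom C g) (Cod C y)"
  proof (rule cokernel_ext[OF ep[of "Dom C g"]])
    have "(y \<circ> (\<one> (Cod C p) \<otimes> g)) \<circ> (p \<otimes> \<one> (Dom C g)) = y \<circ> (p \<otimes> \<one> (Cod C g)) \<circ> (\<one> (Cod C f) \<otimes> g)"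
      using y(1-3) d by (simp add: Comp_TAr)
    also have "\<dots> = x \<circ> (\<one> (Cod C f) \<otimes> g)"
      using Comp_eq_Comp[OF y(4), of "\<one> (Cod C f) \<otimes> g"] y(1-3) d by simp
    finally show "(y \<circ> (\<one> (Cod C p) \<otimes> g)) \<circ> (p \<otimes> \<one> (Dom C g)) =
        zero_arrow (Cod C p \<otimes>\<^sub>o Dom C g) (Cod C y) \<circ> (p \<otimes> \<one> (Dom C g))"
      using xg x(1) y(1-3) d by simp
  qed (use x(1) y(1-3) d in simp_all)
  then obtain z where z: "z \<in> Ar C" "Dom C z = Cod C p \<otimes>\<^sub>o Cod C q" "Cod C z = Cod C x"
    "z \<circ> (\<one> (Cod C p) \<otimes> q) = y"
    using cokernel_desc[OF eq[of "Cod C p"], of y] y(1-3) d by auto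
  have "z \<circ> (p \<otimes> q) = x"
    using Comp_eq_Comp[OF z(4), of "p \<otimes> \<one> (Cod C g)"] z(1-3) y d by (simp add: Comp_TAr)
  then show "\<exists>h. h \<in> Ar C \<and> Dom C h = Cod C (p \<otimes> q) \<and> Cod C h = Cod C x \<and> h \<circ> (p \<otimes> q) = x"
    using z d by auto
qed

text \<open>A square out of an epimorphism is determined by its component on domains. Together with
  \<open>is_cokernel_pushout_product\<close> this reduces equations between squares out of tensor products of cokernels to
  equations between such components.\<close>

lemma cokernel_square_ext:
  assumes "is_cokernel f p" "s \<in> Ar (arrow_category C)" "t \<in> Ar (arrow_category C)"
    and "sq_src s = p" "sq_src t = p" "sq_tgt s = sq_tgt t" "sq0 s = sq0 t"
  shows "s = t"
proof -
  have "sq1 s = sq1 t"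
    by (rule cokernel_ext[OF assms(1)]) (use assms square_commutes[of s] square_commutes[of t] in auto)
  then show ?thesis
    using assms by (simp add: square.expand)
qed

lemma coker_functor_simps [simp]:
  "ObMap (coker_functor C) f = coker C f"
  "sq_src (ArMap (coker_functor C) s) = coker C (sq_src s)"
  "sq_tgt (ArMap (coker_functor C) s) = coker C (sq_tgt s)"
  "sq0 (ArMap (coker_functor C) s) = sq1 s"
  by (simp_all add: coker_functor_def)

lemma coker_functor_Ar:
  assumes s: "s \<in> Ar (arrow_category C)"
  shows "ArMap (coker_functor C) s \<in> Ar (arrow_category C)"
proof -
  let ?f = "sq_src s" and ?g = "sq_tgt s"
  note po = is_pushoutD[OF is_pushout_po_in[of ?g "to_zero C (Dom C ?g)"]]
  have "(coker C ?g \<circ> sq1 s) \<circ> ?f = coker C ?g \<circ> ?g \<circ> sq0 s"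
    using s square_commutes[OF s] by simp
  also have "\<dots> = zero_arrow (Dom C ?f) (Cod C (coker C ?g))"
    using Comp_eq_Comp[OF is_cokernelD(4)[OF is_cokernel_coker[of ?g]], of "sq0 s"] s by simp
  also have "\<dots> = po_inr C ?g (to_zero C (Dom C ?g)) \<circ> to_zero C (Dom C ?f)"
    using from_initial_to_zero[OF zero_initial, of "to_zero C (Dom C ?f)" "po_inr C ?g (to_zero C (Dom C ?g))"]
      po s by (simp add: coker_def)
  finally have "(coker C ?g \<circ> sq1 s) \<circ> ?f = po_inr C ?g (to_zero C (Dom C ?g)) \<circ> to_zero C (Dom C ?f)" .
  from po_desc_simps[OF _ _ _ _ _ _ _ _ this] show ?thesis
    using po s coker_simps[of ?f, unfolded coker_def]
    unfolding in_Ar_arrow_category coker_functor_def by (simp add: coker_def)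
qed

lemma arrow_Comp_Ar:
  "s \<in> Ar (arrow_category C) \<Longrightarrow> t \<in> Ar (arrow_category C) \<Longrightarrow> sq_src t = sq_tgt s \<Longrightarrow>
   t \<circ>\<^bsub>arrow_category C\<^esub> s \<in> Ar (arrow_category C)"
  using category.Comp_simps(1)[OF category_arrow_category] by simp

lemma cat_functor_coker: "cat_functor (arrow_category C) (arrow_category C) (coker_functor C)"
  unfolding cat_functor_def cat_functor_axioms_def
proof (intro conjI allI impI category_arrow_category)
  fix f assume f: "f \<in> Ob (arrow_category C)"
  show "ArMap (coker_functor C) (Idt (arrow_category C) f) =
      Idt (arrow_category C) (ObMap (coker_functor C) f)"
    by (rule cokernel_square_ext[OF is_cokernel_coker[of f]])
      (use f Idt_square_Ar[of "coker C f"] in \<open>simp_all add: coker_functor_Ar Idt_square_Ar\<close>)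
next
  fix s X Y t Z
  assume st: "s \<in> hom (arrow_category C) X Y" "t \<in> hom (arrow_category C) Y Z"
  show "ArMap (coker_functor C) (t \<circ>\<^bsub>arrow_category C\<^esub> s) =
      ArMap (coker_functor C) t \<circ>\<^bsub>arrow_category C\<^esub> ArMap (coker_functor C) s"
  proof (rule cokernel_square_ext[OF is_cokernel_coker[of X]])
    show "ArMap (coker_functor C) (t \<circ>\<^bsub>arrow_category C\<^esub> s) \<in> Ar (arrow_category C)"
      "ArMap (coker_functor C) t \<circ>\<^bsub>arrow_category C\<^esub> ArMap (coker_functor C) s \<in> Ar (arrow_category C)"
      by (intro coker_functor_Ar arrow_Comp_Ar; use st in \<open>simp add: in_hom\<close>)+
  qed (use st in \<open>auto simp: in_hom\<close>)
qed (auto simp: in_hom coker_functor_Ar)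

lemma cat_functor_coker_monoidal:
  "cat_functor (arrow_pushout_product C) (arrow_tensor C) (coker_functor C)"
  using cat_functor_coker category_arrow_pushout_product category_arrow_tensor
  unfolding cat_functor_def cat_functor_axioms_def by simp

text \<open>The isomorphism between two cokernels of \<open>f \<box> g\<close>; it is unique since cokernels are
  epimorphisms.\<close>

definition coker_mult1 :: "'m \<Rightarrow> 'm \<Rightarrow> 'm" where
  "coker_mult1 f g = (SOME m. is_iso C m \<and> Dom C m = Cod C (coker C f \<otimes> coker C g) \<and>
     Cod C m = Cod C (coker C (f \<box> g)) \<and> m \<circ> (coker C f \<otimes> coker C g) = coker C (f \<box> g))"

definition coker_mult :: "'m \<Rightarrow> 'm \<Rightarrow> 'm square" where
  "coker_mult f g = Square (coker C f \<otimes> coker C g) (coker C (f \<box> g))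
     (\<one> (Cod C f \<otimes>\<^sub>o Cod C g)) (coker_mult1 f g)"

definition coker_unit :: "'m square" where
  "coker_unit = Square (\<one> (TUnit C)) (coker C (pp_unit C)) (\<one> (TUnit C)) (coker C (pp_unit C))"

lemma coker_mult1:
  assumes "f \<in> Ar C" "g \<in> Ar C"
  shows "is_iso C (coker_mult1 f g)"
    "Dom C (coker_mult1 f g) = Cod C (coker C f \<otimes> coker C g)"
    "Cod C (coker_mult1 f g) = Cod C (coker C (f \<box> g))"
    "coker_mult1 f g \<circ> (coker C f \<otimes> coker C g) = coker C (f \<box> g)"
proof -
  have "\<exists>m. is_iso C m \<and> Dom C m = Cod C (coker C f \<otimes> coker C g) \<and>
     Cod C m = Cod C (coker C (f \<box> g)) \<and> m \<circ> (coker C f \<otimes> coker C g) = coker C (f \<box> g)"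
    using cokernels_iso[OF is_cokernel_pushout_product[OF is_cokernel_coker is_cokernel_coker] is_cokernel_coker, of f g]
      assms by (metis pushout_product_simps(1))
  from someI_ex[OF this] show "is_iso C (coker_mult1 f g)"
    "Dom C (coker_mult1 f g) = Cod C (coker C f \<otimes> coker C g)"
    "Cod C (coker_mult1 f g) = Cod C (coker C (f \<box> g))"
    "coker_mult1 f g \<circ> (coker C f \<otimes> coker C g) = coker C (f \<box> g)"
    by (simp_all add: coker_mult1_def)
qed

lemma iso_Ar: "is_iso C f \<Longrightarrow> f \<in> Ar C"
  by (simp add: is_iso_def)

lemma coker_mult_Ar: "f \<in> Ar C \<Longrightarrow> g \<in> Ar C \<Longrightarrow> coker_mult f g \<in> Ar (arrow_category C)"
  using coker_mult1[of f g] iso_Ar[of "coker_mult1 f g"]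
  by (simp add: coker_mult_def in_Ar_arrow_category)

lemma coker_mult_iso: "f \<in> Ar C \<Longrightarrow> g \<in> Ar C \<Longrightarrow> is_iso (arrow_category C) (coker_mult f g)"
  using coker_mult_Ar[of f g] coker_mult1(1)[of f g] unfolding coker_mult_def
  by (intro is_iso_Square) (simp_all add: iso_Idt)

lemma coker_mult_simps [simp]:
  "sq_src (coker_mult f g) = coker C f \<otimes> coker C g" "sq_tgt (coker_mult f g) = coker C (f \<box> g)"
  "sq0 (coker_mult f g) = \<one> (Cod C f \<otimes>\<^sub>o Cod C g)"
  by (simp_all add: coker_mult_def)

lemma coker_unit_simps [simp]:
  "sq_src coker_unit = \<one> (TUnit C)" "sq_tgt coker_unit = coker C (pp_unit C)"
  "sq0 coker_unit = \<one> (TUnit C)"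
  by (simp_all add: coker_unit_def)

lemma coker_unit_Ar: "coker_unit \<in> Ar (arrow_category C)"
  by (simp add: coker_unit_def in_Ar_arrow_category)

text \<open>The unit \<open>0 \<rightarrow> S\<close> has the identity as a cokernel, which makes the unit comparison
  invertible.\<close>

lemma is_cokernel_unit: "is_cokernel (pp_unit C) (\<one> (TUnit C))"
proof (rule is_cokernelI)
  show "\<one> (TUnit C) \<circ> pp_unit C = zero_arrow (Dom C (pp_unit C)) (Cod C (\<one> (TUnit C)))"
    by (rule from_zero_ext) simp_all
qed auto

lemma coker_unit_iso: "is_iso (arrow_category C) coker_unit"
proof -
  obtain m where "is_iso C m" "Dom C m = TUnit C" "m \<circ> \<one> (TUnit C) = coker C (pp_unit C)"
    using cokernels_iso[OF is_cokernel_unit is_cokernel_coker] by auto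
  then have "is_iso C (coker C (pp_unit C))"
    by (simp add: iso_Ar)
  then show ?thesis
    using coker_unit_Ar unfolding coker_unit_def by (intro is_iso_Square) (simp_all add: iso_Idt)
qed

lemma arrow_tensor_Ar:
  "s \<in> Ar (arrow_category C) \<Longrightarrow> t \<in> Ar (arrow_category C) \<Longrightarrow>
   s \<otimes>\<^bsub>arrow_tensor C\<^esub> t \<in> Ar (arrow_category C)"
  using symmetric_monoidal_category.TAr_simps(1)[OF symmetric_monoidal_arrow_tensor, of s t] by simp

lemma arrow_Idt_Ar: "f \<in> Ar C \<Longrightarrow> \<one>\<^bsub>arrow_category C\<^esub> f \<in> Ar (arrow_category C)"
  by (simp add: Idt_square_Ar)

lemma arrow_tensor_structure_Ar:
  "f \<in> Ar C \<Longrightarrow> g \<in> Ar C \<Longrightarrow> h \<in> Ar C \<Longrightarrow> Assoc (arrow_tensor C) f g h \<in> Ar (arrow_category C)"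
  "f \<in> Ar C \<Longrightarrow> LUnit (arrow_tensor C) f \<in> Ar (arrow_category C)"
  "f \<in> Ar C \<Longrightarrow> RUnit (arrow_tensor C) f \<in> Ar (arrow_category C)"
  "f \<in> Ar C \<Longrightarrow> g \<in> Ar C \<Longrightarrow> Symm (arrow_tensor C) f g \<in> Ar (arrow_category C)"
  using symmetric_monoidal_category.Assoc_hom[OF symmetric_monoidal_arrow_tensor, of f g h]
    symmetric_monoidal_category.LUnit_hom[OF symmetric_monoidal_arrow_tensor, of f]
    symmetric_monoidal_category.RUnit_hom[OF symmetric_monoidal_arrow_tensor, of f]
    symmetric_monoidal_category.Symm_hom[OF symmetric_monoidal_arrow_tensor, of f g]
  by (simp_all add: in_hom)

lemma arrow_pushout_product_structure_Ar:
  "f \<in> Ar C \<Longrightarrow> g \<in> Ar C \<Longrightarrow> h \<in> Ar C \<Longrightarrow> Assoc (arrow_pushout_product C) f g h \<in> Ar (arrow_category C)"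
  "f \<in> Ar C \<Longrightarrow> LUnit (arrow_pushout_product C) f \<in> Ar (arrow_category C)"
  "f \<in> Ar C \<Longrightarrow> RUnit (arrow_pushout_product C) f \<in> Ar (arrow_category C)"
  "f \<in> Ar C \<Longrightarrow> g \<in> Ar C \<Longrightarrow> Symm (arrow_pushout_product C) f g \<in> Ar (arrow_category C)"
  by (simp_all add: arrow_pushout_product_structure assoc_square_Ar lunit_square_Ar runit_square_Ar symm_square_Ar)

text \<open>The sources of the squares to be compared are tensor products of cokernels, hence cokernels of
  iterated pushout products. Their components on domains are structure isomorphisms of \<open>C\<close> up to
  identities, on either side the same ones.\<close>

lemma strong_symmetric_monoidal_coker:
  "strong_symmetric_monoidal_structure (arrow_pushout_product C) (arrow_tensor C) (coker_functor C)
     coker_mult coker_unit"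
proof (rule strong_symmetric_monoidal_structure.intro[OF symmetric_monoidal_arrow_pushout_product
      symmetric_monoidal_arrow_tensor cat_functor_coker_monoidal])
  note Ars = arrow_Comp_Ar arrow_tensor_Ar coker_functor_Ar coker_mult_Ar coker_unit_Ar arrow_Idt_Ar
    arrow_tensor_structure_Ar arrow_pushout_product_structure_Ar pushout_product_map_Ar coker_simps(1)
  note str = arrow_tensor_structure arrow_pushout_product_structure
  note ck = is_cokernel_pushout_product is_cokernel_coker is_cokernel_unit pushout_product_simps(1)
  show "strong_symmetric_monoidal_structure_axioms (arrow_pushout_product C) (arrow_tensor C)
     (coker_functor C) coker_mult coker_unit"
  proof
    fix f X X' g Y Y'
    assume "f \<in> hom (arrow_pushout_product C) X X'" "g \<in> hom (arrow_pushout_product C) Y Y'"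
    then have f: "f \<in> Ar (arrow_category C)" "sq_src f = X" "sq_tgt f = X'"
      and g: "g \<in> Ar (arrow_category C)" "sq_src g = Y" "sq_tgt g = Y'"
      by (simp_all add: in_hom)
    then have ob: "X \<in> Ar C" "X' \<in> Ar C" "Y \<in> Ar C" "Y' \<in> Ar C"
      by auto
    show "coker_mult X' Y' \<circ>\<^bsub>arrow_tensor C\<^esub>
        (ArMap (coker_functor C) f \<otimes>\<^bsub>arrow_tensor C\<^esub> ArMap (coker_functor C) g) =
      ArMap (coker_functor C) (f \<otimes>\<^bsub>arrow_pushout_product C\<^esub> g) \<circ>\<^bsub>arrow_tensor C\<^esub> coker_mult X Y"
      unfolding arrow_tensor_simps
      by (rule cokernel_square_ext[of "X \<box> Y" "coker C X \<otimes> coker C Y"];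
        (intro ck Ars ob f g)?; simp add: str pushout_product_map_Ar f g ob)
  next
    fix X Y Z
    assume "X \<in> Ob (arrow_pushout_product C)" "Y \<in> Ob (arrow_pushout_product C)" "Z \<in> Ob (arrow_pushout_product C)"
    then have ob: "X \<in> Ar C" "Y \<in> Ar C" "Z \<in> Ar C"
      by simp_all
    show "ArMap (coker_functor C) (Assoc (arrow_pushout_product C) X Y Z) \<circ>\<^bsub>arrow_tensor C\<^esub>
        coker_mult (X \<otimes>\<^sub>o\<^bsub>arrow_pushout_product C\<^esub> Y) Z \<circ>\<^bsub>arrow_tensor C\<^esub>
        (coker_mult X Y \<otimes>\<^bsub>arrow_tensor C\<^esub> \<one>\<^bsub>arrow_tensor C\<^esub> (ObMap (coker_functor C) Z)) =
      coker_mult X (Y \<otimes>\<^sub>o\<^bsub>arrow_pushout_product C\<^esub> Z) \<circ>\<^bsub>arrow_tensor C\<^esub>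
        (\<one>\<^bsub>arrow_tensor C\<^esub> (ObMap (coker_functor C) X) \<otimes>\<^bsub>arrow_tensor C\<^esub> coker_mult Y Z) \<circ>\<^bsub>arrow_tensor C\<^esub>
        Assoc (arrow_tensor C) (ObMap (coker_functor C) X) (ObMap (coker_functor C) Y) (ObMap (coker_functor C) Z)"
      unfolding arrow_tensor_simps coker_functor_simps arrow_pushout_product_structure(1)
      by (rule cokernel_square_ext[of "(X \<box> Y) \<box> Z" "(coker C X \<otimes> coker C Y) \<otimes> coker C Z"];
        (intro ck Ars ob)?; simp add: str ob)
  next
    fix X assume "X \<in> Ob (arrow_pushout_product C)"
    then have ob: "X \<in> Ar C"
      by simp_all
    show "ArMap (coker_functor C) (LUnit (arrow_pushout_product C) X) \<circ>\<^bsub>arrow_tensor C\<^esub>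
        coker_mult (TUnit (arrow_pushout_product C)) X \<circ>\<^bsub>arrow_tensor C\<^esub>
        (coker_unit \<otimes>\<^bsub>arrow_tensor C\<^esub> \<one>\<^bsub>arrow_tensor C\<^esub> (ObMap (coker_functor C) X)) =
      LUnit (arrow_tensor C) (ObMap (coker_functor C) X)"
      unfolding arrow_tensor_simps coker_functor_simps arrow_pushout_product_structure(3)
      by (rule cokernel_square_ext[of "pp_unit C \<box> X" "\<one> (TUnit C) \<otimes> coker C X"];
        (intro ck Ars ob pp_unit_simps(1))?; simp add: str ob)
    show "ArMap (coker_functor C) (RUnit (arrow_pushout_product C) X) \<circ>\<^bsub>arrow_tensor C\<^esub>
        coker_mult X (TUnit (arrow_pushout_product C)) \<circ>\<^bsub>arrow_tensor C\<^esub>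
        (\<one>\<^bsub>arrow_tensor C\<^esub> (ObMap (coker_functor C) X) \<otimes>\<^bsub>arrow_tensor C\<^esub> coker_unit) =
      RUnit (arrow_tensor C) (ObMap (coker_functor C) X)"
      unfolding arrow_tensor_simps coker_functor_simps arrow_pushout_product_structure(3)
      by (rule cokernel_square_ext[of "X \<box> pp_unit C" "coker C X \<otimes> \<one> (TUnit C)"];
        (intro ck Ars ob pp_unit_simps(1))?; simp add: str ob)
  next
    fix X Y
    assume "X \<in> Ob (arrow_pushout_product C)" "Y \<in> Ob (arrow_pushout_product C)"
    then have ob: "X \<in> Ar C" "Y \<in> Ar C"
      by simp_all
    show "ArMap (coker_functor C) (Symm (arrow_pushout_product C) X Y) \<circ>\<^bsub>arrow_tensor C\<^esub> coker_mult X Y =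
      coker_mult Y X \<circ>\<^bsub>arrow_tensor C\<^esub> Symm (arrow_tensor C) (ObMap (coker_functor C) X) (ObMap (coker_functor C) Y)"
      unfolding arrow_tensor_simps coker_functor_simps
      by (rule cokernel_square_ext[of "X \<box> Y" "coker C X \<otimes> coker C Y"];
        (intro ck Ars ob)?; simp add: str ob)
  qed (simp_all add: in_hom str coker_mult_Ar coker_mult_iso coker_unit_Ar coker_unit_iso)
qed


section \<open>Kernels are right adjoint to cokernels\<close>

lemma ker_simps [simp]:
  assumes "p \<in> Ar C"
  shows "ker C p \<in> Ar C" "Cod C (ker C p) = Dom C p"
    and ker_zero: "p \<circ> ker C p = zero_arrow (Dom C (ker C p)) (Cod C p)"
proof -
  note pb = is_pullbackD[OF is_pullback_pb_pr[of p "from_zero C (Cod C p)"]]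
  show "ker C p \<in> Ar C" "Cod C (ker C p) = Dom C p"
    using pb assms by (simp_all add: ker_def)
  have "pb_snd C p (from_zero C (Cod C p)) = to_zero C (Dom C (ker C p))"
    using pb assms by - (rule to_zero_ext, simp_all add: ker_def)
  then show "p \<circ> ker C p = zero_arrow (Dom C (ker C p)) (Cod C p)"
    using pb assms by (simp add: ker_def zero_arrow_def)
qed

lemma ker_ext:
  assumes "p \<in> Ar C" "u \<in> Ar C" "v \<in> Ar C" "Cod C u = Dom C (ker C p)" "Cod C v = Dom C (ker C p)"
    and "Dom C u = Dom C v" "ker C p \<circ> u = ker C p \<circ> v"
  shows "u = v"
proof -
  note pb = is_pullback_pb_pr[of p "from_zero C (Cod C p)"]
  note d = is_pullbackD[OF pb]
  have "pb_snd C p (from_zero C (Cod C p)) \<circ> u = pb_snd C p (from_zero C (Cod C p)) \<circ> v"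
    using assms d by - (rule to_zero_ext, simp_all add: ker_def)
  then show ?thesis
    using assms d by - (rule pullback_ext[OF pb], simp_all add: ker_def)
qed

lemma ker_lift:
  assumes p: "p \<in> Ar C" and x: "x \<in> Ar C" "Cod C x = Dom C p"
    and y: "y \<in> Ar C" "Cod C y = zero_ob C" "Dom C y = Dom C x"
    and eq: "p \<circ> x = zero_arrow (Dom C x) (Cod C p)"
  shows "pb_lift C p (from_zero C (Cod C p)) x y \<in> Ar C"
    "Cod C (pb_lift C p (from_zero C (Cod C p)) x y) = Dom C (ker C p)"
    "Dom C (pb_lift C p (from_zero C (Cod C p)) x y) = Dom C x"
    "ker C p \<circ> pb_lift C p (from_zero C (Cod C p)) x y = x"
proof -
  have "y = to_zero C (Dom C x)"
    using x y by - (rule to_zero_ext, simp_all)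
  then have "p \<circ> x = from_zero C (Cod C p) \<circ> y"
    using eq by (simp add: zero_arrow_def)
  from pb_lift_simps[OF _ _ _ _ _ _ _ _ this] show "pb_lift C p (from_zero C (Cod C p)) x y \<in> Ar C"
    "Cod C (pb_lift C p (from_zero C (Cod C p)) x y) = Dom C (ker C p)"
    "Dom C (pb_lift C p (from_zero C (Cod C p)) x y) = Dom C x"
    "ker C p \<circ> pb_lift C p (from_zero C (Cod C p)) x y = x"
    using p x y by (simp_all add: ker_def)
qed

lemma ker_square_ext:
  assumes "p \<in> Ar C" "s \<in> Ar (arrow_category C)" "t \<in> Ar (arrow_category C)"
    and "sq_src s = sq_src t" "sq_tgt s = ker C p" "sq_tgt t = ker C p" "sq1 s = sq1 t"
  shows "s = t"
proof -
  have "sq0 s = sq0 t"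
    by (rule ker_ext[OF assms(1)]) (use assms square_commutes[of s] square_commutes[of t] in auto)
  then show ?thesis
    using assms by (simp add: square.expand)
qed

lemma ker_functor_simps [simp]:
  "ObMap (ker_functor C) p = ker C p"
  "sq_src (ArMap (ker_functor C) s) = ker C (sq_src s)"
  "sq_tgt (ArMap (ker_functor C) s) = ker C (sq_tgt s)"
  "sq1 (ArMap (ker_functor C) s) = sq0 s"
  by (simp_all add: ker_functor_def)

lemma ker_functor_Ar:
  assumes s: "s \<in> Ar (arrow_category C)"
  shows "ArMap (ker_functor C) s \<in> Ar (arrow_category C)"
proof -
  let ?f = "sq_src s" and ?g = "sq_tgt s"
  note pb = is_pullbackD[OF is_pullback_pb_pr[of ?f "from_zero C (Cod C ?f)"]]
  have "?g \<circ> sq0 s \<circ> ker C ?f = sq1 s \<circ> ?f \<circ> ker C ?f"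
    using Comp_eq_Comp[OF square_commutes[OF s], of "ker C ?f"] s by simp
  also have "\<dots> = zero_arrow (Dom C (ker C ?f)) (Cod C ?g)"
    using s by (simp add: ker_zero)
  finally have "?g \<circ> sq0 s \<circ> ker C ?f = zero_arrow (Dom C (sq0 s \<circ> ker C ?f)) (Cod C ?g)"
    using s by simp
  from ker_lift[OF _ _ _ _ _ _ this, of "pb_snd C ?f (from_zero C (Cod C ?f))"] show ?thesis
    using pb s unfolding in_Ar_arrow_category ker_functor_def by (simp add: ker_def[of C ?f])
qed

lemma cat_functor_ker: "cat_functor (arrow_category C) (arrow_category C) (ker_functor C)"
  unfolding cat_functor_def cat_functor_axioms_def
proof (intro conjI allI impI category_arrow_category)
  fix f assume f: "f \<in> Ob (arrow_category C)"
  show "ArMap (ker_functor C) (Idt (arrow_category C) f) =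
      Idt (arrow_category C) (ObMap (ker_functor C) f)"
    by (rule ker_square_ext[of f])
      (use f Idt_square_Ar[of "ker C f"] in \<open>simp_all add: ker_functor_Ar Idt_square_Ar\<close>)
next
  fix s X Y t Z
  assume st: "s \<in> hom (arrow_category C) X Y" "t \<in> hom (arrow_category C) Y Z"
  show "ArMap (ker_functor C) (t \<circ>\<^bsub>arrow_category C\<^esub> s) =
      ArMap (ker_functor C) t \<circ>\<^bsub>arrow_category C\<^esub> ArMap (ker_functor C) s"
  proof (rule ker_square_ext[of Z])
    show "ArMap (ker_functor C) (t \<circ>\<^bsub>arrow_category C\<^esub> s) \<in> Ar (arrow_category C)"
      "ArMap (ker_functor C) t \<circ>\<^bsub>arrow_category C\<^esub> ArMap (ker_functor C) s \<in> Ar (arrow_category C)"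
      by (intro ker_functor_Ar arrow_Comp_Ar; use st in \<open>simp add: in_hom\<close>)+
  qed (use st in \<open>auto simp: in_hom\<close>)
qed (auto simp: in_hom ker_functor_Ar)

text \<open>The component \<open>sq0 s: Cod C f \<rightarrow> Dom C p\<close> is kept; the other component is induced by
  \<open>p \<circ> sq0 s \<circ> f = 0\<close>.\<close>

definition transpose :: "'m \<Rightarrow> 'm \<Rightarrow> 'm square \<Rightarrow> 'm square" where
  "transpose f p s = Square f (ker C p)
     (pb_lift C p (from_zero C (Cod C p)) (sq0 s \<circ> f) (to_zero C (Dom C f))) (sq0 s)"

lemma transpose_simps [simp]:
  "sq_src (transpose f p s) = f" "sq_tgt (transpose f p s) = ker C p" "sq1 (transpose f p s) = sq0 s"
  by (simp_all add: transpose_def)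

lemma transpose_Ar:
  assumes f: "f \<in> Ar C" and s: "s \<in> Ar (arrow_category C)" "sq_src s = coker C f" "sq_tgt s = p"
  shows "transpose f p s \<in> Ar (arrow_category C)"
proof -
  have s': "sq0 s \<in> Ar C" "Dom C (sq0 s) = Cod C f" "Cod C (sq0 s) = Dom C p" "p \<in> Ar C"
    using f s square_parts[OF s(1)] by simp_all
  have "p \<circ> sq0 s \<circ> f = sq1 s \<circ> coker C f \<circ> f"
    using Comp_eq_Comp[OF square_commutes[OF s(1)], of f] f s s' by simp
  also have "\<dots> = zero_arrow (Dom C (sq0 s \<circ> f)) (Cod C p)"
    using f s s' is_cokernelD(4)[OF is_cokernel_coker[OF f]] by simp
  finally have "p \<circ> sq0 s \<circ> f = zero_arrow (Dom C (sq0 s \<circ> f)) (Cod C p)" .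
  from ker_lift[OF s'(4) _ _ _ _ _ this, of "to_zero C (Dom C f)"] show ?thesis
    unfolding transpose_def in_Ar_arrow_category using f s' by simp
qed

text \<open>Both kinds of squares are determined by the component that transposition keeps, one because
  cokernels are epimorphisms and the other because kernels are monomorphisms. An arrow \<open>b\<close> is
  this component of a square of either kind exactly if \<open>p \<circ> b \<circ> f = 0\<close>.\<close>

lemma bij_betw_transpose:
  assumes f: "f \<in> Ar C" and p: "p \<in> Ar C"
  shows "bij_betw (transpose f p) (hom (arrow_category C) (coker C f) p) (hom (arrow_category C) f (ker C p))"
proof (rule bij_betwI')
  fix s t
  assume "s \<in> hom (arrow_category C) (coker C f) p" "t \<in> hom (arrow_category C) (coker C f) p"
  then show "transpose f p s = transpose f p t \<longleftrightarrow> s = t"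
    using cokernel_square_ext[OF is_cokernel_coker[OF f], of s t] by (auto simp: in_hom transpose_def)
next
  fix s assume "s \<in> hom (arrow_category C) (coker C f) p"
  then show "transpose f p s \<in> hom (arrow_category C) f (ker C p)"
    using transpose_Ar[OF f] by (simp add: in_hom)
next
  fix t assume "t \<in> hom (arrow_category C) f (ker C p)"
  then have t: "t \<in> Ar (arrow_category C)" "sq_src t = f" "sq_tgt t = ker C p"
    by (simp_all add: in_hom)
  have t': "sq0 t \<in> Ar C" "Dom C (sq0 t) = Dom C f" "Cod C (sq0 t) = Dom C (ker C p)"
    "sq1 t \<in> Ar C" "Dom C (sq1 t) = Cod C f" "Cod C (sq1 t) = Dom C p" "sq1 t \<circ> f = ker C p \<circ> sq0 t"
    using t p square_parts[OF t(1)] square_commutes[OF t(1)] by simp_all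
  have eq: "(p \<circ> sq1 t) \<circ> f = zero_arrow (Dom C f) (Cod C (p \<circ> sq1 t))"
    using t' f p Comp_eq_Comp[OF ker_zero[OF p], of "sq0 t"] by simp
  obtain c where c: "c \<in> Ar C" "Dom C c = Cod C (coker C f)" "Cod C c = Cod C (p \<circ> sq1 t)"
    "c \<circ> coker C f = p \<circ> sq1 t"
    by (rule cokernel_desc[OF is_cokernel_coker[OF f] _ _ eq]) (use t'(4-6) p in simp_all)
  define s where "s = Square (coker C f) p (sq1 t) c"
  have s: "s \<in> Ar (arrow_category C)" "sq_src s = coker C f" "sq_tgt s = p" "sq0 s = sq1 t"
    using c t' f p by (simp_all add: s_def in_Ar_arrow_category del: square_parts)
  have "t = transpose f p s"
    by (rule ker_square_ext[OF p]) (use t s transpose_Ar[OF f s(1-3)] in simp_all)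
  then show "\<exists>s \<in> hom (arrow_category C) (coker C f) p. t = transpose f p s"
    using s by (auto simp: in_hom)
qed

lemma is_right_adjoint_ker:
  "is_right_adjoint (arrow_category C) (arrow_category C) (coker_functor C) (ker_functor C)"
  unfolding is_right_adjoint_def
proof (intro conjI exI ballI)
  fix X Y assume "X \<in> Ob (arrow_category C)" "Y \<in> Ob (arrow_category C)"
  then show "bij_betw (transpose X Y) (hom (arrow_category C) (ObMap (coker_functor C) X) Y)
      (hom (arrow_category C) X (ObMap (ker_functor C) Y))"
    using bij_betw_transpose by simp
next
  fix X X' Y Y' a h b
  assume "X \<in> Ob (arrow_category C)" "X' \<in> Ob (arrow_category C)" "Y \<in> Ob (arrow_category C)"
    "Y' \<in> Ob (arrow_category C)" "a \<in> hom (arrow_category C) X' X"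
    "h \<in> hom (arrow_category C) (ObMap (coker_functor C) X) Y" "b \<in> hom (arrow_category C) Y Y'"
  then have ob: "X \<in> Ar C" "X' \<in> Ar C" "Y \<in> Ar C" "Y' \<in> Ar C"
    and a: "a \<in> Ar (arrow_category C)" "sq_src a = X'" "sq_tgt a = X"
    and h: "h \<in> Ar (arrow_category C)" "sq_src h = coker C X" "sq_tgt h = Y"
    and b: "b \<in> Ar (arrow_category C)" "sq_src b = Y" "sq_tgt b = Y'"
    by (simp_all add: in_hom)
  show "transpose X' Y' (b \<circ>\<^bsub>arrow_category C\<^esub> h \<circ>\<^bsub>arrow_category C\<^esub> ArMap (coker_functor C) a) =
      ArMap (ker_functor C) b \<circ>\<^bsub>arrow_category C\<^esub> transpose X Y h \<circ>\<^bsub>arrow_category C\<^esub> a"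
  proof (rule ker_square_ext[OF ob(4)])
    show "transpose X' Y' (b \<circ>\<^bsub>arrow_category C\<^esub> h \<circ>\<^bsub>arrow_category C\<^esub> ArMap (coker_functor C) a)
        \<in> Ar (arrow_category C)"
      by (intro transpose_Ar arrow_Comp_Ar coker_functor_Ar ob a h b; use a h b in simp)
    show "ArMap (ker_functor C) b \<circ>\<^bsub>arrow_category C\<^esub> transpose X Y h \<circ>\<^bsub>arrow_category C\<^esub> a
        \<in> Ar (arrow_category C)"
      by (intro transpose_Ar arrow_Comp_Ar ker_functor_Ar ob a h b; use a h b in simp)
  qed (use a h b in simp_all)
qed (rule cat_functor_coker cat_functor_ker)+

end

theorem theorem1p4:
  fixes C :: "('o, 'm) smcat"
  assumes "symmetric_monoidal_category C"
    and "closed_monoidal C"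
    and "infinite (UNIV :: 'i set)"
    and "bicomplete TYPE('i) C"
    and "pointed C"
  shows "strong_symmetric_monoidal_functor
           (arrow_pushout_product C) (arrow_tensor C) (coker_functor C) \<and>
         is_right_adjoint (arrow_category C) (arrow_category C) (coker_functor C) (ker_functor C)"
proof -
  interpret symmetric_monoidal_category C
    by fact
  interpret pointed_closed_monoidal_category C
    by unfold_locales
      (use assms(2,5) bicomplete_pushout[OF assms(3,4)] bicomplete_pullback[OF assms(3,4)] in simp_all)
  show ?thesis
    using strong_symmetric_monoidal_coker is_right_adjoint_ker
    by (auto simp: strong_symmetric_monoidal_functor_def)
qed

end
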